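(* Fix an integer $k\ge2$ and let $\ell=(3k+1)^{\log^{*}n}$. If there is an oracle (algorithm) solving $\mathbb{Z}\text{-}\mathsf{kOV}_{n,\ell+1}$ in $O(n^{k-\delta})$ time for some $\delta>0$, then it can be used to construct an $O(n^{k-\delta+o(1)})$ time algorithm for $\mathsf{kOV}_{n,c\log n}$, for an arbitrary constant $c>0$.
   Context: For vectors $y_1,\ldots,y_k\in\mathbb{Z}^m$, $\langle y_1,\ldots,y_k\rangle=\sum_{s=1}^m\prod_{t=1}^k y_t[s]$. $\mathsf{kOV}_{n,d}$: given $k$ sets $X_1,\ldots,X_k$ of $n$ vectors in $\{0,1\}^d$, decide whether there are $x_t\in X_t$ with $\langle x_1,\ldots,x_k\rangle=0$. $\mathbb{Z}\text{-}\mathsf{kOV}_{n,m}$: the same problem where the vectors lie in $\mathbb{Z}^m$. $\log^*$ is the iterated logarithm. Word-RAM model with word size $\Theta(\log n)$. *)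

theory Defs
  imports Complex_Main "HOL-Library.Landau_Symbols"
begin

text \<open>A family \<open>X\<close> of \<open>k\<close> collections of \<open>n\<close> integer vectors is a function of three indices
  (all from 0): \<open>X t i s\<close> is coordinate \<open>s\<close> of the \<open>i\<close>-th vector of the \<open>t\<close>-th collection.
  Values outside the index ranges are irrelevant. A collection may list a vector repeatedly; for
  \<open>2 ^ d < n\<close> there would otherwise be no instance over \<open>{0,1}\<close>.\<close>

definition kinner :: "nat \<Rightarrow> nat \<Rightarrow> (nat \<Rightarrow> nat \<Rightarrow> int) \<Rightarrow> int" where
  "kinner k m y = (\<Sum>s<m. \<Prod>t<k. y t s)"

definition kOV_yes :: "nat \<Rightarrow> nat \<Rightarrow> nat \<Rightarrow> (nat \<Rightarrow> nat \<Rightarrow> nat \<Rightarrow> int) \<Rightarrow> bool" where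
  "kOV_yes k n m X \<longleftrightarrow> (\<exists>i. (\<forall>t<k. i t < n) \<and> kinner k m (\<lambda>t. X t (i t)) = 0)"

definition log_star :: "nat \<Rightarrow> nat" where
  "log_star n = (LEAST j. (log 2 ^^ j) (real n) \<le> 1)"


section \<open>A word RAM\<close>

text \<open>Structured programs for a word RAM with word size \<open>w\<close>. Words are the naturals below
  \<open>2 ^ w\<close>. There are registers and memory banks of \<open>2 ^ w\<close> words, each bank indexed by words;
  register and bank numbers occur literally in programs, so a program uses finitely many of both.
  Every instruction and every test takes one time unit.\<close>

datatype binop = Add | Sub | Mul | Div | Mod | BitAnd | BitOr | BitXor | Shl | Shr | Lt | Equal

datatype com =
    Const nat nat             \<comment> \<open>\<open>r := c\<close>\<close>
  | Op binop nat nat nat      \<comment> \<open>\<open>r := r1 op r2\<close>\<close>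
  | Load nat nat nat          \<comment> \<open>\<open>r := bank b [a]\<close>\<close>
  | Store nat nat nat         \<comment> \<open>\<open>bank b [a] := r\<close>\<close>
  | Seq com com
  | Cond nat com com          \<comment> \<open>branch on \<open>r \<noteq> 0\<close>\<close>
  | While nat com             \<comment> \<open>loop as long as \<open>r \<noteq> 0\<close>\<close>
  | Call                      \<comment> \<open>place holder for a subroutine, see \<open>link\<close>\<close>

record state =
  reg :: "nat \<Rightarrow> nat"
  mem :: "nat \<Rightarrow> nat \<Rightarrow> nat"

fun binop_sem :: "nat \<Rightarrow> binop \<Rightarrow> nat \<Rightarrow> nat \<Rightarrow> nat" where
  "binop_sem w Add x y = (x + y) mod 2 ^ w"
| "binop_sem w Sub x y = (x + (2 ^ w - y)) mod 2 ^ w"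
| "binop_sem w Mul x y = (x * y) mod 2 ^ w"
| "binop_sem w Div x y = x div y"
| "binop_sem w Mod x y = x mod y"
| "binop_sem w BitAnd x y = Bit_Operations.and x y"
| "binop_sem w BitOr x y = Bit_Operations.or x y"
| "binop_sem w BitXor x y = Bit_Operations.xor x y"
| "binop_sem w Shl x y = (x * 2 ^ y) mod 2 ^ w"
| "binop_sem w Shr x y = x div 2 ^ y"
| "binop_sem w Lt x y = (if x < y then 1 else 0) mod 2 ^ w"
| "binop_sem w Equal x y = (if x = y then 1 else 0) mod 2 ^ w"

text \<open>\<open>exec w p s t s'\<close>: started in state \<open>s\<close>, the program \<open>p\<close> halts in state \<open>s'\<close> after
  exactly \<open>t\<close> time units. There is no rule for \<open>Call\<close>: executing an unlinked call never halts.\<close>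

inductive exec :: "nat \<Rightarrow> com \<Rightarrow> state \<Rightarrow> nat \<Rightarrow> state \<Rightarrow> bool" for w :: nat where
  Const: "exec w (Const r c) s 1 (s\<lparr>reg := (reg s)(r := c mod 2 ^ w)\<rparr>)"
| Op: "exec w (Op f r r1 r2) s 1 (s\<lparr>reg := (reg s)(r := binop_sem w f (reg s r1) (reg s r2))\<rparr>)"
| Load: "exec w (Load r b a) s 1 (s\<lparr>reg := (reg s)(r := mem s b (reg s a))\<rparr>)"
| Store: "exec w (Store b a r) s 1
    (s\<lparr>mem := (mem s)(b := (mem s b)(reg s a := reg s r))\<rparr>)"
| Seq: "exec w p s t s' \<Longrightarrow> exec w q s' t' s'' \<Longrightarrow> exec w (Seq p q) s (t + t') s''"
| CondTrue: "reg s r \<noteq> 0 \<Longrightarrow> exec w p s t s' \<Longrightarrow> exec w (Cond r p q) s (t + 1) s'"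
| CondFalse: "reg s r = 0 \<Longrightarrow> exec w q s t s' \<Longrightarrow> exec w (Cond r p q) s (t + 1) s'"
| WhileFalse: "reg s r = 0 \<Longrightarrow> exec w (While r p) s 1 s"
| WhileTrue: "reg s r \<noteq> 0 \<Longrightarrow> exec w p s t s' \<Longrightarrow> exec w (While r p) s' t' s''
    \<Longrightarrow> exec w (While r p) s (t + t' + 1) s''"

text \<open>\<open>link A R\<close> inserts the program \<open>A\<close> at every \<open>Call\<close> in \<open>R\<close>, with the registers and banks of
  \<open>A\<close> moved to the odd numbers. Thus \<open>R\<close> owns the even registers and banks, and register or
  bank \<open>j\<close> of the subroutine is visible to \<open>R\<close> under the number \<open>2 * j + 1\<close>. The running time of
  the linked program includes that of all subroutine calls.\<close>

fun rename_odd :: "com \<Rightarrow> com" where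
  "rename_odd (Const r c) = Const (2 * r + 1) c"
| "rename_odd (Op f r r1 r2) = Op f (2 * r + 1) (2 * r1 + 1) (2 * r2 + 1)"
| "rename_odd (Load r b a) = Load (2 * r + 1) (2 * b + 1) (2 * a + 1)"
| "rename_odd (Store b a r) = Store (2 * b + 1) (2 * a + 1) (2 * r + 1)"
| "rename_odd (Seq p q) = Seq (rename_odd p) (rename_odd q)"
| "rename_odd (Cond r p q) = Cond (2 * r + 1) (rename_odd p) (rename_odd q)"
| "rename_odd (While r p) = While (2 * r + 1) (rename_odd p)"
| "rename_odd Call = Call"

fun link :: "com \<Rightarrow> com \<Rightarrow> com" where
  "link A Call = rename_odd A"
| "link A (Seq p q) = Seq (link A p) (link A q)"
| "link A (Cond r p q) = Cond r (link A p) (link A q)"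
| "link A (While r p) = While r (link A p)"
| "link A p = p"


section \<open>Algorithms for the two problems\<close>

text \<open>An input state holds \<open>n\<close> in register 0, the dimension \<open>m\<close> in register 1 and the
  instance, one coordinate per word in two's complement, in bank 0. The rest of the state
  consists of arbitrary words; hence a program can be called again without clearing memory.\<close>

definition input_state ::
  "nat \<Rightarrow> nat \<Rightarrow> nat \<Rightarrow> nat \<Rightarrow> (nat \<Rightarrow> nat \<Rightarrow> nat \<Rightarrow> int) \<Rightarrow> state \<Rightarrow> bool" where
  "input_state w k n m X s \<longleftrightarrow>
     (\<forall>r. reg s r < 2 ^ w) \<and> (\<forall>b a. mem s b a < 2 ^ w) \<and>
     reg s 0 = n \<and> reg s 1 = m \<and>
     (\<forall>t<k. \<forall>i<n. \<forall>j<m. int (mem s 0 ((t * n + i) * m + j)) = X t i j mod 2 ^ w)"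

text \<open>\<open>P\<close> decides in time \<open>O(T n)\<close> whether \<open>k\<close> collections of \<open>n\<close> vectors of dimension \<open>d n\<close>,
  with coordinates in \<open>E w\<close>, contain vectors with inner product 0. The word size is
  \<open>\<Theta>(log n)\<close>: \<open>P\<close> has to work for every word size that is at least a sufficiently large
  constant times \<open>log n\<close>, and the constant hidden in the time bound may depend on the constant \<open>C\<close>
  bounding the word size from above. (The logarithm of \<open>n + 1\<close> is taken because \<open>log 2 1 = 0\<close>.)\<close>

definition decides_OV ::
  "nat \<Rightarrow> (nat \<Rightarrow> nat) \<Rightarrow> (nat \<Rightarrow> int set) \<Rightarrow> com \<Rightarrow> (nat \<Rightarrow> real) \<Rightarrow> bool" where
  "decides_OV k d E P T \<longleftrightarrow>
     (\<exists>C0::nat. \<forall>C::nat. \<exists>f \<in> O(T). \<forall>n\<ge>1. \<forall>w::nat.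
        real C0 * log 2 (real n + 1) \<le> real w \<and> real w \<le> real C * log 2 (real n + 1) \<longrightarrow>
        (\<forall>X s. (\<forall>t<k. \<forall>i<n. \<forall>j<d n. X t i j \<in> E w) \<and> input_state w k n (d n) X s \<longrightarrow>
           (\<exists>\<tau> s'. exec w P s \<tau> s' \<and> real \<tau> \<le> f n \<and>
              reg s' 0 = (if kOV_yes k n (d n) X then 1 else 0))))"

definition kOV_solver :: "nat \<Rightarrow> (nat \<Rightarrow> nat) \<Rightarrow> com \<Rightarrow> (nat \<Rightarrow> real) \<Rightarrow> bool" where
  "kOV_solver k d P T \<longleftrightarrow> decides_OV k d (\<lambda>w. {0, 1}) P T"

text \<open>Integer coordinates are those that fit into a machine word, i.e. have \<open>O(log n)\<close> bits.\<close>

definition ZkOV_solver :: "nat \<Rightarrow> (nat \<Rightarrow> nat) \<Rightarrow> com \<Rightarrow> (nat \<Rightarrow> real) \<Rightarrow> bool" where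
  "ZkOV_solver k d P T \<longleftrightarrow> decides_OV k d (\<lambda>w. {- (2 ^ (w - 1)) ..< 2 ^ (w - 1)}) P T"

end

theory Submission
  imports Defs "HOL-Number_Theory.Cong" "HOL-Real_Asymp.Real_Asymp"
begin

text \<open>Group the coordinates into \<open>l = (3 * k + 1) ^ log_star n\<close> columns of \<open>N\<close> bits each. A column is
  packed into one integer by iterated Chinese remaindering: at level \<open>i\<close>, blocks of \<open>m i\<close> codes
  below \<open>U i\<close> become the residues of one code modulo distinct primes above \<open>M i = l * U i ^ k\<close>. Such a
  prime exceeds every inner product of codes of level \<open>i\<close>, so the value of an inner product of top
  level codes determines, by iterated reduction, all inner products of the original bits; it is
  an inner product of orthogonal vectors iff all these residues are 0. As there are
  \<open>M i\<close> primes between \<open>M i\<close> and \<open>(M i)\<^sup>2\<close>, the number of bits per encoded bit grows by a factor of at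
  most \<open>3 * k\<close> per level, and \<open>log_star n\<close> levels suffice. Hence the top level codes have
  \<open>O((log n / l) * (3 * k) ^ log_star n * log l) = o(log n)\<close> bits, and it is affordable to ask the
  solver, for every value \<open>v\<close> of an inner product of orthogonal vectors, whether \<open>v\<close> is attained: this
  takes one more coordinate, with entries \<open>- v, 1, \<dots>, 1\<close>. For the same reason codes and primes
  can be found by exhaustive search. The remaining overhead is \<open>n ^ (1 + o(1))\<close>, which is harmless
  since no solver runs in sublinear time.\<close>

section \<open>Structured programs and weakest preconditions\<close>

text \<open>The constant 3 comes from one level of coding: the primes are at most the square of
  \<open>M i\<close>, a factor 2, and the logarithm of \<open>M i\<close> is log l plus k times that
  of \<open>U i\<close>, a factor \<open>k + 1\<close>; for \<open>k \<ge> 2\<close> this gives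
  \<open>2 + 2 * k \<le> 3 * k\<close>. The base of \<open>l\<close> has to exceed
  \<open>3 * k\<close>: what remains of the code length relative to log n is log l times the
  \<open>log_star n\<close>-th power of 3k / (3k + 1), and log l is only linear in
  \<open>log_star n\<close>. Few levels suffice because every level but the last uses all its
  \<open>M i\<close> primes, so that \<open>U\<close> grows at least like a tower of twos. Whether a
  value decodes to zeros depends on the moduli alone, hence the values are enumerated without
  looking at the vectors. All small loops share one bound \<open>B\<close> = n^{o(1)}, so together
  they cost a fixed power of \<open>B\<close>; only the construction of a query runs over all
  \<open>k * n\<close> vectors. This linear term is absorbed because a solver cannot have an
  exponent below 1, whatever \<delta> is assumed.\<close>

datatype ex = Num nat | Var nat | Bin binop ex ex | Ld nat ex

datatype stm =
    Asg nat ex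
  | Sto nat ex ex
  | Sq stm stm  (infixr ";;" 60)
  | Ite ex stm stm
  | Wh bool ex stm  \<comment> \<open>the flag selects the bound on the number of iterations, see \<open>tb\<close>\<close>
  | Cl

text \<open>Copying a register is its bitwise or with itself, as the RAM has no move instruction.
  Scratch registers advance in steps of 2 to stay among the even ones, which a linked subroutine
  never touches.\<close>

fun compE :: "ex \<Rightarrow> nat \<Rightarrow> com" where
  "compE (Num c) t = Const t c"
| "compE (Var x) t = Op BitOr t x x"
| "compE (Bin f a b) t = Seq (compE a t) (Seq (compE b (t + 2)) (Op f t t (t + 2)))"
| "compE (Ld b a) t = Seq (compE a t) (Load t b t)"

fun costE :: "ex \<Rightarrow> nat" where
  "costE (Num c) = 1"
| "costE (Var x) = 1"
| "costE (Bin f a b) = costE a + costE b + 1"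
| "costE (Ld b a) = costE a + 1"

fun compS :: "stm \<Rightarrow> com" where
  "compS (Asg x e) = Seq (compE e 100) (Op BitOr x 100 100)"
| "compS (Sto b a e) = Seq (compE a 100) (Seq (compE e 102) (Store b 100 102))"
| "compS (Sq p q) = Seq (compS p) (compS q)"
| "compS (Ite e p q) = Seq (compE e 100) (Cond 100 (compS p) (compS q))"
| "compS (Wh h e p) = Seq (compE e 100) (While 100 (Seq (compS p) (compE e 100)))"
| "compS Cl = Call"

text \<open>Even registers from 100 on hold intermediate results of expressions. The odd ones belong to the
  subroutine.\<close>

definition tmp :: "nat \<Rightarrow> bool" where "tmp x \<longleftrightarrow> even x \<and> x \<ge> 100"

fun cleanE :: "ex \<Rightarrow> bool" where
  "cleanE (Num c) = True"
| "cleanE (Var x) = (\<not> tmp x)"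
| "cleanE (Bin f a b) = (cleanE a \<and> cleanE b)"
| "cleanE (Ld b a) = cleanE a"

fun cleanS :: "stm \<Rightarrow> bool" where
  "cleanS (Asg x e) = (\<not> tmp x \<and> cleanE e)"
| "cleanS (Sto b a e) = (cleanE a \<and> cleanE e)"
| "cleanS (Sq p q) = (cleanS p \<and> cleanS q)"
| "cleanS (Ite e p q) = (cleanE e \<and> cleanS p \<and> cleanS q)"
| "cleanS (Wh h e p) = (cleanE e \<and> cleanS p)"
| "cleanS Cl = True"

text \<open>Exact arithmetic for addition, multiplication and left shift, with \<open>fits\<close>
  as the obligation to show. \<open>Sub\<close> keeps its wrap-around: \<open>buildP\<close> obtains
  the two's complement of \<open>- v\<close> as \<open>0 - v\<close>.\<close>

fun bop :: "nat \<Rightarrow> binop \<Rightarrow> nat \<Rightarrow> nat \<Rightarrow> nat" where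
  "bop w Add x y = x + y"
| "bop w Mul x y = x * y"
| "bop w Shl x y = x * 2 ^ y"
| "bop w Lt x y = (if x < y then 1 else 0)"
| "bop w Equal x y = (if x = y then 1 else 0)"
| "bop w f x y = binop_sem w f x y"

fun fits :: "nat \<Rightarrow> binop \<Rightarrow> nat \<Rightarrow> nat \<Rightarrow> bool" where
  "fits w Add x y = (x + y < 2 ^ w)"
| "fits w Mul x y = (x * y < 2 ^ w)"
| "fits w Shl x y = (x * 2 ^ y < 2 ^ w)"
| "fits w f x y = True"

fun ev :: "nat \<Rightarrow> ex \<Rightarrow> (nat \<Rightarrow> nat) \<Rightarrow> (nat \<Rightarrow> nat \<Rightarrow> nat) \<Rightarrow> nat" where
  "ev w (Num c) v m = c"
| "ev w (Var x) v m = v x"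
| "ev w (Bin f a b) v m = bop w f (ev w a v m) (ev w b v m)"
| "ev w (Ld b a) v m = m b (ev w a v m)"

fun okE :: "nat \<Rightarrow> ex \<Rightarrow> (nat \<Rightarrow> nat) \<Rightarrow> (nat \<Rightarrow> nat \<Rightarrow> nat) \<Rightarrow> bool" where
  "okE w (Num c) v m = (c < 2 ^ w)"
| "okE w (Var x) v m = True"
| "okE w (Bin f a b) v m = (okE w a v m \<and> okE w b v m \<and> fits w f (ev w a v m) (ev w b v m))"
| "okE w (Ld b a) v m = okE w a v m"

lemma binop_sem_fits: "w \<ge> 1 \<Longrightarrow> fits w f x y \<Longrightarrow> binop_sem w f x y = bop w f x y"
  by (cases f) (auto simp: one_less_power intro!: mod_less)

definition words :: "nat \<Rightarrow> state \<Rightarrow> bool" where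
  "words w s \<longleftrightarrow> (\<forall>r. reg s r < 2 ^ w) \<and> (\<forall>b a. mem s b a < 2 ^ w)"

lemma binop_sem_less:
  assumes "x < 2 ^ w" "y < 2 ^ w" shows "binop_sem w f x y < 2 ^ w"
proof -
  \<comment> \<open>Being below \<open>2 ^ w\<close> is invariance under \<open>take_bit w\<close>,
    which distributes over and, or and xor.\<close>
  have bits: "\<And>z::nat. z < 2 ^ w \<longleftrightarrow> take_bit w z = z"
    by (simp add: take_bit_nat_eq_self_iff)
  have 1: "and x y < 2 ^ w" "or x y < 2 ^ w" "xor x y < 2 ^ w"
    using assms by (simp_all add: bits)
  have 2: "x div z < 2 ^ w" "x mod z < 2 ^ w" for z
    using assms(1) div_le_dividend[of x z] mod_less_eq_dividend[of x z] by linarith+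
  show ?thesis using 1 2 by (cases f) simp_all
qed

lemma exec_words: "exec w p s t s' \<Longrightarrow> words w s \<Longrightarrow> words w s'"
  by (induction rule: exec.induct) (auto simp: words_def binop_sem_less)

lemma link_compE [simp]: "link A (compE e t) = compE e t"
  by (induction e arbitrary: t) auto

text \<open>The frame condition carries the induction: registers below \<open>t\<close> survive, so
  in \<open>Bin\<close> the left operand in \<open>t\<close> is still there after the right one has
  been computed into \<open>t + 2\<close>.\<close>

lemma exec_compE:
  assumes "w \<ge> 1"
  shows "cleanE e \<Longrightarrow> tmp t \<Longrightarrow> okE w e v (mem s) \<Longrightarrow> \<forall>x. \<not> tmp x \<longrightarrow> reg s x = v x \<Longrightarrow>
    \<exists>s'. exec w (compE e t) s (costE e) s' \<and> reg s' t = ev w e v (mem s) \<and>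
      (\<forall>x. x < t \<or> \<not> tmp x \<longrightarrow> reg s' x = reg s x) \<and> mem s' = mem s"
proof (induction e arbitrary: t s)
  case (Num c)
  then show ?case
    using exec.Const[of w t c s]
    by (intro exI[of _ "s\<lparr>reg := (reg s)(t := c mod 2 ^ w)\<rparr>"]) auto
next
  case (Var x)
  then show ?case
    using exec.Op[of w BitOr t x x s]
    by (intro exI[of _ "s\<lparr>reg := (reg s)(t := v x)\<rparr>"]) auto
next
  case (Bin f a b)
  obtain s1 where s1: "exec w (compE a t) s (costE a) s1" "reg s1 t = ev w a v (mem s)"
    "\<forall>x. x < t \<or> \<not> tmp x \<longrightarrow> reg s1 x = reg s x" "mem s1 = mem s"
    using Bin.IH(1)[of t s] Bin.prems by auto
  obtain s2 where s2: "exec w (compE b (t + 2)) s1 (costE b) s2" "reg s2 (t + 2) = ev w b v (mem s)"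
    "\<forall>x. x < t + 2 \<or> \<not> tmp x \<longrightarrow> reg s2 x = reg s1 x" "mem s2 = mem s"
    using Bin.IH(2)[of "t + 2" s1] Bin.prems s1 by (auto simp: tmp_def)
  have val: "binop_sem w f (reg s2 t) (reg s2 (t + 2)) = ev w (Bin f a b) v (mem s)"
    using s1 s2 Bin.prems binop_sem_fits[OF assms] by simp
  have "exec w (compE (Bin f a b) t) s (costE (Bin f a b))
      (s2\<lparr>reg := (reg s2)(t := ev w (Bin f a b) v (mem s))\<rparr>)"
    using exec.Seq[OF s1(1) exec.Seq[OF s2(1) exec.Op[of w f t t "t + 2" s2]]]
    unfolding val by simp
  then show ?case
    using s1(3,4) s2(3,4) Bin.prems(2)
    by (intro exI[of _ "s2\<lparr>reg := (reg s2)(t := ev w (Bin f a b) v (mem s))\<rparr>"])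
       (auto simp del: ev.simps compE.simps costE.simps)
next
  case (Ld b a)
  obtain s1 where s1: "exec w (compE a t) s (costE a) s1" "reg s1 t = ev w a v (mem s)"
    "\<forall>x. x < t \<or> \<not> tmp x \<longrightarrow> reg s1 x = reg s x" "mem s1 = mem s"
    using Ld.IH[of t s] Ld.prems by auto
  show ?case
    using exec.Seq[OF s1(1) exec.Load[of w t b t]] s1 Ld.prems(2)
    by (intro exI[of _ "s1\<lparr>reg := (reg s1)(t := mem s b (ev w a v (mem s)))\<rparr>"]) auto
qed

text \<open>A worst case read off the program text: both branches are charged, a loop with flag
  \<open>h\<close> gets \<open>b h\<close> iterations, a call costs \<open>T\<close>. It can
  therefore be estimated separately from correctness, see \<open>tb_lin\<close>.\<close>

fun tb :: "(bool \<Rightarrow> nat) \<Rightarrow> nat \<Rightarrow> stm \<Rightarrow> nat" where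
  "tb b T (Asg x e) = costE e + 1"
| "tb b T (Sto c a e) = costE a + costE e + 1"
| "tb b T (Sq p q) = tb b T p + tb b T q"
| "tb b T (Ite e p q) = costE e + 1 + tb b T p + tb b T q"
| "tb b T (Wh h e p) = costE e + 1 + b h * (tb b T p + costE e + 1)"
| "tb b T Cl = T"

locale ram =
  fixes w :: nat and A :: com and b :: "bool \<Rightarrow> nat" and T :: nat
  assumes w1: "w \<ge> 1"
begin

definition rep :: "state \<Rightarrow> (nat \<Rightarrow> nat) \<Rightarrow> (nat \<Rightarrow> nat \<Rightarrow> nat) \<Rightarrow> bool" where
  "rep s v m \<longleftrightarrow> words w s \<and> (\<forall>x. \<not> tmp x \<longrightarrow> reg s x = v x) \<and> mem s = m"

text \<open>Total correctness together with the time bound \<open>tb\<close>. \<open>cleanS\<close>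
  is a premise inside the definition so that it is discharged once, for the whole program, and not
  at every rule application.\<close>

definition wp :: "stm \<Rightarrow> ((nat \<Rightarrow> nat) \<Rightarrow> (nat \<Rightarrow> nat \<Rightarrow> nat) \<Rightarrow> bool) \<Rightarrow>
    (nat \<Rightarrow> nat) \<Rightarrow> (nat \<Rightarrow> nat \<Rightarrow> nat) \<Rightarrow> bool" where
  "wp p Q v m \<longleftrightarrow> (cleanS p \<longrightarrow> (\<forall>s. rep s v m \<longrightarrow>
     (\<exists>\<tau> s' v' m'. exec w (link A (compS p)) s \<tau> s' \<and> \<tau> \<le> tb b T p \<and> rep s' v' m' \<and> Q v' m')))"

lemma rep_compE:
  assumes "rep s v m" "cleanE e" "tmp t" "okE w e v m"
  obtains s' where "exec w (compE e t) s (costE e) s'" "reg s' t = ev w e v m"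
      "\<And>x. x < t \<Longrightarrow> reg s' x = reg s x" "rep s' v m"
  using exec_compE[OF w1, of e t v s] assms exec_words[of w "compE e t" s]
  unfolding rep_def by metis

lemma wp_Asg:
  assumes "okE w e v m" "Q (v(x := ev w e v m)) m"
  shows "wp (Asg x e) Q v m"
  unfolding wp_def
proof (intro impI allI)
  fix s assume c: "cleanS (Asg x e)" and r: "rep s v m"
  obtain s1 where s1: "exec w (compE e 100) s (costE e) s1" "reg s1 100 = ev w e v m" "rep s1 v m"
    using rep_compE[OF r, of e 100] c assms(1) by (auto simp: tmp_def)
  have e: "exec w (link A (compS (Asg x e))) s (costE e + 1)
      (s1\<lparr>reg := (reg s1)(x := ev w e v m)\<rparr>)"
    using exec.Seq[OF s1(1) exec.Op[of w BitOr x 100 100 s1]] s1(2) by simp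
  moreover have "rep (s1\<lparr>reg := (reg s1)(x := ev w e v m)\<rparr>) (v(x := ev w e v m)) m"
    using s1(3) exec_words[OF e] r by (auto simp: rep_def)
  ultimately show "\<exists>\<tau> s' v' m'. exec w (link A (compS (Asg x e))) s \<tau> s' \<and>
      \<tau> \<le> tb b T (Asg x e) \<and> rep s' v' m' \<and> Q v' m'"
    using assms(2)
    by (intro exI[of _ "costE e + 1"] exI[of _ "s1\<lparr>reg := (reg s1)(x := ev w e v m)\<rparr>"]) auto
qed

lemma wp_Sto:
  assumes "okE w a v m" "okE w e v m"
    "Q v (m(c := (m c)(ev w a v m := ev w e v m)))"
  shows "wp (Sto c a e) Q v m"
  unfolding wp_def
proof (intro impI allI)
  fix s assume c: "cleanS (Sto c a e)" and r: "rep s v m"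
  obtain s1 where s1: "exec w (compE a 100) s (costE a) s1" "reg s1 100 = ev w a v m" "rep s1 v m"
    using rep_compE[OF r, of a 100] c assms(1) by (auto simp: tmp_def)
  obtain s2 where s2: "exec w (compE e 102) s1 (costE e) s2" "reg s2 102 = ev w e v m"
    "reg s2 100 = ev w a v m" "rep s2 v m"
  proof -
    have "cleanE e" "tmp 102" "(100::nat) < 102" using c by (auto simp: tmp_def)
    then show thesis using rep_compE[OF s1(3) _ _ assms(2), of 102] that s1(2) by metis
  qed
  define s3 where "s3 = s2\<lparr>mem := m(c := (m c)(ev w a v m := ev w e v m))\<rparr>"
  have e: "exec w (link A (compS (Sto c a e))) s (costE a + costE e + 1) s3"
    using exec.Seq[OF s1(1) exec.Seq[OF s2(1) exec.Store[of w c 100 102 s2]]] s2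
    by (simp add: s3_def rep_def)
  moreover have "rep s3 v (m(c := (m c)(ev w a v m := ev w e v m)))"
    using s2 exec_words[OF e] r by (auto simp: rep_def s3_def)
  ultimately show "\<exists>\<tau> s' v' m'. exec w (link A (compS (Sto c a e))) s \<tau> s' \<and>
      \<tau> \<le> tb b T (Sto c a e) \<and> rep s' v' m' \<and> Q v' m'"
    using assms(3)
    by (intro exI[of _ "costE a + costE e + 1"] exI[of _ s3] exI[of _ v] exI) auto
qed

lemma wp_Sq:
  assumes "wp p (\<lambda>v m. wp q Q v m) v m"
  shows "wp (p ;; q) Q v m"
  unfolding wp_def
proof (intro impI allI)
  fix s assume c: "cleanS (p ;; q)" and r: "rep s v m"
  obtain t1 s1 v1 m1 where 1: "exec w (link A (compS p)) s t1 s1" "t1 \<le> tb b T p" "rep s1 v1 m1"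
    "wp q Q v1 m1"
    using assms c r unfolding wp_def[of p] by (metis cleanS.simps(3))
  obtain t2 s2 v2 m2 where 2: "exec w (link A (compS q)) s1 t2 s2" "t2 \<le> tb b T q" "rep s2 v2 m2"
    "Q v2 m2"
    using 1 c unfolding wp_def[of q] by (metis cleanS.simps(3))
  show "\<exists>\<tau> s' v' m'. exec w (link A (compS (p ;; q))) s \<tau> s' \<and>
      \<tau> \<le> tb b T (p ;; q) \<and> rep s' v' m' \<and> Q v' m'"
    using exec.Seq[OF 1(1) 2(1)] 1(2) 2(2-4) by (metis add_mono compS.simps(3) link.simps(2) tb.simps(3))
qed

lemma wp_Ite:
  assumes "okE w e v m" "ev w e v m \<noteq> 0 \<Longrightarrow> wp p Q v m" "ev w e v m = 0 \<Longrightarrow> wp q Q v m"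
  shows "wp (Ite e p q) Q v m"
  unfolding wp_def
proof (intro impI allI)
  fix s assume c: "cleanS (Ite e p q)" and r: "rep s v m"
  obtain s1 where s1: "exec w (compE e 100) s (costE e) s1" "reg s1 100 = ev w e v m" "rep s1 v m"
    using rep_compE[OF r, of e 100] c assms(1) by (auto simp: tmp_def)
  show "\<exists>\<tau> s' v' m'. exec w (link A (compS (Ite e p q))) s \<tau> s' \<and>
      \<tau> \<le> tb b T (Ite e p q) \<and> rep s' v' m' \<and> Q v' m'"
  proof (cases "ev w e v m = 0")
    case False
    then obtain t2 s2 v2 m2 where 2: "exec w (link A (compS p)) s1 t2 s2" "t2 \<le> tb b T p"
        "rep s2 v2 m2" "Q v2 m2"
      using assms(2) s1(3) c unfolding wp_def by (metis cleanS.simps(4))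
    have "exec w (link A (compS (Ite e p q))) s (costE e + (t2 + 1)) s2"
      using exec.Seq[OF s1(1) exec.CondTrue[OF _ 2(1)]] s1(2) False by simp
    then show ?thesis using 2 by (intro exI[of _ "costE e + (t2 + 1)"] exI[of _ s2]) auto
  next
    case True
    then obtain t2 s2 v2 m2 where 2: "exec w (link A (compS q)) s1 t2 s2" "t2 \<le> tb b T q"
        "rep s2 v2 m2" "Q v2 m2"
      using assms(3) s1(3) c unfolding wp_def by (metis cleanS.simps(4))
    have "exec w (link A (compS (Ite e p q))) s (costE e + (t2 + 1)) s2"
      using exec.Seq[OF s1(1) exec.CondFalse[OF _ 2(1)]] s1(2) True by simp
    then show ?thesis using 2 by (intro exI[of _ "costE e + (t2 + 1)"] exI[of _ s2]) auto
  qed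
qed

lemma wp_conseq:
  assumes "wp p Q v m" "\<And>v m. Q v m \<Longrightarrow> Q' v m"
  shows "wp p Q' v m"
  using assms unfolding wp_def by meson

text \<open>A variant that drops in every iteration bounds the number of iterations by its initial
  value; hence only that value is compared with \<open>b h\<close>.\<close>

lemma wp_Wh:
  assumes "I v m" and ok: "\<And>v m. I v m \<Longrightarrow> okE w e v m"
    and body: "\<And>v m. I v m \<Longrightarrow> ev w e v m \<noteq> 0 \<Longrightarrow>
      wp p (\<lambda>v' m'. I v' m' \<and> (\<mu> v' m' :: nat) < \<mu> v m) v m"
    and fin: "\<And>v m. I v m \<Longrightarrow> ev w e v m = 0 \<Longrightarrow> Q v m"
    and bd: "\<mu> v m \<le> b h"
  shows "wp (Wh h e p) Q v m"
  unfolding wp_def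
proof (intro impI allI)
  fix s assume c: "cleanS (Wh h e p)" and r: "rep s v m"
  let ?L = "While 100 (Seq (link A (compS p)) (compE e 100))"
  \<comment> \<open>Induction on the variant for the bare machine loop: on entry register 100
    already holds the value of the test, which the compiled body recomputes at its end.\<close>
  have *: "I v m \<Longrightarrow> rep s v m \<Longrightarrow> reg s 100 = ev w e v m \<Longrightarrow>
      \<exists>\<tau> s' v' m'. exec w ?L s \<tau> s' \<and> \<tau> \<le> \<mu> v m * (tb b T p + costE e + 1) + 1 \<and>
        rep s' v' m' \<and> Q v' m'" for s v m
  proof (induction "\<mu> v m" arbitrary: s v m rule: less_induct)
    case less
    show ?case
    proof (cases "ev w e v m = 0")
      case True
      then show ?thesis
        using exec.WhileFalse[of s 100 w] fin less.prems by fastforce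
    next
      case False
      obtain t1 s1 v1 m1 where 1: "exec w (link A (compS p)) s t1 s1" "t1 \<le> tb b T p"
          "rep s1 v1 m1" "I v1 m1" "\<mu> v1 m1 < \<mu> v m"
        using body[OF less.prems(1) False] less.prems(2) c unfolding wp_def
        by (metis cleanS.simps(5))
      obtain s2 where 2: "exec w (compE e 100) s1 (costE e) s2" "reg s2 100 = ev w e v1 m1"
          "rep s2 v1 m1"
        using rep_compE[OF 1(3), of e 100] c ok[OF 1(4)] by (auto simp: tmp_def)
      obtain \<tau> s' v' m' where 3: "exec w ?L s2 \<tau> s'" "\<tau> \<le> \<mu> v1 m1 * (tb b T p + costE e + 1) + 1"
          "rep s' v' m'" "Q v' m'"
        using less.hyps[OF 1(5) 1(4) 2(3) 2(2)] by blast
      have "Suc (\<mu> v1 m1) * (tb b T p + costE e + 1) \<le> \<mu> v m * (tb b T p + costE e + 1)"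
        using 1(5) by (intro mult_right_mono) auto
      then have "(t1 + costE e) + \<tau> + 1 \<le> \<mu> v m * (tb b T p + costE e + 1) + 1"
        using 1(2) 3(2) by simp
      moreover have "exec w ?L s ((t1 + costE e) + \<tau> + 1) s'"
        using exec.WhileTrue[OF _ exec.Seq[OF 1(1) 2(1)] 3(1)] less.prems(3) False by simp
      ultimately show ?thesis using 3 by blast
    qed
  qed
  obtain s1 where s1: "exec w (compE e 100) s (costE e) s1" "reg s1 100 = ev w e v m" "rep s1 v m"
    using rep_compE[OF r, of e 100] c ok[OF assms(1)] by (auto simp: tmp_def)
  obtain \<tau> s' v' m' where 3: "exec w ?L s1 \<tau> s'" "\<tau> \<le> \<mu> v m * (tb b T p + costE e + 1) + 1"
      "rep s' v' m'" "Q v' m'"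
    using *[OF assms(1) s1(3,2)] by blast
  have "\<mu> v m * (tb b T p + costE e + 1) \<le> b h * (tb b T p + costE e + 1)"
    using bd by (rule mult_right_mono) simp
  then have "costE e + \<tau> \<le> tb b T (Wh h e p)" using 3(2) by simp
  moreover have "exec w (link A (compS (Wh h e p))) s (costE e + \<tau>) s'"
    using exec.Seq[OF s1(1) 3(1)] by simp
  ultimately show "\<exists>\<tau> s' v' m'. exec w (link A (compS (Wh h e p))) s \<tau> s' \<and>
      \<tau> \<le> tb b T (Wh h e p) \<and> rep s' v' m' \<and> Q v' m'"
    using 3 by blast
qed

end

section \<open>Running a subroutine on the odd half of the state\<close>

definition odd_part :: "state \<Rightarrow> state" where
  "odd_part S = \<lparr>reg = \<lambda>x. reg S (2 * x + 1), mem = \<lambda>c. mem S (2 * c + 1)\<rparr>"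

definition even_part :: "state \<Rightarrow> state" where
  "even_part S = \<lparr>reg = \<lambda>x. reg S (2 * x), mem = \<lambda>c. mem S (2 * c)\<rparr>"

lemma odd_part_reg [simp]:
  "odd_part (S\<lparr>reg := (reg S)(2 * r + 1 := y)\<rparr>) = (odd_part S)\<lparr>reg := (reg (odd_part S))(r := y)\<rparr>"
  "odd_part (S\<lparr>mem := (mem S)(2 * r + 1 := f)\<rparr>) = (odd_part S)\<lparr>mem := (mem (odd_part S))(r := f)\<rparr>"
  by (auto simp: odd_part_def fun_eq_iff)

lemma odd_ne_even: "2 * x \<noteq> Suc (2 * (y::nat))" by presburger

lemma even_part_reg [simp]:
  "even_part (S\<lparr>reg := (reg S)(2 * r + 1 := y)\<rparr>) = even_part S"
  "even_part (S\<lparr>mem := (mem S)(2 * r + 1 := f)\<rparr>) = even_part S"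
  by (simp_all add: even_part_def fun_eq_iff odd_ne_even)

lemma reg_odd_part: "reg S (2 * x + 1) = reg (odd_part S) x" "mem S (2 * x + 1) = mem (odd_part S) x"
  by (simp_all add: odd_part_def)

text \<open>A renamed program reads and writes odd registers and banks only, so a run on the odd
  half lifts step by step and leaves the even half alone.\<close>

lemma exec_rename_odd:
  "exec w p s t s' \<Longrightarrow> odd_part S = s \<Longrightarrow>
    \<exists>S'. exec w (rename_odd p) S t S' \<and> odd_part S' = s' \<and> even_part S' = even_part S"
proof (induction arbitrary: S rule: exec.induct)
  case (Const r c s)
  show ?case
    using Const exec.Const[of w "2 * r + 1" c S] by (metis odd_part_reg(1) even_part_reg(1) rename_odd.simps(1))
next
  case (Op f r r1 r2 s)
  show ?case
    using Op exec.Op[of w f "2 * r + 1" "2 * r1 + 1" "2 * r2 + 1" S]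
    by (metis odd_part_reg(1) even_part_reg(1) rename_odd.simps(2) reg_odd_part)
next
  case (Load r b a s)
  show ?case
    using Load exec.Load[of w "2 * r + 1" "2 * b + 1" "2 * a + 1" S]
    by (metis odd_part_reg(1) even_part_reg(1) rename_odd.simps(3) reg_odd_part)
next
  case (Store b a r s)
  show ?case
    using Store exec.Store[of w "2 * b + 1" "2 * a + 1" "2 * r + 1" S]
    by (metis odd_part_reg(2) even_part_reg(2) rename_odd.simps(4) reg_odd_part)
next
  case (Seq p s t s' q t' s'')
  then show ?case by (metis exec.Seq rename_odd.simps(5))
next
  case (CondTrue s r p t s' q)
  then show ?case by (metis exec.CondTrue rename_odd.simps(6) reg_odd_part(1))
next
  case (CondFalse s r q t s' p)
  then show ?case by (metis exec.CondFalse rename_odd.simps(6) reg_odd_part(1))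
next
  case (WhileFalse s r p)
  then show ?case by (metis exec.WhileFalse rename_odd.simps(7) reg_odd_part(1))
next
  case (WhileTrue s r p t s' t' s'')
  then show ?case by (metis exec.WhileTrue rename_odd.simps(7) reg_odd_part(1))
qed

context ram begin

text \<open>Everything even survives the call; of the odd part only the answer is known afterwards.
  This is why the query is rebuilt before each call.\<close>

lemma wp_Cl:
  assumes solver: "\<And>s. input_state w k n d X s \<Longrightarrow>
      \<exists>\<tau> s'. exec w A s \<tau> s' \<and> \<tau> \<le> T \<and> reg s' 0 = ans"
    and "v 1 = n" "v 3 = d"
    and "\<And>t i j. t < k \<Longrightarrow> i < n \<Longrightarrow> j < d \<Longrightarrow> int (m 1 ((t * n + i) * d + j)) = X t i j mod 2 ^ w"
    and post: "\<And>v' m'. (\<forall>x. even x \<longrightarrow> v' x = v x) \<Longrightarrow> (\<forall>c. even c \<longrightarrow> m' c = m c) \<Longrightarrow> v' 1 = ans \<Longrightarrow>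
      Q v' m'"
  shows "wp Cl Q v m"
  unfolding wp_def
proof (intro impI allI)
  fix s assume r: "rep s v m"
  let ?s = "odd_part s"
  have [simp]: "\<not> tmp (Suc 0)" by (simp add: tmp_def)
  have "\<not> tmp 1" "\<not> tmp 3" by (auto simp: tmp_def)
  then have "reg s 1 = n" "reg s 3 = d" "mem s = m" "words w s"
    using r assms(2,3) by (auto simp: rep_def)
  then have "input_state w k n d X ?s"
    using assms(4) unfolding input_state_def words_def odd_part_def
    by (simp add: numeral_3_eq_3)
  then obtain \<tau> s' where 1: "exec w A ?s \<tau> s'" "\<tau> \<le> T" "reg s' 0 = ans"
    using solver by blast
  obtain S' where S': "exec w (rename_odd A) s \<tau> S'" "odd_part S' = s'"
      "even_part S' = even_part s"
    using exec_rename_odd[OF 1(1)] by auto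
  have ev: "reg S' x = reg s x" "mem S' x = mem s x" if "even x" for x
    using that arg_cong[OF S'(3), of "\<lambda>u. reg u (x div 2)"] arg_cong[OF S'(3), of "\<lambda>u. mem u (x div 2)"]
    by (simp_all add: even_part_def)
  have res: "reg S' 1 = ans"
    using arg_cong[OF S'(2), of "\<lambda>u. reg u 0"] 1(3) by (simp add: odd_part_def)
  \<comment> \<open>\<open>rep\<close> ignores scratch registers, so \<open>v'\<close> may keep the
    old values there; the frame condition then holds at all even registers.\<close>
  define v' where "v' = (\<lambda>x. if tmp x then v x else reg S' x)"
  have "rep S' v' (mem S')"
    using r exec_words[OF S'(1)] by (simp add: rep_def v'_def)
  moreover have "Q v' (mem S')"
    using r ev res by (intro post) (simp_all add: v'_def rep_def)
  ultimately show "\<exists>\<tau> s' v' m'. exec w (link A (compS Cl)) s \<tau> s' \<and> \<tau> \<le> tb b T Cl \<and>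
      rep s' v' m' \<and> Q v' m'"
    using S'(1) 1(2) by (intro exI[of _ \<tau>] exI[of _ S'] exI[of _ v'] exI[of _ "mem S'"]) simp
qed

end

section \<open>Many primes between a number and its square\<close>

lemma multiplicity_fact_sum:
  assumes "prime (p::nat)"
  shows "multiplicity p (fact n) = (\<Sum>i\<in>{1..n}. multiplicity p i)"
proof (induction n)
  case (Suc n)
  have "multiplicity p (Suc n * fact n) = multiplicity p (Suc n) + multiplicity p (fact n)"
    using assms by (intro prime_elem_multiplicity_mult_distrib) auto
  then show ?case using Suc by simp
qed simp

lemma multiplicity_eq_card:
  assumes "prime (p::nat)" "i > 0" "i < p ^ L"
  shows "multiplicity p i = card {e\<in>{1..<L}. p ^ e dvd i}"
proof -
  have "p ^ multiplicity p i \<le> i" using assms by (simp add: dvd_imp_le multiplicity_dvd)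
  then have "p ^ multiplicity p i < p ^ L" using assms by linarith
  then have "multiplicity p i < L" using assms prime_gt_1_nat power_less_imp_less_exp by blast
  moreover have "p ^ e dvd i \<longleftrightarrow> e \<le> multiplicity p i" for e
    using assms prime_gt_1_nat by (intro power_dvd_iff_le_multiplicity) auto
  ultimately have "{e\<in>{1..<L}. p ^ e dvd i} = {1..multiplicity p i}"
    unfolding set_eq_iff mem_Collect_eq atLeastAtMost_iff atLeastLessThan_iff
    by (meson order.strict_trans1)
  then show ?thesis by (metis card_atLeastAtMost diff_Suc_1)
qed

text \<open>Legendre's formula, by double counting the pairs of \<open>i\<close> and
  \<open>e\<close> with \<open>p ^ e dvd i\<close>. The exponent \<open>L\<close> truncates the sum
  where all further terms vanish.\<close>

lemma legendre:
  assumes "prime (p::nat)" "n < p ^ L"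
  shows "multiplicity p (fact n) = (\<Sum>e\<in>{1..<L}. n div p ^ e)"
proof -
  have "multiplicity p (fact n) = (\<Sum>i\<in>{1..n}. card {e\<in>{1..<L}. p ^ e dvd i})"
    unfolding multiplicity_fact_sum[OF assms(1)]
    by (intro sum.cong refl multiplicity_eq_card) (use assms in auto)
  also have "\<dots> = (\<Sum>i\<in>{1..n}. \<Sum>e\<in>{1..<L}. if p ^ e dvd i then 1 else 0)"
    by (simp only: card_eq_sum sum.inter_filter finite_atLeastLessThan finite_atLeastAtMost)
  also have "\<dots> = (\<Sum>e\<in>{1..<L}. \<Sum>i\<in>{1..n}. if p ^ e dvd i then 1 else 0)"
    by (rule sum.swap)
  also have "\<dots> = (\<Sum>e\<in>{1..<L}. card {i\<in>{1..n}. p ^ e dvd i})"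
    by (simp only: card_eq_sum sum.inter_filter finite_atLeastLessThan finite_atLeastAtMost)
  also have "\<dots> = (\<Sum>e\<in>{1..<L}. n div p ^ e)"
  proof (intro sum.cong refl)
    fix e
    have pos: "p ^ e > 0" using assms(1) prime_gt_0_nat by simp
    have "{i\<in>{1..n}. p ^ e dvd i} = (\<lambda>j. p ^ e * j) ` {1..n div p ^ e}"
      using pos by (auto simp: dvd_def image_iff less_eq_div_iff_mult_less_eq mult.commute Suc_le_eq)
    moreover have "inj_on (\<lambda>j. p ^ e * j) {1..n div p ^ e}" using pos by (auto simp: inj_on_def)
    ultimately show "card {i\<in>{1..n}. p ^ e dvd i} = n div p ^ e" by (simp add: card_image)
  qed
  finally show ?thesis .
qed

text \<open>By Legendre's formula each exponent \<open>e\<close> contributes at most 1 to the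
  multiplicity, as \<open>(2 * n) div p ^ e\<close> exceeds \<open>2 * (n div p ^ e)\<close> by at
  most 1, and only exponents with \<open>p ^ e \<le> 2 * n\<close> contribute.\<close>

lemma prime_power_central_binomial_le:
  assumes "prime (p::nat)" "n > 0"
  shows "p ^ multiplicity p ((2 * n) choose n) \<le> 2 * n"
proof -
  define c where "c = (2 * n) choose n"
  have p1: "p > 1" using assms prime_gt_1_nat by blast
  define t where "t = (LEAST e. 2 * n < p ^ e)"
  have t: "2 * n < p ^ t" unfolding t_def
    by (rule LeastI[of _ "2 * n"]) (rule power_gt_expt[OF p1[unfolded One_nat_def]])
  have t0: "t > 0" using t assms by (cases t) auto
  have tm: "p ^ (t - 1) \<le> 2 * n"
    using not_less_Least[of "t - 1" "\<lambda>e. 2 * n < p ^ e"] t0 by (simp add: t_def)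
  have nz: "c \<noteq> 0" by (simp add: c_def)
  have "fact (2 * n) = fact n * fact n * c"
    using binomial_fact_lemma[of n "2 * n"] by (simp add: c_def mult_2)
  moreover have "multiplicity p (fact n * fact n * c)
      = multiplicity p (fact n :: nat) + multiplicity p (fact n) + multiplicity p c"
    using assms nz by (simp add: prime_elem_multiplicity_mult_distrib)
  ultimately have "multiplicity p (fact (2 * n)) = 2 * multiplicity p (fact n :: nat) + multiplicity p c"
    by (metis mult_2)
  moreover have "multiplicity p (fact (2 * n)) = (\<Sum>e\<in>{1..<t}. (2 * n) div p ^ e)"
    using legendre[OF assms(1) t] by simp
  moreover have "multiplicity p (fact n) = (\<Sum>e\<in>{1..<t}. n div p ^ e)"
    using legendre[OF assms(1), of n t] t by simp
  moreover have "(\<Sum>e\<in>{1..<t}. (2 * n) div p ^ e) \<le> (\<Sum>e\<in>{1..<t}. 2 * (n div p ^ e) + 1)"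
  proof (rule sum_mono)
    fix e
    have pe: "p ^ e > 0" using p1 by simp
    have "n < (n div p ^ e + 1) * p ^ e" using pe dividend_less_div_times[of "p ^ e" n] by simp
    then have "2 * n < (2 * (n div p ^ e) + 2) * p ^ e" by simp
    then show "(2 * n) div p ^ e \<le> 2 * (n div p ^ e) + 1"
      using less_mult_imp_div_less[of "2 * n" "2 * (n div p ^ e) + 2" "p ^ e"] by linarith
  qed
  moreover have "(\<Sum>e\<in>{1..<t}. 2 * (n div p ^ e) + 1) = 2 * (\<Sum>e\<in>{1..<t}. n div p ^ e) + (t - 1)"
    by (subst sum.distrib) (simp add: sum_distrib_left)
  ultimately have "multiplicity p c \<le> t - 1" by linarith
  then have "p ^ multiplicity p c \<le> p ^ (t - 1)" using p1 by (simp add: power_increasing)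
  then show ?thesis using tm by (simp add: c_def)
qed

text \<open>All prime factors divide \<open>fact (2 * n)\<close>, and each prime power in the
  factorization is at most \<open>2 * n\<close>.\<close>

lemma central_binomial_le_power_primes:
  assumes "n > 0"
  shows "(2 * n) choose n \<le> (2 * n) ^ card {p. prime p \<and> p \<le> 2 * n}"
proof -
  define c where "c = (2 * n) choose n"
  have fin: "finite {p. prime p \<and> p \<le> 2 * n}" by (rule finite_subset[of _ "{..2 * n}"]) auto
  have nz: "c \<noteq> 0" by (simp add: c_def)
  have sub: "prime_factors c \<subseteq> {p. prime p \<and> p \<le> 2 * n}"
  proof
    fix p assume p: "p \<in> prime_factors c"
    then have "p dvd fact (2 * n)"
      using binomial_fact_lemma[of n "2 * n"] unfolding c_def
      by (metis dvd_mult dvd_trans in_prime_factors_imp_dvd le_add2 mult_2 dvd_refl)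
    then show "p \<in> {p. prime p \<and> p \<le> 2 * n}"
      using p prime_dvd_fact_iff by auto
  qed
  have "c = (\<Prod>p\<in>prime_factors c. p ^ multiplicity p c)"
    using nz by (simp add: prod_prime_factors)
  also have "\<dots> \<le> (\<Prod>p\<in>prime_factors c. 2 * n)"
    using assms by (intro prod_mono) (auto simp: c_def intro!: prime_power_central_binomial_le)
  also have "\<dots> = (2 * n) ^ card (prime_factors c)" by simp
  also have "\<dots> \<le> (2 * n) ^ card {p. prime p \<and> p \<le> 2 * n}"
    using assms card_mono[OF fin sub] by (intro power_increasing) auto
  finally show ?thesis by (simp add: c_def)
qed

text \<open>Chebyshev's lower bound for the prime counting function: compare with the lower bound
  \<open>4 ^ n / (2 * n)\<close> of the central binomial coefficient and take logarithms. The
  \<open>+ 1\<close> absorbs the denominator.\<close>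

lemma double_le_card_primes_mult_log:
  assumes "n > 0"
  shows "2 * real n \<le> (real (card {p. prime p \<and> p \<le> 2 * n}) + 1) * log 2 (2 * real n)"
proof -
  let ?c = "card {p. prime p \<and> p \<le> 2 * n}"
  have "4 ^ n / (2 * real n) \<le> real ((2 * n) choose n)" by (rule central_binomial_lower_bound[OF assms])
  also have "\<dots> \<le> real ((2 * n) ^ ?c)" using central_binomial_le_power_primes[OF assms] by linarith
  finally have "4 ^ n \<le> (2 * real n) ^ (?c + 1)" using assms by (simp add: field_simps)
  then have "log 2 (4 ^ n) \<le> log 2 ((2 * real n) ^ (?c + 1))" using assms by (subst log_le_cancel_iff) auto
  moreover have "log 2 (4::real) = 2" using log_pow_cancel[of 2 2] by simp
  moreover have "log 2 ((2 * real n) ^ (?c + 1)) = real (?c + 1) * log 2 (2 * real n)"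
    using assms by (intro log_nat_power) auto
  moreover have "log 2 (4 ^ n) = real n * log 2 4" by (intro log_nat_power) auto
  ultimately show ?thesis by (simp add: algebra_simps)
qed

section \<open>Enumerating the primes above a given number\<close>

definition nextp :: "nat \<Rightarrow> nat" where
  "nextp M = (LEAST q. M < q \<and> prime q)"

lemma nextp: "M < nextp M" "prime (nextp M)" "\<And>q. M < q \<Longrightarrow> prime q \<Longrightarrow> nextp M \<le> q"
proof -
  obtain q where "M < q \<and> prime q" using bigger_prime[of M] by blast
  from LeastI[of "\<lambda>q. M < q \<and> prime q", OF this]
  show "M < nextp M" "prime (nextp M)" unfolding nextp_def by blast+
  show "nextp M \<le> q" if "M < q" "prime q" for q
    unfolding nextp_def by (rule Least_le) (use that in blast)
qed

lemma prime_iterate_nextp: "j > 0 \<Longrightarrow> prime ((nextp ^^ j) M)"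
  by (cases j) (simp_all add: nextp(2))

lemma strict_mono_iterate_nextp: "strict_mono (\<lambda>j. (nextp ^^ j) M)"
  by (simp add: strict_mono_Suc_iff nextp(1))

lemma less_iterate_nextp: "j > 0 \<Longrightarrow> M < (nextp ^^ j) M"
  using strict_monoD[OF strict_mono_iterate_nextp, of 0 j M] by simp

text \<open>Each application of \<open>nextp\<close> uses up exactly one prime of the
  interval.\<close>

lemma iterate_nextp_le:
  "j \<le> card {p. prime p \<and> M < p \<and> p \<le> K} \<Longrightarrow> M \<le> K \<Longrightarrow> (nextp ^^ j) M \<le> K"
proof (induction j arbitrary: M)
  case (Suc j)
  let ?S = "\<lambda>M. {p. prime p \<and> M < p \<and> p \<le> K}"
  have "?S M \<noteq> {}" using Suc.prems(1) by (metis card.empty not_less_eq_eq le0)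
  then obtain q where "prime q" "M < q" "q \<le> K" by blast
  then have le: "nextp M \<le> K" using nextp(3)[of M q] by linarith
  have "?S M = insert (nextp M) (?S (nextp M))"
    using le nextp[of M] by (auto simp: le_less)
  moreover have "finite (?S (nextp M))" by (rule finite_subset[of _ "{..K}"]) auto
  ultimately have "card (?S M) = Suc (card (?S (nextp M)))" by simp
  then show ?case using Suc.IH[of "nextp M"] Suc.prems(1) le by (simp add: funpow_swap1)
qed simp

text \<open>Chebyshev's bound at the square of \<open>M\<close> grows faster than
  \<open>2 * M\<close>, and at most \<open>M\<close> primes are lost below \<open>M\<close>.\<close>

lemma many_primes_below_square:
  "eventually (\<lambda>M. (nextp ^^ M) M \<le> M\<^sup>2) at_top"
proof -
  have "eventually (\<lambda>x::real. x\<^sup>2 - 2 \<ge> (2 * x + 1) * log 2 (x\<^sup>2) \<and> x \<ge> 2) at_top"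
    by (intro eventually_conj; real_asymp)
  then have "eventually (\<lambda>M::nat. (real M)\<^sup>2 - 2 \<ge> (2 * real M + 1) * log 2 ((real M)\<^sup>2) \<and> real M \<ge> 2) at_top"
    using filterlim_real_sequentially by (auto simp: filterlim_iff)
  then show ?thesis
  proof eventually_elim
    case (elim M)
    \<comment> \<open>The bound on primes is about even numbers. Rounding down costs at most 1 and
      strictness another 1, hence the \<open>- 2\<close> in the real inequality.\<close>
    let ?n = "M\<^sup>2 div 2"
    let ?S = "{p. prime p \<and> M < p \<and> p \<le> M\<^sup>2}"
    let ?c = "card {p. prime p \<and> p \<le> M\<^sup>2}"
    have M2: "M \<ge> 2" using elim by simp
    have "2 * 2 \<le> M * M" using M2 by (intro mult_mono) auto
    then have n0: "?n > 0" by (simp add: power2_eq_square div_greater_zero_iff)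
    have sub: "2 * real ?n \<le> (real M)\<^sup>2" "(real M)\<^sup>2 - 2 \<le> 2 * real ?n - 1"
      using of_nat_mono[of "2 * ?n" "M\<^sup>2", where 'a = real] of_nat_mono[of "M\<^sup>2" "2 * ?n + 1", where 'a = real]
      by auto
    have fin: "finite {p. prime p \<and> p \<le> M\<^sup>2}" by (rule finite_subset[of _ "{..M\<^sup>2}"]) auto
    have "card {p. prime p \<and> p \<le> 2 * ?n} \<le> ?c" using fin by (intro card_mono) auto
    then have "2 * real ?n \<le> (real ?c + 1) * log 2 ((real M)\<^sup>2)"
      using double_le_card_primes_mult_log[OF n0] sub(1) n0 M2
      by (elim order.trans) (intro mult_mono, auto)
    then have "(2 * real M + 1) * log 2 ((real M)\<^sup>2) < (real ?c + 1) * log 2 ((real M)\<^sup>2)"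
      using elim sub(2) by linarith
    moreover have "log 2 ((real M)\<^sup>2) > 0" using M2 by (subst zero_less_log_cancel_iff) (auto simp: one_less_power)
    ultimately have "2 * real M < real ?c" by (simp add: mult_less_cancel_right_pos)
    then have "2 * M \<le> ?c" by linarith
    also have "?c \<le> card (?S \<union> {1..M})"
      using prime_gt_0_nat by (intro card_mono) (auto simp: Suc_le_eq intro: finite_subset[of _ "{..M\<^sup>2}"])
    also have "\<dots> \<le> card ?S + M" using card_Un_le[of ?S "{1..M}"] by simp
    finally have "M \<le> card ?S" by simp
    moreover have "M \<le> M\<^sup>2" by (simp add: power2_eq_square)
    ultimately show ?case by (rule iterate_nextp_le)
  qed
qed

section \<open>Chinese remainder codes\<close>

locale tower_code =
  fixes k l N :: nat
  assumes k2: "k \<ge> 2" and l1: "l \<ge> 1" and N1: "N \<ge> 1"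
begin

text \<open>The pair consists of the block length in bits and the exclusive bound on codes. The
  number \<open>m\<close> of sub-blocks is capped twice: by \<open>M\<close>, since only that many
  primes are known to lie below its square, and by \<open>N div p + 1\<close>, so that the last
  level overshoots \<open>N\<close> by less than a factor 2.\<close>

primrec lev :: "nat \<Rightarrow> nat \<times> nat" where
  "lev 0 = (1, 2)"
| "lev (Suc i) = (let p = fst (lev i); M = l * snd (lev i) ^ k; m = min M (N div p + 1)
     in (p * m, \<Prod>j<m. (nextp ^^ Suc j) M))"

definition "P i = fst (lev i)"
definition "U i = snd (lev i)"
definition "M i = l * U i ^ k"
definition "m i = min (M i) (N div P i + 1)"
text \<open>Bit \<open>g\<close> lies in block \<open>g div P i\<close> of level \<open>i\<close>,
  whose position within its parent is the remainder modulo \<open>m i\<close>. So this is the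
  modulus that leads from level \<open>i + 1\<close> to level \<open>i\<close> on the path of
  \<open>g\<close>.\<close>

definition "q i g = (nextp ^^ Suc ((g div P i) mod m i)) (M i)"
definition "r = (LEAST i. N \<le> P i)"

lemma lev_simps [simp]:
  "P 0 = 1" "U 0 = 2" "P (Suc i) = P i * m i" "U (Suc i) = (\<Prod>j<m i. (nextp ^^ Suc j) (M i))"
  by (simp_all add: P_def U_def M_def m_def Let_def)

lemma q_gt: "M i < q i g" unfolding q_def by (rule less_iterate_nextp) simp

lemma U_pos: "U i \<ge> 1"
proof (cases i)
  case (Suc i')
  have "(nextp ^^ Suc j) (M i') > 0" for j using less_iterate_nextp[of "Suc j" "M i'"] by simp
  then show ?thesis unfolding Suc lev_simps Suc_le_eq One_nat_def by (intro prod_pos) auto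
qed simp

lemma U_le_M: "U i \<le> M i"
proof -
  have "U i ^ 1 \<le> U i ^ k" using U_pos k2 by (intro power_increasing) auto
  also have "\<dots> \<le> l * U i ^ k" using l1 by simp
  finally show ?thesis by (simp add: M_def)
qed

lemma m_pos: "m i \<ge> 1"
  using U_le_M[of i] U_pos[of i] by (simp add: m_def)

lemma P_pos: "P i \<ge> 1"
proof (induction i)
  case (Suc i)
  then show ?case using m_pos[of i] by simp
qed simp

lemma U_ge_2: "U i \<ge> 2"
proof (cases i)
  case (Suc i')
  have "2 \<le> (nextp ^^ Suc j) (M i')" for j
    using prime_ge_2_nat[OF prime_iterate_nextp[of "Suc j"]] by simp
  then have "(\<Prod>j<m i'. 2) \<le> U i" unfolding Suc lev_simps by (intro prod_mono) auto
  moreover have "(2::nat) ^ 1 \<le> 2 ^ m i'" using m_pos[of i'] by (intro power_increasing) auto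
  ultimately show ?thesis by simp
qed simp

lemma m_ge_2: "P i < N \<Longrightarrow> m i \<ge> 2"
proof -
  assume "P i < N"
  then have "N div P i \<ge> 1" using P_pos[of i] by (simp add: Suc_le_eq div_greater_zero_iff)
  then show ?thesis using U_ge_2[of i] U_le_M[of i] by (simp add: m_def)
qed

text \<open>While below \<open>N\<close>, the block length at least doubles per level and thus
  outruns the level number.\<close>

lemma N_le_P: "\<exists>i\<le>N. N \<le> P i"
proof (rule ccontr)
  assume "\<not> (\<exists>i\<le>N. N \<le> P i)"
  then have *: "P i < N" if "i \<le> N" for i using that by auto
  have "i \<le> N \<Longrightarrow> i < P i" for i
  proof (induction i)
    case (Suc i)
    have "P i * 2 \<le> P i * m i" using m_ge_2[OF *[of i]] Suc.prems by simp
    moreover have "Suc i < P i * 2" using Suc by simp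
    ultimately have "Suc i < P i * m i" by linarith
    then show ?case by simp
  qed simp
  then show False using *[of N] by fastforce
qed

lemma N_le_P_r: "N \<le> P r" and r_le_N: "r \<le> N"
proof -
  obtain i where i: "i \<le> N" "N \<le> P i" using N_le_P by blast
  show "N \<le> P r" unfolding r_def using i(2) by (rule LeastI)
  have "r \<le> i" unfolding r_def using i(2) by (rule Least_le)
  then show "r \<le> N" using i(1) by simp
qed

lemma less_r: "i < r \<Longrightarrow> P i < N"
  unfolding r_def using not_less_Least by fastforce

text \<open>Decoding: \<open>y\<close> is a code of level \<open>R\<close>, or an inner product of
  such codes, and is followed along the path of bit \<open>g\<close> down to level
  \<open>i\<close>.\<close>

primrec cv :: "nat \<Rightarrow> nat \<Rightarrow> nat \<Rightarrow> nat \<Rightarrow> nat" where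
  "cv 0 y g i = y"
| "cv (Suc R) y g i = (if i \<le> R then cv R (y mod q R g) g i else y)"

lemma cv_top [simp]: "cv R y g R = y"
  by (cases R) auto

lemma cv_step: "i < R \<Longrightarrow> cv R y g i = cv R y g (Suc i) mod q i g"
proof (induction R arbitrary: y)
  case (Suc R)
  then show ?case by (cases "i = R") auto
qed simp

text \<open>The range condition on the intermediate residues is essential: a residue is a priori
  only below the prime \<open>q i g\<close>, and with factors that large an inner product could
  exceed the modulus.\<close>

definition valid :: "(nat \<Rightarrow> nat) \<Rightarrow> nat \<Rightarrow> bool" where
  "valid a y \<longleftrightarrow> (\<forall>g<N. (\<forall>i<r. cv r y g i < U i) \<and> cv r y g 0 = a g)"

text \<open>Chinese remaindering glues the codes of the \<open>m R\<close> sub-blocks. The block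
  number \<open>b\<close> varies in the induction because each sub-block holds other bits.\<close>

lemma valid_block:
  assumes "\<And>g. a g < 2"
  shows "\<exists>y<U R. \<forall>g. g div P R = b \<longrightarrow> (\<forall>i\<le>R. cv R y g i < U i) \<and> cv R y g 0 = a g"
proof (induction R arbitrary: b)
  case 0
  show ?case using assms by (intro exI[of _ "a b"]) auto
next
  case (Suc R)
  define z where "z j = (SOME y. y < U R \<and>
      (\<forall>g. g div P R = b * m R + j \<longrightarrow> (\<forall>i\<le>R. cv R y g i < U i) \<and> cv R y g 0 = a g))" for j
  have z: "z j < U R"
      "g div P R = b * m R + j \<Longrightarrow> (\<forall>i\<le>R. cv R (z j) g i < U i) \<and> cv R (z j) g 0 = a g" for j g
    using someI_ex[OF Suc.IH[of "b * m R + j"]] unfolding z_def by blast+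
  let ?q = "\<lambda>j. (nextp ^^ Suc j) (M R)"
  have pr: "prime (?q j)" for j by (rule prime_iterate_nextp) simp
  have inj: "?q i = ?q j \<Longrightarrow> i = j" for i j
    using strict_mono_eq[OF strict_mono_iterate_nextp[of "M R"], of "Suc i" "Suc j"] by simp
  have cop: "i \<noteq> j \<Longrightarrow> coprime (?q i) (?q j)" for i j
    using primes_coprime[OF pr pr] inj by blast
  have nz: "?q j \<noteq> 0" for j using pr[of j] by (metis not_prime_0)
  obtain y where y: "y < (\<Prod>j<m R. ?q j)" "\<And>j. j < m R \<Longrightarrow> [y = z j] (mod ?q j)"
    using chinese_remainder_unique_nat[of "{..<m R}" ?q z] cop nz by (meson finite_lessThan lessThan_iff)
  have ymod: "y mod ?q j = z j" if "j < m R" for j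
  proof -
    \<comment> \<open>The moduli lie above \<open>M R \<ge> U R\<close>, so the residue is the code
      of the sub-block itself and not merely congruent to it.\<close>
    have "z j < ?q j" using z(1)[of j] U_le_M[of R] less_iterate_nextp[of "Suc j" "M R"] by linarith
    then have "z j mod ?q j = z j" by (rule mod_less)
    then show ?thesis by (rule trans[OF y(2)[OF that, unfolded unique_euclidean_semiring_class.cong_def]])
  qed
  show ?case
  proof (intro exI[of _ y] conjI allI impI)
    show yU: "y < U (Suc R)" using y(1) by (simp only: lev_simps)
    fix g assume g: "g div P (Suc R) = b"
    define j where "j = (g div P R) mod m R"
    have j: "j < m R" using m_pos[of R] by (simp add: j_def)
    have "g div P R = b * m R + j"
      using g div_mult_mod_eq[of "g div P R" "m R"] by (simp add: j_def div_mult2_eq)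
    note z = z(1) z(2)[OF this]
    have e: "y mod q R g = z j" using ymod[OF j] by (simp add: q_def j_def)
    show "cv (Suc R) y g 0 = a g" using z by (simp add: e)
    show "cv (Suc R) y g i < U i" if "i \<le> Suc R" for i
    proof (cases "i \<le> R")
      case False
      then have "i = Suc R" using that by simp
      then show ?thesis using yU by simp
    qed (use z e in auto)
  qed
qed

lemma valid_exists:
  assumes "\<And>g. g < N \<Longrightarrow> a g < 2"
  shows "\<exists>y<U r. valid a y"
proof -
  \<comment> \<open>Positions from \<open>N\<close> on are padded with 0. Block 0 of level
    \<open>r\<close> then contains all \<open>N\<close> bits, since
    \<open>N \<le> P r\<close>.\<close>
  have "(if g < N then a g else 0) < 2" for g using assms by simp
  then obtain y where y: "y < U r"
      "\<And>g. g div P r = 0 \<Longrightarrow> (\<forall>i\<le>r. cv r y g i < U i) \<and> cv r y g 0 = (if g < N then a g else 0)"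
    using valid_block[of "\<lambda>g. if g < N then a g else 0" r 0] by blast
  have "g div P r = 0" if "g < N" for g using that N_le_P_r by simp
  then show ?thesis using y by (auto simp: valid_def intro!: exI[of _ y])
qed

text \<open>The least valid code is what the search from 0 in \<open>encP\<close> finds;
  \<open>valid_exists\<close> keeps it below \<open>U r\<close>.\<close>

definition enc :: "(nat \<Rightarrow> nat) \<Rightarrow> nat" where "enc a = (LEAST y. valid a y)"

lemma enc:
  assumes "\<And>g. g < N \<Longrightarrow> a g < 2"
  shows "valid a (enc a)" "enc a < U r"
proof -
  obtain y where y: "y < U r" "valid a y" using valid_exists[of a] assms by blast
  show "valid a (enc a)" unfolding enc_def using y(2) by (rule LeastI)
  have "enc a \<le> y" unfolding enc_def using y(2) by (rule Least_le)
  then show "enc a < U r" using y(1) by simp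
qed

text \<open>This is the reason for the choice of \<open>M i\<close>. The inequality is strict
  because every factor is at most \<open>U i - 1\<close>.\<close>

lemma sum_prod_less:
  assumes "\<And>t s. t < k \<Longrightarrow> s < l \<Longrightarrow> f t s < U i"
  shows "(\<Sum>s<l. \<Prod>t<k. f t s) < M i"
proof -
  have "(\<Sum>s<l. \<Prod>t<k. f t s) \<le> (\<Sum>s<l. \<Prod>t<k. U i - 1)"
    using assms by (intro sum_mono prod_mono) fastforce
  also have "\<dots> = l * (U i - 1) ^ k" by simp
  also have "(U i - 1) ^ k < U i ^ k" using U_pos[of i] k2 by (intro power_strict_mono) auto
  then have "l * (U i - 1) ^ k < M i" using l1 by (simp add: M_def)
  finally show ?thesis .
qed

text \<open>Reduction commutes with sums and products, and the inner product of the reduced codes is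
  below \<open>M i < q i g\<close>, so the outermost reduction changes nothing. The induction runs
  from the top level downwards.\<close>

lemma cv_sum_prod:
  assumes y: "\<And>t s. t < k \<Longrightarrow> s < l \<Longrightarrow> y t s < U r \<and> valid (a t s) (y t s)" and "g < N"
  shows "i \<le> r \<Longrightarrow> cv r (\<Sum>s<l. \<Prod>t<k. y t s) g i = (\<Sum>s<l. \<Prod>t<k. cv r (y t s) g i)"
proof (induction i rule: inc_induct)
  case (step i)
  have "cv r (\<Sum>s<l. \<Prod>t<k. y t s) g i = (\<Sum>s<l. \<Prod>t<k. cv r (y t s) g (Suc i)) mod q i g"
    using step by (simp add: cv_step)
  also have "\<dots> = (\<Sum>s<l. (\<Prod>t<k. cv r (y t s) g (Suc i) mod q i g) mod q i g) mod q i g"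
    by (simp add: mod_sum_eq mod_prod_eq)
  also have "\<dots> = (\<Sum>s<l. \<Prod>t<k. cv r (y t s) g i) mod q i g"
    using step by (simp add: cv_step mod_sum_eq)
  also have "\<dots> = (\<Sum>s<l. \<Prod>t<k. cv r (y t s) g i)"
    using sum_prod_less[of "\<lambda>t s. cv r (y t s) g i" i] y \<open>g < N\<close> step q_gt[of i g]
    by (intro mod_less) (fastforce simp: valid_def)
  finally show ?case .
qed simp

text \<open>The number \<open>v\<close> alone reveals, for every row \<open>g\<close>, the inner
  product of the bits in that row, a sum of nonnegative terms. Hence the property to be tested is
  one of the number, not of the vectors behind it.\<close>

lemma orthogonal_iff_cv:
  assumes bits: "\<And>t s g. t < k \<Longrightarrow> s < l \<Longrightarrow> g < N \<Longrightarrow> a t s g < 2"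
  defines "v \<equiv> \<Sum>s<l. \<Prod>t<k. enc (a t s)"
  shows "v < M r" "(\<forall>g<N. cv r v g 0 = 0) \<longleftrightarrow> (\<forall>g<N. \<forall>s<l. \<exists>t<k. a t s g = 0)"
proof -
  have e: "enc (a t s) < U r \<and> valid (a t s) (enc (a t s))" if "t < k" "s < l" for t s
    using enc[of "a t s"] bits that by blast
  show "v < M r" unfolding v_def using e by (intro sum_prod_less) blast
  have "cv r v g 0 = (\<Sum>s<l. \<Prod>t<k. a t s g)" if "g < N" for g
  proof -
    have "cv r v g 0 = (\<Sum>s<l. \<Prod>t<k. cv r (enc (a t s)) g 0)"
      unfolding v_def
      using cv_sum_prod[of "\<lambda>t s. enc (a t s)" a g 0] e that by blast
    also have "\<dots> = (\<Sum>s<l. \<Prod>t<k. a t s g)"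
      using e that by (intro sum.cong prod.cong refl) (auto simp: valid_def)
    finally show ?thesis .
  qed
  moreover have "(\<Sum>s<l. \<Prod>t<k. a t s g) = 0 \<longleftrightarrow> (\<forall>s<l. \<exists>t<k. a t s g = 0)" for g
    by (simp, metis lessThan_iff)
  ultimately show "(\<forall>g<N. cv r v g 0 = 0) \<longleftrightarrow> (\<forall>g<N. \<forall>s<l. \<exists>t<k. a t s g = 0)"
    by metis
qed

end

section \<open>Number of levels and size of the codes\<close>

text \<open>The values are 0, 1, 2, 4, 16, ...; the start at 0 makes \<open>tow (Suc j)\<close> the
  largest \<open>n\<close> with \<open>log_star n \<le> j\<close>.\<close>

fun tow :: "nat \<Rightarrow> nat" where
  "tow 0 = 0"
| "tow (Suc j) = 2 ^ tow j"

lemma tow_less_Suc: "tow j < tow (Suc j)" by simp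

lemma strict_mono_tow: "strict_mono tow"
  unfolding strict_mono_Suc_iff using tow_less_Suc by blast

context tower_code begin

text \<open>The last level starts from a block length below \<open>N\<close>, and the cap
  \<open>N div P i + 1\<close> lets it pass \<open>N\<close> by at most that length.\<close>

lemma P_r_le: "P r \<le> 2 * N"
proof (cases r)
  case 0
  then show ?thesis using N1 by simp
next
  case (Suc i)
  have lt: "P i < N" using less_r[of i] Suc by simp
  have "P r \<le> P i * (N div P i + 1)" unfolding Suc lev_simps m_def by (intro mult_left_mono) auto
  also have "\<dots> \<le> N + P i" by (simp add: algebra_simps)
  finally show ?thesis using lt by simp
qed

text \<open>Were the cap \<open>N div P i + 1\<close> attained, the next block length would exceed
  \<open>N\<close> and no further level would follow.\<close>

lemma m_nonlast: "Suc i < r \<Longrightarrow> m i = M i"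
proof -
  assume "Suc i < r"
  then have "P i * m i < N" using less_r[of "Suc i"] by simp
  moreover have "N < P i * (N div P i + 1)"
    using dividend_less_times_div[of "P i" N] P_pos[of i] by (simp add: algebra_simps)
  ultimately have "m i \<noteq> N div P i + 1" by (metis less_asym)
  then show ?thesis by (auto simp: m_def min_def split: if_splits)
qed

lemma two_power_m_le: "2 ^ m i \<le> U (Suc i)"
proof -
  have "2 \<le> (nextp ^^ Suc j) (M i)" for j
    using prime_ge_2_nat[OF prime_iterate_nextp[of "Suc j"]] by simp
  then have "(\<Prod>j<m i. 2) \<le> U (Suc i)" unfolding lev_simps by (intro prod_mono) auto
  then show ?thesis by simp
qed

text \<open>Before the last level there are \<open>M i \<ge> U i\<close> primes, each at least 2, so
  \<open>U (Suc i)\<close> is at least 2 to the \<open>U i\<close>.\<close>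

lemma tow_le_U: "i < r \<Longrightarrow> tow (i + 2) \<le> U i"
proof (induction i)
  case (Suc i)
  then have "tow (i + 2) \<le> m i" using U_le_M[of i] by (simp add: m_nonlast)
  then have "(2::nat) ^ tow (i + 2) \<le> 2 ^ m i" by (intro power_increasing) auto
  also have "\<dots> \<le> U (Suc i)" by (rule two_power_m_le)
  finally show ?case by simp
qed (simp add: numeral_2_eq_2)

text \<open>For \<open>r = j + 2\<close> level \<open>j\<close> still uses all its primes, so the
  block length of level \<open>j + 1\<close> is at least \<open>U j \<ge> tow r\<close>, yet below
  \<open>N\<close>. This limits the number of levels.\<close>

lemma tow_r_less: "tow r < N"
proof (cases r)
  case 0
  then show ?thesis using N1 by simp
next
  case (Suc i)
  show ?thesis
  proof (cases i)
    case 0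
    then show ?thesis using Suc less_r[of 0] by simp
  next
    case (Suc j)
    note r = \<open>r = Suc i\<close> this
    have "tow r \<le> U j" using tow_le_U[of j] r by simp
    also have "\<dots> \<le> m j" using U_le_M[of j] r by (simp add: m_nonlast)
    also have "\<dots> \<le> P (Suc j)" using P_pos[of j] by simp
    also have "\<dots> < N" using r by (intro less_r) simp
    finally show ?thesis .
  qed
qed

text \<open>One level multiplies by \<open>m i\<close> for the number of primes, by 2 for the square
  and by \<open>k + 1\<close> for the logarithm of \<open>M i\<close>;
  \<open>2 + 2 * k \<le> 3 * k\<close> uses \<open>k \<ge> 2\<close>. The assumption on primes
  starts only at \<open>l\<close>, which tends to infinity with \<open>n\<close>, so an asymptotic
  statement about primes will do.\<close>

lemma log_U_le:
  assumes primes: "\<And>M. l \<le> M \<Longrightarrow> (nextp ^^ M) M \<le> M\<^sup>2"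
  shows "log 2 (U i) \<le> P i * (1 + log 2 l) * (3 * k) ^ i"
proof (induction i)
  case 0
  show ?case using l1 by simp
next
  case (Suc i)
  let ?x = "P i * (1 + log 2 l) * (3 * k) ^ i"
  have ll: "0 \<le> log 2 l" using l1 by simp
  have one: "1 \<le> real (3 * k) ^ i" using k2 by (intro one_le_power) auto
  have "log 2 l \<le> P i * (1 + log 2 l) * 1"
    using ll P_pos[of i] mult_mono[of 1 "real (P i)" "log 2 l" "1 + log 2 l"] by simp
  also have "P i * (1 + log 2 l) * 1 \<le> ?x"
    using ll one by (intro mult_left_mono) auto
  finally have lx: "log 2 l \<le> ?x" .
  have Mi: "l \<le> M i" "1 \<le> M i" using U_le_M[of i] U_pos[of i] l1 unfolding M_def by auto
  have "(nextp ^^ Suc j) (M i) \<le> (M i)\<^sup>2" if "j < m i" for j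
  proof -
    have "(nextp ^^ Suc j) (M i) \<le> (nextp ^^ M i) (M i)"
      using that strict_mono_less_eq[OF strict_mono_iterate_nextp[of "M i"], of "Suc j" "M i"]
      by (simp add: m_def)
    then show ?thesis using primes[OF Mi(1)] by linarith
  qed
  then have "U (Suc i) \<le> (\<Prod>j<m i. (M i)\<^sup>2)" unfolding lev_simps by (intro prod_mono) auto
  then have "U (Suc i) \<le> M i ^ (2 * m i)" by (simp add: power_mult)
  then have "real (U (Suc i)) \<le> real (M i) ^ (2 * m i)"
    unfolding of_nat_power[symmetric] of_nat_le_iff .
  then have "log 2 (U (Suc i)) \<le> log 2 (real (M i) ^ (2 * m i))"
    using U_pos[of "Suc i"] Mi(2) by (subst log_le_cancel_iff) (auto simp del: lev_simps)
  also have "\<dots> = 2 * m i * log 2 (M i)" using Mi by (subst log_nat_power) auto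
  also have "\<dots> \<le> 2 * m i * (?x + k * ?x)"
  proof (rule mult_left_mono)
    have "log 2 (M i) = log 2 l + k * log 2 (U i)"
      using U_pos[of i] l1 by (simp add: M_def log_mult log_nat_power del: lev_simps)
    also have "k * log 2 (U i) \<le> k * ?x"
      using Suc by (intro mult_left_mono) auto
    finally show "log 2 (M i) \<le> ?x + k * ?x" using lx by linarith
  qed simp
  also have "\<dots> = m i * ?x * (2 + 2 * k)" by (simp add: algebra_simps)
  also have "\<dots> \<le> m i * ?x * (3 * k)"
    using ll k2 by (intro mult_left_mono) auto
  finally show ?case by (simp add: algebra_simps)
qed

end

section \<open>The reduction as a program\<close>

definition For :: "bool \<Rightarrow> nat \<Rightarrow> ex \<Rightarrow> stm \<Rightarrow> stm" where
  "For h x e p = Asg x (Num 0) ;; Wh h (Bin Lt (Var x) e) (p ;; Asg x (Bin Add (Var x) (Num 1)))"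

text \<open>The limit \<open>e\<close> is re-evaluated before each iteration and so has to be
  constant under the invariant. The counter is incremented after the body, hence the invariant for
  \<open>Suc i\<close> refers to the updated valuation.\<close>

lemma (in ram) wp_For:
  assumes init: "I 0 (v(x := 0)) m"
    and lim: "\<And>i v m. i \<le> L \<Longrightarrow> I i v m \<Longrightarrow> v x = i \<Longrightarrow> okE w e v m \<and> ev w e v m = L"
    and body: "\<And>i v m. i < L \<Longrightarrow> I i v m \<Longrightarrow> v x = i \<Longrightarrow>
      wp p (\<lambda>v' m'. v' x = i \<and> I (Suc i) (v'(x := Suc i)) m') v m"
    and fin: "\<And>v m. I L v m \<Longrightarrow> v x = L \<Longrightarrow> Q v m"
    and bd: "L \<le> b h" "L < 2 ^ w"
  shows "wp (For h x e p) Q v m"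
proof -
  have [simp]: "Suc 0 < 2 ^ w" using w1 one_less_power[of "2::nat" w] by simp
  let ?J = "\<lambda>v m. v x \<le> L \<and> I (v x) v m"
  show ?thesis
    unfolding For_def
  proof (intro wp_Sq wp_Asg)
    show "wp (Wh h (Bin Lt (Var x) e) (p ;; Asg x (Bin Add (Var x) (Num 1)))) Q
        (v(x := ev w (Num 0) v m)) m"
    proof (rule wp_Wh[where I = ?J and \<mu> = "\<lambda>v m. L - v x"])
      show "?J (v(x := ev w (Num 0) v m)) m" using init by simp
      show "okE w (Bin Lt (Var x) e) v m" if "?J v m" for v m
        using that lim by auto
      show "Q v m" if "?J v m" "ev w (Bin Lt (Var x) e) v m = 0" for v m
        using that lim[of "v x" v m] fin[of v m] by (auto split: if_splits)
      show "L - (v(x := ev w (Num 0) v m)) x \<le> b h" using bd by simp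
      fix v m assume J: "?J v m" "ev w (Bin Lt (Var x) e) v m \<noteq> 0"
      have lt: "v x < L" using J lim[of "v x" v m] by (auto split: if_splits)
      show "wp (p ;; Asg x (Bin Add (Var x) (Num 1))) (\<lambda>v' m'. ?J v' m' \<and> L - v' x < L - v x) v m"
        using lt bd
        by (intro wp_Sq wp_conseq[OF body[of "v x" v m, OF lt conjunct2[OF J(1)] refl]] wp_Asg) auto
    qed
  qed simp
qed

text \<open>Registers: 0 holds \<open>n\<close>, 2 the dimension \<open>d\<close>, 4, 6, 8, 10, 12 hold \<open>l\<close>, \<open>N\<close>, \<open>r\<close>, \<open>U r\<close>, \<open>M r\<close>, 14 the
  value \<open>v\<close> of an inner product, 16 the answer, 18 whether \<open>v\<close> belongs to orthogonal vectors, 20 the number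
  of a vector, 22 a column, 24 a candidate for its code, 26 whether that is valid,
  28 a row; bank 2 holds the prime \<open>q i g\<close> at address \<open>i * N + g\<close> and bank 4 holds \<open>U i\<close> at
  address \<open>i\<close>. The code of a column and the level parameters are found by exhaustive search.
  Registers 1 and 3 and bank 1 are the input of the subroutine.\<close>

definition chainP :: stm where
  "chainP = Asg 32 (Var 8) ;;
     Wh False (Var 32)
      (Asg 32 (Bin Sub (Var 32) (Num 1)) ;;
       Asg 30 (Bin Mod (Var 30) (Ld 2 (Bin Add (Bin Mul (Var 32) (Var 6)) (Var 28)))) ;;
       Asg 26 (Bin Mul (Var 26) (Bin Lt (Var 30) (Ld 4 (Var 32)))))"

definition validP :: stm where
  "validP = Asg 26 (Num 1) ;;
     For False 28 (Var 6)
      (Asg 30 (Var 24) ;; chainP ;;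
       Asg 34 (Bin Add (Bin Mul (Var 22) (Var 6)) (Var 28)) ;;
       Ite (Bin Lt (Var 34) (Var 2))
         (Asg 36 (Ld 0 (Bin Add (Bin Mul (Var 20) (Var 2)) (Var 34))))
         (Asg 36 (Num 0)) ;;
       Asg 26 (Bin Mul (Var 26) (Bin Equal (Var 30) (Var 36))))"

definition encP :: stm where
  "encP = Asg 24 (Num 0) ;; validP ;;
     Wh False (Bin Equal (Var 26) (Num 0)) (Asg 24 (Bin Add (Var 24) (Num 1)) ;; validP)"

definition inVP :: stm where
  "inVP = Asg 18 (Num 1) ;;
     For False 28 (Var 6)
      (Asg 30 (Var 14) ;; Asg 26 (Num 1) ;; chainP ;;
       Asg 18 (Bin Mul (Var 18) (Bin Equal (Var 30) (Num 0))))"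

text \<open>The outer loop is the only one with flag \<open>True\<close>. A vector belongs to the
  first collection iff its running number is below \<open>n\<close>; there the extra entry is
  \<open>- v\<close>, elsewhere 1.\<close>

definition buildP :: "nat \<Rightarrow> stm" where
  "buildP k = For True 20 (Bin Mul (Num k) (Var 0))
     (For False 22 (Var 4)
       (encP ;; Sto 1 (Bin Add (Bin Mul (Var 20) (Bin Add (Var 4) (Num 1))) (Var 22)) (Var 24)) ;;
      Asg 24 (Bin Add (Bin Mul (Var 20) (Bin Add (Var 4) (Num 1))) (Var 4)) ;;
      Ite (Bin Lt (Var 20) (Var 0))
        (Sto 1 (Var 24) (Bin Sub (Num 0) (Var 14)))
        (Sto 1 (Var 24) (Num 1)))"

text \<open>There is no skip statement; self-assignments such as \<open>Asg 16 (Var 16)\<close> take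
  its place.\<close>

definition mainP :: "nat \<Rightarrow> stm" where
  "mainP k = Asg 16 (Num 0) ;;
     For False 14 (Var 12)
      (inVP ;;
       Ite (Var 18)
         (buildP k ;; Asg 1 (Var 0) ;; Asg 3 (Bin Add (Var 4) (Num 1)) ;; Cl ;;
          Ite (Var 1) (Asg 16 (Num 1)) (Asg 16 (Var 16)))
         (Asg 16 (Var 16))) ;;
     Asg 0 (Var 16)"

section \<open>Verification of the main loop\<close>

text \<open>\<open>B\<close> bounds both the iterations of all small loops and the small numbers
  that occur. The factor 2 in \<open>W\<close> reserves the sign bit: \<open>B\<close> fits into
  \<open>w - 1\<close> bits.\<close>

locale ovram = ram w A b T + tower_code k l N
  for w A b T k l N +
  fixes n d B :: nat
  assumes bF: "b False = B" and bT: "b True = k * n"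
    and n1: "n \<ge> 1"
    and N_def: "N = d div l + 1"
    and B: "M r + N * N + l * N + l + 2 * N + k + 3 \<le> B"
    and W: "2 * ((k * n + 1) * (B + 1)) \<le> 2 ^ w"
begin

lemma B_less: "x \<le> B \<Longrightarrow> x < 2 ^ w"
proof -
  assume "x \<le> B"
  then have "x < 1 * (B + 1)" by simp
  also have "\<dots> \<le> (k * n + 1) * (B + 1)" by (intro mult_right_mono) auto
  also have "\<dots> \<le> 2 ^ w" using W by simp
  finally show ?thesis .
qed

lemma nB_less: "x \<le> k * n \<Longrightarrow> y \<le> B \<Longrightarrow> z \<le> B \<Longrightarrow> x * y + z < 2 ^ w"
proof -
  assume "x \<le> k * n" "y \<le> B" "z \<le> B"
  then have "x * y + z \<le> (k * n) * B + B" by (intro add_mono mult_mono) auto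
  also have "\<dots> < (k * n + 1) * (B + 1)" by simp
  also have "\<dots> \<le> 2 ^ w" using W by simp
  finally show ?thesis .
qed

lemma one_less_w [simp]: "Suc 0 < 2 ^ w" "0 < (2::nat) ^ w"
  using w1 one_less_power[of "2::nat" w] by simp_all

lemma sub_one [simp]: "0 < x \<Longrightarrow> x \<le> B \<Longrightarrow> (x + (2 ^ w - Suc 0)) mod 2 ^ w = x - Suc 0"
proof -
  assume x: "0 < x" "x \<le> B"
  have "x + (2 ^ w - Suc 0) = (x - Suc 0) + 2 ^ w" using x(1) one_less_w(1) by linarith
  then have "(x + (2 ^ w - Suc 0)) mod 2 ^ w = (x - Suc 0) mod 2 ^ w" by (simp only: mod_add_self2)
  also have "\<dots> = x - Suc 0" using B_less[OF x(2)] by (intro mod_less) linarith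
  finally show ?thesis .
qed

lemma N_le_B: "N \<le> B" "l \<le> B" "M r \<le> B" "r \<le> B" "l + 1 \<le> B"
  using B r_le_N by linarith+

lemma d_le: "d \<le> l * N"
proof -
  have "d < l * (d div l + 1)" using l1 dividend_less_times_div[of l d] by simp
  then show ?thesis by (simp add: N_def)
qed

lemma d_le_B: "d \<le> B" using d_le B by linarith

lemma pair_le: "i < x \<Longrightarrow> g < y \<Longrightarrow> i * y + g < x * (y::nat)"
proof -
  assume "i < x" "g < y"
  then have "i * y + g < Suc i * y" by simp
  also have "\<dots> \<le> x * y" using \<open>i < x\<close> by (intro mult_right_mono) auto
  finally show ?thesis .
qed

lemma rN_le: "i < r \<Longrightarrow> g < N \<Longrightarrow> i * N + g \<le> B"
proof -
  assume "i < r" "g < N"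
  then have "i * N + g < N * N" using r_le_N by (intro pair_le) auto
  then show ?thesis using B by linarith
qed

lemma lN_le: "i < l \<Longrightarrow> g < N \<Longrightarrow> i * N + g \<le> B"
proof -
  assume "i < l" "g < N"
  then have "i * N + g < l * N" by (intro pair_le) auto
  then show ?thesis using B by linarith
qed

lemma le_sum_less: "x + y < 2 ^ w \<Longrightarrow> (x::nat) < 2 ^ w" by simp

definition tabs :: "(nat \<Rightarrow> nat \<Rightarrow> nat) \<Rightarrow> bool" where
  "tabs h \<longleftrightarrow> (\<forall>i<r. \<forall>g<N. h 2 (i * N + g) = q i g) \<and> (\<forall>i<r. h 4 i = U i)"

lemma wp_chainP:
  assumes pre: "v 8 = r" "v 6 = N" "v 28 < N" "v 26 \<le> 1" "tabs h"
    and post: "\<And>v'. (\<forall>x<30. x \<noteq> 26 \<longrightarrow> v' x = v x) \<Longrightarrow> v' 30 = cv r (v 30) (v 28) 0 \<Longrightarrow>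
      v' 26 = (if v 26 = 1 \<and> (\<forall>i<r. cv r (v 30) (v 28) i < U i) then 1 else 0) \<Longrightarrow> Q v' h"
  shows "wp chainP Q v h"
  unfolding chainP_def
proof (intro wp_Sq wp_Asg)
  let ?y = "v 30" and ?g = "v 28"
  let ?I = "\<lambda>v' h'. h' = h \<and> v' 32 \<le> r \<and> (\<forall>x<30. x \<noteq> 26 \<longrightarrow> v' x = v x) \<and> v' 30 = cv r ?y ?g (v' 32) \<and>
      v' 26 = (if v 26 = 1 \<and> (\<forall>i<r. v' 32 \<le> i \<longrightarrow> cv r ?y ?g i < U i) then 1 else 0)"
  show "wp (Wh False (Var 32)
      (Asg 32 (Bin Sub (Var 32) (Num 1)) ;;
       Asg 30 (Bin Mod (Var 30) (Ld 2 (Bin Add (Bin Mul (Var 32) (Var 6)) (Var 28)))) ;;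
       Asg 26 (Bin Mul (Var 26) (Bin Lt (Var 30) (Ld 4 (Var 32))))))
      Q (v(32 := ev w (Var 8) v h)) h"
  proof (rule wp_Wh[where I = ?I and \<mu> = "\<lambda>v h. v 32"])
    show "?I (v(32 := ev w (Var 8) v h)) h" using pre by auto
    show "(v(32 := ev w (Var 8) v h)) 32 \<le> b False" using pre N_le_B bF by simp
    show "Q v' h'" if "?I v' h'" "ev w (Var 32) v' h' = 0" for v' h'
      using that post[of v'] by simp
    fix v' h' assume I: "?I v' h'" and nz: "ev w (Var 32) v' h' \<noteq> 0"
    define i where "i = v' 32 - 1"
    have i: "v' 32 = Suc i" "i < r" using I nz by (auto simp: i_def)
    have [simp]: "v' 6 = N" "v' 28 = ?g" using I pre by auto
    have t: "h 2 (i * N + ?g) = q i ?g" "h 4 i = U i" using pre i by (auto simp: tabs_def)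
    have a: "i * N + ?g < 2 ^ w" using rN_le[OF i(2) pre(3)] B_less by blast
    have iw: "i < 2 ^ w" using i N_le_B by (intro B_less) linarith
    have c: "cv r ?y ?g (Suc i) mod q i ?g = cv r ?y ?g i" using cv_step[OF i(2)] by simp
    have ex: "(\<forall>j<r. i \<le> j \<longrightarrow> cv r ?y ?g j < U j) \<longleftrightarrow>
        (\<forall>j<r. Suc i \<le> j \<longrightarrow> cv r ?y ?g j < U j) \<and> cv r ?y ?g i < U i"
      using i(2) by (auto simp: Suc_le_eq le_less)
    show "wp (Asg 32 (Bin Sub (Var 32) (Num 1)) ;;
       Asg 30 (Bin Mod (Var 30) (Ld 2 (Bin Add (Bin Mul (Var 32) (Var 6)) (Var 28)))) ;;
       Asg 26 (Bin Mul (Var 26) (Bin Lt (Var 30) (Ld 4 (Var 32)))))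
        (\<lambda>v'' h''. ?I v'' h'' \<and> v'' 32 < v' 32) v' h'"
      by (intro wp_Sq wp_Asg)
         (use I i iw t c a le_sum_less[OF a] in \<open>simp_all add: ex\<close>)
  qed simp
qed simp

text \<open>Coordinate \<open>s * N + g\<close> of a vector is placed in column \<open>s\<close> and
  row \<open>g\<close>. Positions past the dimension hold 0 in every vector and thus never spoil
  orthogonality.\<close>

definition bits :: "(nat \<Rightarrow> nat) \<Rightarrow> nat \<Rightarrow> nat \<Rightarrow> nat \<Rightarrow> nat" where
  "bits mm x s g = (if s * N + g < d then mm (x * d + (s * N + g)) else 0)"

lemma wp_validP:
  assumes pre: "v 2 = d" "v 6 = N" "v 8 = r" "v 20 < k * n" "v 22 < l" "tabs h"
    and post: "\<And>v'. (\<forall>x<26. v' x = v x) \<Longrightarrow>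
      v' 26 = (if valid (bits (h 0) (v 20) (v 22)) (v 24) then 1 else 0) \<Longrightarrow> Q v' h"
  shows "wp validP Q v h"
  unfolding validP_def
proof (intro wp_Sq wp_Asg)
  let ?a = "bits (h 0) (v 20) (v 22)"
  let ?c = "\<lambda>g. (\<forall>i<r. cv r (v 24) g i < U i) \<and> cv r (v 24) g 0 = ?a g"
  let ?I = "\<lambda>i v' h'. h' = h \<and> (\<forall>x<26. v' x = v x) \<and> v' 26 = (if \<forall>g<i. ?c g then 1 else 0)"
  show "wp (For False 28 (Var 6)
      (Asg 30 (Var 24) ;; chainP ;;
       Asg 34 (Bin Add (Bin Mul (Var 22) (Var 6)) (Var 28)) ;;
       Ite (Bin Lt (Var 34) (Var 2))
         (Asg 36 (Ld 0 (Bin Add (Bin Mul (Var 20) (Var 2)) (Var 34))))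
         (Asg 36 (Num 0)) ;;
       Asg 26 (Bin Mul (Var 26) (Bin Equal (Var 30) (Var 36))))) Q (v(26 := ev w (Num 1) v h)) h"
  proof (rule wp_For[where I = ?I and L = N])
    show "?I 0 ((v(26 := ev w (Num 1) v h))(28 := 0)) h" by simp
    show "okE w (Var 6) v' h' \<and> ev w (Var 6) v' h' = N" if "?I i v' h'" for i v' h'
      using that pre by simp
    show "Q v' h'" if "?I N v' h'" for v' h'
      using that by (auto intro!: post simp: valid_def)
    show "N \<le> b False" "N < 2 ^ w" using N_le_B bF B_less by auto
    fix i v' h' assume i: "i < N" and I: "?I i v' h'" and v28: "v' 28 = i"
    have I': "h' = h" "\<And>x. x < 26 \<Longrightarrow> v' x = v x" "v' 26 = (if \<forall>g<i. ?c g then 1 else 0)"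
      using I by auto
    have a: "v 22 * N + i < 2 ^ w" using lN_le[OF pre(5) i] B_less by blast
    have a': "v 20 * d + (v 22 * N + i) < 2 ^ w"
      using nB_less[of "v 20" d "v 22 * N + i"] pre(4) d_le_B lN_le[OF pre(5) i] by simp
    \<comment> \<open>Opaque names for the quantified facts keep the simplifier from rewriting
      inside them.\<close>
    obtain pa pb where p: "(\<forall>g<i. ?c g) = pa" "(\<forall>j<r. cv r (v 24) i j < U j) = pb" by blast
    have ex: "(\<forall>g<Suc i. ?c g) \<longleftrightarrow> pa \<and> pb \<and> cv r (v 24) i 0 = ?a i"
      unfolding p[symmetric] by (auto simp: less_Suc_eq)
    have b: "v 22 * N + i < d \<Longrightarrow> ?a i = h 0 (v 20 * d + (v 22 * N + i))"
        "\<not> v 22 * N + i < d \<Longrightarrow> ?a i = 0" by (simp_all add: bits_def)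
    show "wp (Asg 30 (Var 24) ;; chainP ;;
       Asg 34 (Bin Add (Bin Mul (Var 22) (Var 6)) (Var 28)) ;;
       Ite (Bin Lt (Var 34) (Var 2))
         (Asg 36 (Ld 0 (Bin Add (Bin Mul (Var 20) (Var 2)) (Var 34))))
         (Asg 36 (Num 0)) ;;
       Asg 26 (Bin Mul (Var 26) (Bin Equal (Var 30) (Var 36))))
      (\<lambda>v' h'. v' 28 = i \<and> ?I (Suc i) (v'(28 := Suc i)) h') v' h'"
    proof (intro wp_Sq wp_Asg)
      show "okE w (Var 24) v' h'" by simp
      show "wp chainP (wp (Asg 34 (Bin Add (Bin Mul (Var 22) (Var 6)) (Var 28)) ;;
       Ite (Bin Lt (Var 34) (Var 2))
         (Asg 36 (Ld 0 (Bin Add (Bin Mul (Var 20) (Var 2)) (Var 34))))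
         (Asg 36 (Num 0)) ;;
       Asg 26 (Bin Mul (Var 26) (Bin Equal (Var 30) (Var 36))))
         (\<lambda>v' h'. v' 28 = i \<and> ?I (Suc i) (v'(28 := Suc i)) h')) (v'(30 := ev w (Var 24) v' h')) h'"
      proof (rule wp_chainP, goal_cases)
        case (6 u)
        have u: "u 6 = N" "u 2 = d" "u 20 = v 20" "u 22 = v 22" "u 28 = i" "u 24 = v 24"
            "\<And>x. x < 26 \<Longrightarrow> u x = v x" "u 30 = cv r (v 24) i 0"
            "u 26 = (if pa \<and> pb then 1 else 0)"
          using 6 I' pre v28 p by auto
        show ?case
          by (intro wp_Sq wp_Asg wp_Ite)
             (use u a a' b le_sum_less[OF a] le_sum_less[OF a'] I'(1) in
               \<open>simp_all only: ex, simp_all split: if_split_asm\<close>)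
      qed (use I' pre v28 i in auto)
    qed
  qed
qed simp

lemma enc_bits_less:
  assumes "\<And>g. g < N \<Longrightarrow> a g < 2"
  shows "enc a < 2 ^ w" "enc a \<le> B"
proof -
  have "enc a \<le> B" using enc(2)[of a] assms U_le_M[of r] N_le_B by fastforce
  then show "enc a < 2 ^ w" "enc a \<le> B" using B_less by blast+
qed

lemma wp_encP:
  assumes pre: "v 2 = d" "v 6 = N" "v 8 = r" "v 20 < k * n" "v 22 < l" "tabs h"
      "\<And>g. g < N \<Longrightarrow> bits (h 0) (v 20) (v 22) g < 2"
    and post: "\<And>v'. (\<forall>x<24. v' x = v x) \<Longrightarrow> v' 24 = enc (bits (h 0) (v 20) (v 22)) \<Longrightarrow> Q v' h"
  shows "wp encP Q v h"
  unfolding encP_def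
proof (intro wp_Sq wp_Asg)
  let ?a = "bits (h 0) (v 20) (v 22)"
  let ?I = "\<lambda>v' h'. h' = h \<and> (\<forall>x<24. v' x = v x) \<and> v' 26 = (if valid ?a (v' 24) then 1 else 0) \<and>
      v' 24 \<le> enc ?a"
  have e: "valid ?a (enc ?a)" "enc ?a \<le> B" using enc(1)[of ?a] enc_bits_less[of ?a] pre by auto
  show "wp validP (wp (Wh False (Bin Equal (Var 26) (Num 0))
      (Asg 24 (Bin Add (Var 24) (Num 1)) ;; validP)) Q) (v(24 := ev w (Num 0) v h)) h"
  proof (rule wp_validP, goal_cases)
    case (7 u)
    show ?case
    \<comment> \<open>The candidate never passes the least valid code and a valid candidate is never
      below it; so the distance is a variant and the loop stops exactly at
      \<open>enc ?a\<close>.\<close>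
    proof (rule wp_Wh[where I = ?I and \<mu> = "\<lambda>v h. enc ?a - v 24"])
      show "?I u h" using 7 by simp
      show "enc ?a - u 24 \<le> b False" using e bF by simp
      show "okE w (Bin Equal (Var 26) (Num 0)) v' h'" for v' h' by simp
      show "Q v' h'" if "?I v' h'" "ev w (Bin Equal (Var 26) (Num 0)) v' h' = 0" for v' h'
      proof -
        have "valid ?a (v' 24)" using that by (auto split: if_split_asm)
        then have "enc ?a \<le> v' 24" unfolding enc_def by (rule Least_le)
        then show ?thesis using that post[of v'] by simp
      qed
      fix v' h' assume I: "?I v' h'" and "ev w (Bin Equal (Var 26) (Num 0)) v' h' \<noteq> 0"
      then have "\<not> valid ?a (v' 24)" by (auto split: if_split_asm)
      then have lt: "v' 24 < enc ?a" using I e by (metis le_neq_implies_less)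
      have x: "Suc (v' 24) < 2 ^ w" using lt e B_less by (meson Suc_leI order_trans)
      show "wp (Asg 24 (Bin Add (Var 24) (Num 1)) ;; validP)
          (\<lambda>v'' h''. ?I v'' h'' \<and> enc ?a - v'' 24 < enc ?a - v' 24) v' h'"
      proof (intro wp_Sq wp_Asg)
        show "wp validP (\<lambda>v'' h''. ?I v'' h'' \<and> enc ?a - v'' 24 < enc ?a - v' 24)
            (v'(24 := ev w (Bin Add (Var 24) (Num 1)) v' h')) h'"
          by (rule wp_validP) (use I pre lt in auto)
      qed (use x in simp)
    qed
  qed (use pre in auto)
qed simp

lemma wp_inVP:
  assumes pre: "v 6 = N" "v 8 = r" "tabs h"
    and post: "\<And>v'. (\<forall>x<26. x \<noteq> 18 \<longrightarrow> v' x = v x) \<Longrightarrow>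
      v' 18 = (if \<forall>g<N. cv r (v 14) g 0 = 0 then 1 else 0) \<Longrightarrow> Q v' h"
  shows "wp inVP Q v h"
  unfolding inVP_def
proof (intro wp_Sq wp_Asg)
  let ?I = "\<lambda>i v' h'. h' = h \<and> (\<forall>x<26. x \<noteq> 18 \<longrightarrow> v' x = v x) \<and>
      v' 18 = (if \<forall>g<i. cv r (v 14) g 0 = 0 then 1 else 0)"
  show "wp (For False 28 (Var 6)
      (Asg 30 (Var 14) ;; Asg 26 (Num 1) ;; chainP ;;
       Asg 18 (Bin Mul (Var 18) (Bin Equal (Var 30) (Num 0))))) Q (v(18 := ev w (Num 1) v h)) h"
  proof (rule wp_For[where I = ?I and L = N])
    show "?I 0 ((v(18 := ev w (Num 1) v h))(28 := 0)) h" by simp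
    show "okE w (Var 6) v' h' \<and> ev w (Var 6) v' h' = N" if "?I i v' h'" for i v' h'
      using that pre by simp
    show "Q v' h'" if "?I N v' h'" for v' h' using that by (auto intro!: post)
    show "N \<le> b False" "N < 2 ^ w" using N_le_B bF B_less by auto
    fix i v' h' assume i: "i < N" and I: "?I i v' h'" and v28: "v' 28 = i"
    obtain pa where p: "(\<forall>g<i. cv r (v 14) g 0 = 0) = pa" by blast
    have ex: "(\<forall>g<Suc i. cv r (v 14) g 0 = 0) \<longleftrightarrow> pa \<and> cv r (v 14) i 0 = 0"
      unfolding p[symmetric] by (auto simp: less_Suc_eq)
    have I': "h' = h" "\<And>x. x < 26 \<Longrightarrow> x \<noteq> 18 \<Longrightarrow> v' x = v x" "v' 18 = (if pa then 1 else 0)"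
      using I p by auto
    show "wp (Asg 30 (Var 14) ;; Asg 26 (Num 1) ;; chainP ;;
       Asg 18 (Bin Mul (Var 18) (Bin Equal (Var 30) (Num 0))))
      (\<lambda>v' h'. v' 28 = i \<and> ?I (Suc i) (v'(28 := Suc i)) h') v' h'"
    proof (intro wp_Sq wp_Asg)
      show "wp chainP (wp (Asg 18 (Bin Mul (Var 18) (Bin Equal (Var 30) (Num 0))))
         (\<lambda>v' h'. v' 28 = i \<and> ?I (Suc i) (v'(28 := Suc i)) h'))
         ((v'(30 := ev w (Var 14) v' h'))(26 := ev w (Num 1) (v'(30 := ev w (Var 14) v' h')) h')) h'"
      proof (rule wp_chainP, goal_cases)
        case (6 u)
        have u: "u 28 = i" "u 18 = (if pa then 1 else 0)"
            "\<And>x. x < 26 \<Longrightarrow> x \<noteq> 18 \<Longrightarrow> u x = v x" "u 30 = cv r (v 14) i 0"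
          using 6 I' pre v28 p by auto
        show ?case
          by (intro wp_Sq wp_Asg)
             (use u I'(1) in \<open>simp_all only: ex, simp_all split: if_split_asm\<close>)
      qed (use I' pre v28 i in auto)
    qed (use I' in simp_all)
  qed
qed simp

text \<open>The memory image of a query in two's complement. The reduction modulo
  \<open>2 ^ w\<close> matters for \<open>x = 0\<close>, where \<open>2 ^ w - x\<close> is not a
  word.\<close>

definition target :: "(nat \<Rightarrow> nat) \<Rightarrow> nat \<Rightarrow> nat \<Rightarrow> nat \<Rightarrow> nat" where
  "target mm x y j = (if j < l then enc (bits mm y j) else if y < n then (2 ^ w - x) mod 2 ^ w else 1)"

lemma addr_eq:
  assumes "j < L" "j' < L"
  shows "i * L + j = i' * L + j' \<longleftrightarrow> i = i' \<and> j = (j'::nat)"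
proof
  assume eq: "i * L + j = i' * L + j'"
  have "i = (i * L + j) div L" "i' = (i' * L + j') div L" using assms by auto
  then show "i = i' \<and> j = j'" using eq by auto
qed simp

lemma wp_buildP:
  assumes pre: "v 0 = n" "v 2 = d" "v 4 = l" "v 6 = N" "v 8 = r" "tabs h"
      "\<And>y s g. y < k * n \<Longrightarrow> s < l \<Longrightarrow> g < N \<Longrightarrow> bits (h 0) y s g < 2"
    and post: "\<And>v' f. (\<forall>x<20. v' x = v x) \<Longrightarrow>
      (\<forall>y<k * n. \<forall>j\<le>l. f (y * (l + 1) + j) = target (h 0) (v 14) y j) \<Longrightarrow> Q v' (h(1 := f))"
  shows "wp (buildP k) Q v h"
  unfolding buildP_def
proof -
  let ?good = "\<lambda>f y j. f (y * (l + 1) + j) = target (h 0) (v 14) y j"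
  let ?I = "\<lambda>y v' h'. \<exists>f. h' = h(1 := f) \<and> (\<forall>x<20. v' x = v x) \<and> (\<forall>y'<y. \<forall>j\<le>l. ?good f y' j)"
  let ?body = "encP ;; Sto 1 (Bin Add (Bin Mul (Var 20) (Bin Add (Var 4) (Num 1))) (Var 22)) (Var 24)"
  have kn: "k < 2 ^ w" "k * n < 2 ^ w" "l + 1 < 2 ^ w"
    using B_less[of k] B_less[of "l + 1"] nB_less[of "k * n" 1 0] B N_le_B(5) by simp_all
  show "wp (For True 20 (Bin Mul (Num k) (Var 0))
     (For False 22 (Var 4) ?body ;;
      Asg 24 (Bin Add (Bin Mul (Var 20) (Bin Add (Var 4) (Num 1))) (Var 4)) ;;
      Ite (Bin Lt (Var 20) (Var 0)) (Sto 1 (Var 24) (Bin Sub (Num 0) (Var 14)))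
        (Sto 1 (Var 24) (Num 1)))) Q v h"
  proof (rule wp_For[where I = ?I and L = "k * n"])
    show "?I 0 (v(20 := 0)) h" by (intro exI[of _ "h 1"]) auto
    show "okE w (Bin Mul (Num k) (Var 0)) v' h' \<and> ev w (Bin Mul (Num k) (Var 0)) v' h' = k * n"
      if "?I i v' h'" for i v' h' using that pre kn by auto
    show "Q v' h'" if "?I (k * n) v' h'" for v' h' using that post by blast
    show "k * n \<le> b True" by (simp add: bT)
    show "k * n < 2 ^ w" by (rule kn)
    fix y v' h' assume y: "y < k * n" and "?I y v' h'" and v20: "v' 20 = y"
    then obtain f where I: "h' = h(1 := f)" "\<And>x. x < 20 \<Longrightarrow> v' x = v x"
        "\<And>y' j. y' < y \<Longrightarrow> j \<le> l \<Longrightarrow> ?good f y' j" by blast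
    let ?J = "\<lambda>s v'' h''. \<exists>f. h'' = h(1 := f) \<and> (\<forall>x<20. v'' x = v x) \<and> v'' 20 = y \<and>
        (\<forall>y'<y. \<forall>j\<le>l. ?good f y' j) \<and> (\<forall>j<s. ?good f y j)"
    have a: "y * (l + 1) + s < 2 ^ w" if "s \<le> l" for s
      using that y N_le_B by (intro nB_less) auto
    have al: "y * (l + 1) < 2 ^ w" using a[of 0] by simp
    show "wp (For False 22 (Var 4) ?body ;;
      Asg 24 (Bin Add (Bin Mul (Var 20) (Bin Add (Var 4) (Num 1))) (Var 4)) ;;
      Ite (Bin Lt (Var 20) (Var 0)) (Sto 1 (Var 24) (Bin Sub (Num 0) (Var 14)))
        (Sto 1 (Var 24) (Num 1)))
      (\<lambda>v' h'. v' 20 = y \<and> ?I (Suc y) (v'(20 := Suc y)) h') v' h'"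
    proof (rule wp_Sq, rule wp_For[where I = ?J and L = l])
      show "?J 0 (v'(22 := 0)) h'" using I v20 by auto
      show "okE w (Var 4) v'' h'' \<and> ev w (Var 4) v'' h'' = l" if "?J s v'' h''" for s v'' h''
        using that pre by auto
      show "l \<le> b False" "l < 2 ^ w" using N_le_B bF B_less by auto
    next
      fix s u h'' assume s: "s < l" and "?J s u h''" and u22: "u 22 = s"
      then obtain f where J: "h'' = h(1 := f)" "\<And>x. x < 20 \<Longrightarrow> u x = v x" "u 20 = y"
          "\<And>y' j. y' < y \<Longrightarrow> j \<le> l \<Longrightarrow> ?good f y' j" "\<And>j. j < s \<Longrightarrow> ?good f y j" by blast
      have as: "y * (l + 1) + s < 2 ^ w" using a[of s] s by simp
      show "wp ?body (\<lambda>v' h'. v' 22 = s \<and> ?J (Suc s) (v'(22 := Suc s)) h') u h''"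
      proof (rule wp_Sq, rule wp_encP, goal_cases)
        case (8 z)
        have z: "z 20 = y" "z 22 = s" "z 24 = enc (bits (h 0) y s)" "z 4 = l"
            "\<And>x. x < 20 \<Longrightarrow> z x = v x"
          using 8 J u22 pre by auto
        define f' where "f' = f(y * (l + 1) + s := enc (bits (h 0) y s))"
        have new: "?good f' y s" using s by (simp add: f'_def target_def)
        have old: "?good f' y' j" if "y' < y \<and> j \<le> l \<or> y' = y \<and> j < s" for y' j
          using that J(4)[of y' j] J(5)[of j] s addr_eq[of j "l + 1" s y' y]
          unfolding f'_def by (auto simp del: add_mult_distrib2 mult_Suc_right)
        have "h''(1 := (h'' 1)(y * (l + 1) + s := z 24)) = h(1 := f')"
          by (simp add: J(1) f'_def z)
        moreover have "\<forall>j<Suc s. ?good f' y j" using new old by (auto simp: less_Suc_eq)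
        ultimately show ?case
          using z as le_sum_less[OF as] kn(3) old u22
          by (intro wp_Sto) auto
      qed (use J s y pre u22 in \<open>auto simp: tabs_def\<close>)
    next
      fix u h'' assume "?J l u h''"
      then obtain f where J: "h'' = h(1 := f)" "\<And>x. x < 20 \<Longrightarrow> u x = v x" "u 20 = y"
          "\<And>y' j. y' < y \<Longrightarrow> j \<le> l \<Longrightarrow> ?good f y' j" "\<And>j. j < l \<Longrightarrow> ?good f y j" by blast
      define f' where "f' = f(y * (l + 1) + l := target (h 0) (v 14) y l)"
      have "?good f' y' j" if "y' < Suc y" "j \<le> l" for y' j
        using that J(4)[of y' j] J(5)[of j] addr_eq[of j "l + 1" l y' y]
        unfolding f'_def by (cases "y' = y"; cases "j = l") auto
      then have fin: "\<exists>f''. h(1 := f(y * (l + 1) + l :=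
            (if y < n then (2 ^ w - v 14) mod 2 ^ w else 1))) = h(1 := f'') \<and>
          (\<forall>y'<Suc y. \<forall>j\<le>l. ?good f'' y' j)"
        by (intro exI[of _ f']) (simp add: f'_def target_def)
      show "wp (Asg 24 (Bin Add (Bin Mul (Var 20) (Bin Add (Var 4) (Num 1))) (Var 4)) ;;
        Ite (Bin Lt (Var 20) (Var 0)) (Sto 1 (Var 24) (Bin Sub (Num 0) (Var 14)))
          (Sto 1 (Var 24) (Num 1)))
        (\<lambda>v' h'. v' 20 = y \<and> ?I (Suc y) (v'(20 := Suc y)) h') u h''"
        by (intro wp_Sq wp_Asg wp_Ite wp_Sto)
           (use J pre a[of l] al kn fin in
             \<open>(simp_all split: if_split_asm, blast+)\<close>)
    qed
  qed
qed

definition query :: "(nat \<Rightarrow> nat) \<Rightarrow> nat \<Rightarrow> nat \<Rightarrow> nat \<Rightarrow> nat \<Rightarrow> int" where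
  "query mm x t i j = (if j < l then int (enc (bits mm (t * n + i) j)) else if t = 0 then - int x else 1)"

lemma target_query:
  assumes "t < k" "i < n" "j \<le> l" "x < M r"
    and "\<And>y s g. y < k * n \<Longrightarrow> s < l \<Longrightarrow> g < N \<Longrightarrow> bits mm y s g < 2"
  shows "int (target mm x (t * n + i) j) = query mm x t i j mod 2 ^ w"
proof (cases "j < l")
  case True
  have y: "t * n + i < k * n" by (rule pair_le[OF assms(1,2)])
  have "enc (bits mm (t * n + i) j) < 2 ^ w"
    using assms(5)[OF y True] by (intro enc_bits_less) auto
  then have "int (enc (bits mm (t * n + i) j)) < 2 ^ w" by (metis of_nat_less_iff of_nat_numeral of_nat_power)
  then show ?thesis using True by (simp add: target_def query_def)
next
  case False
  \<comment> \<open>The program sees only the running number of a vector, the integer query its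
    collection \<open>t\<close>.\<close>
  have lt: "t * n + i < n \<longleftrightarrow> t = 0"
  proof
    assume "t * n + i < n"
    then have "\<not> 1 * n \<le> t * n" by linarith
    then show "t = 0" by (metis One_nat_def Suc_leI mult_le_mono1 neq0_conv)
  qed (use assms in simp)
  have x: "x < 2 ^ w" using assms N_le_B by (intro B_less) linarith
  have "int ((2 ^ w - x) mod 2 ^ w) = (2 ^ w - int x) mod 2 ^ w"
    using x by (simp add: of_nat_mod of_nat_diff)
  also have "\<dots> = (- int x) mod 2 ^ w" using mod_add_self2[of "- int x" "2 ^ w"] by simp
  finally have 1: "int ((2 ^ w - x) mod 2 ^ w) = (- int x) mod 2 ^ w" .
  have "(1::int) < 2 ^ w" using w1 by (intro one_less_power) auto
  then have "(1::int) mod 2 ^ w = 1" using w1 by simp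
  then show ?thesis using False assms 1 lt w1 by (simp add: target_def query_def)
qed

lemma wp_mainP:
  assumes solver: "\<And>x s. x < M r \<Longrightarrow> input_state w k n (l + 1) (query (h 0) x) s \<Longrightarrow>
      \<exists>\<tau> s'. exec w A s \<tau> s' \<and> \<tau> \<le> T \<and> reg s' 0 = (if kOV_yes k n (l + 1) (query (h 0) x) then 1 else 0)"
    and pre: "v 0 = n" "v 2 = d" "v 4 = l" "v 6 = N" "v 8 = r" "v 12 = M r" "tabs h"
      "\<And>y s g. y < k * n \<Longrightarrow> s < l \<Longrightarrow> g < N \<Longrightarrow> bits (h 0) y s g < 2"
    and post: "\<And>v' h'. v' 0 = (if \<exists>x<M r. (\<forall>g<N. cv r x g 0 = 0) \<and>
      kOV_yes k n (l + 1) (query (h 0) x) then 1 else 0) \<Longrightarrow> Q v' h'"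
  shows "wp (mainP k) Q v h"
  unfolding mainP_def
proof (rule wp_Sq, rule wp_Asg, simp, rule wp_Sq)
  let ?c = "\<lambda>x. (\<forall>g<N. cv r x g 0 = 0) \<and> kOV_yes k n (l + 1) (query (h 0) x)"
  \<comment> \<open>Restricted to even registers and banks, which are the ones preserved by a call;
    in particular the instance in bank 0 stays available.\<close>
  let ?I = "\<lambda>x v' h'. (\<forall>c. even c \<longrightarrow> h' c = h c) \<and> (\<forall>y<14. even y \<longrightarrow> v' y = v y) \<and>
      v' 16 = (if \<exists>x'<x. ?c x' then 1 else 0)"
  let ?B = "buildP k ;; Asg 1 (Var 0) ;; Asg 3 (Bin Add (Var 4) (Num 1)) ;; Cl ;;
          Ite (Var 1) (Asg 16 (Num 1)) (Asg 16 (Var 16))"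
  show "wp (For False 14 (Var 12) (inVP ;; Ite (Var 18) ?B (Asg 16 (Var 16))))
     (wp (Asg 0 (Var 16)) Q) (v(16 := ev w (Num 0) v h)) h"
  proof (rule wp_For[where I = ?I and L = "M r"])
    show "?I 0 ((v(16 := ev w (Num 0) v h))(14 := 0)) h" by simp
    show "okE w (Var 12) v' h' \<and> ev w (Var 12) v' h' = M r" if "?I i v' h'" for i v' h'
      using that pre by simp
    show "wp (Asg 0 (Var 16)) Q v' h'" if "?I (M r) v' h'" for v' h'
      by (rule wp_Asg) (use that in \<open>auto intro!: post\<close>)
    show "M r \<le> b False" "M r < 2 ^ w" using N_le_B bF B_less by auto
    fix x v' h' assume x: "x < M r" and I: "?I x v' h'" and v14: "v' 14 = x"
    obtain pa where pa: "(\<exists>x'<x. ?c x') = pa" by blast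
    have ex: "(\<exists>x'<Suc x. ?c x') \<longleftrightarrow> pa \<or> ?c x"
      unfolding pa[symmetric] by (auto simp: less_Suc_eq)
    have r': "v' 0 = n" "v' 2 = d" "v' 4 = l" "v' 6 = N" "v' 8 = r" "v' 12 = M r"
        "\<And>y. y < 14 \<Longrightarrow> even y \<Longrightarrow> v' y = v y" "v' 16 = (if pa then 1 else 0)"
      using I pre pa by auto
    have h': "\<And>c. even c \<Longrightarrow> h' c = h c" using I by blast
    have t': "tabs h'" using pre(7) h'[of 2] h'[of 4] by (simp add: tabs_def)
    let ?Q = "\<lambda>u h''. u 14 = x \<and> ?I (Suc x) (u(14 := Suc x)) h''"
    show "wp (inVP ;; Ite (Var 18) ?B (Asg 16 (Var 16))) ?Q v' h'"
    proof (rule wp_Sq, rule wp_inVP, goal_cases)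
      case (4 u)
      have u: "u 0 = n" "u 2 = d" "u 4 = l" "u 6 = N" "u 8 = r" "u 14 = x"
        "\<And>y. y < 14 \<Longrightarrow> even y \<Longrightarrow> u y = v y" "u 16 = (if pa then 1 else 0)"
        "u 18 = (if \<forall>g<N. cv r x g 0 = 0 then 1 else 0)"
        using 4 r' v14 by auto
      show ?case
      proof (rule wp_Ite)
        assume "ev w (Var 18) u h' = 0"
        then have "\<not> (\<forall>g<N. cv r x g 0 = 0)" using u(9) by (auto split: if_split_asm)
        then have ex': "(\<exists>x'<Suc x. ?c x') = pa" unfolding ex by blast
        show "wp (Asg 16 (Var 16)) ?Q u h'"
          by (rule wp_Asg) (use u h' in \<open>simp_all only: ex', simp_all\<close>)
      next
        assume "ev w (Var 18) u h' \<noteq> 0"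
        then have inV: "\<forall>g<N. cv r x g 0 = 0" using u(9) by (auto split: if_split_asm)
        have ex': "(\<exists>x'<Suc x. ?c x') \<longleftrightarrow> pa \<or> kOV_yes k n (l + 1) (query (h 0) x)"
          unfolding ex using inV by blast
        show "wp ?B ?Q u h'"
        proof (rule wp_Sq, rule wp_buildP, goal_cases)
          case (8 z f)
          have z: "z 0 = n" "z 4 = l" "z 14 = x" "\<And>y. y < 14 \<Longrightarrow> even y \<Longrightarrow> z y = v y"
              "z 16 = (if pa then 1 else 0)"
            using 8 u by auto
          have l1: "Suc l < 2 ^ w" using N_le_B(5) B_less by simp
          show ?case
          proof (intro wp_Sq wp_Asg)
            let ?z = "(z(1 := ev w (Var 0) z (h'(1 := f))))
              (3 := ev w (Bin Add (Var 4) (Num 1)) (z(1 := ev w (Var 0) z (h'(1 := f)))) (h'(1 := f)))"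
            show "wp Cl (wp (Ite (Var 1) (Asg 16 (Num 1)) (Asg 16 (Var 16))) ?Q) ?z (h'(1 := f))"
            proof (rule wp_Cl[where n = n and d = "l + 1" and k = k and X = "query (h 0) x"
                and ans = "if kOV_yes k n (l + 1) (query (h 0) x) then 1 else 0"], goal_cases)
              case (1 s)
              then show ?case by (rule solver[OF x])
            next
              case (4 t i j)
              have "t * n + i < k * n" using pair_le 4 by blast
              then have "(h'(1 := f)) 1 ((t * n + i) * (l + 1) + j) = target (h 0) x (t * n + i) j"
                using 8(2) 4 u(6) h'[of 0] by simp
              then show ?case using target_query[of t i j x "h 0"] 4 x pre(8) by simp
            next
              case (5 y g)
              note e = 5(1)[rule_format] and hg = 5(2)[rule_format]
              have y: "y 14 = x" "y 16 = (if pa then 1 else 0)" using e[of 14] e[of 16] z by simp_all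
              have y': "y a = v a" if "a < 14" "even a" for a
              proof -
                have "a \<noteq> 1" "a \<noteq> 3" using that by auto
                then show ?thesis using e[OF that(2)] z(4)[OF that] by simp
              qed
              have g: "g c = h c" if "even c" for c
              proof -
                have "c \<noteq> 1" using that by auto
                then show ?thesis using hg[OF that] h'[OF that] by simp
              qed
              show ?case
                by (intro wp_Ite wp_Asg)
                   (use y y' g 5(3) in \<open>simp_all only: ex', simp_all split: if_split_asm\<close>)
            qed (use z in simp_all)
          qed (use z l1 in simp_all)
        qed (use u t' h'[of 0] pre(8) in simp_all)
      qed simp
    qed (use r' t' in simp_all)
  qed
qed

end

section \<open>Programs for the level parameters\<close>

definition mulP :: "nat \<Rightarrow> stm" where
  "mulP k = Asg 12 (Var 4) ;; For False 22 (Num k) (Asg 12 (Bin Mul (Var 12) (Var 10)))"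

text \<open>Trial division by all smaller numbers above 1. This is affordable as every prime sought
  is at most \<open>U r\<close> and hence at most \<open>B\<close>.\<close>

definition nextP :: stm where
  "nextP = Asg 24 (Num 0) ;; Wh False (Bin Equal (Var 24) (Num 0))
     (Asg 20 (Bin Add (Var 20) (Num 1)) ;; Asg 24 (Num 1) ;;
      For False 22 (Var 20)
        (Ite (Bin Lt (Num 1) (Var 22))
          (Ite (Bin Equal (Bin Mod (Var 20) (Var 22)) (Num 0)) (Asg 24 (Num 0)) (Asg 24 (Var 24)))
          (Asg 24 (Var 24))))"

text \<open>A new prime is entered at once for all rows whose block has the matching position in its
  parent; \<open>chainP\<close> can then look up its modulus by level and row.\<close>

definition fillP :: stm where
  "fillP = For False 22 (Var 6)
     (Ite (Bin Equal (Bin Mod (Bin Div (Var 22) (Var 14)) (Var 16)) (Var 18))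
       (Sto 2 (Bin Add (Bin Mul (Var 8) (Var 6)) (Var 22)) (Var 20)) (Asg 10 (Var 10)))"

text \<open>During the setup register 8 holds the level \<open>i\<close>, 14 holds
  \<open>P i\<close>, 16 holds \<open>m i\<close>, 18 counts the primes, 20 is the current prime,
  and 10 turns from \<open>U i\<close> into the product that becomes
  \<open>U (Suc i)\<close>.\<close>

definition levelP :: "nat \<Rightarrow> stm" where
  "levelP k = Sto 4 (Var 8) (Var 10) ;; mulP k ;;
     Asg 16 (Bin Add (Bin Div (Var 6) (Var 14)) (Num 1)) ;;
     Ite (Bin Lt (Var 12) (Var 16)) (Asg 16 (Var 12)) (Asg 16 (Var 16)) ;;
     Asg 10 (Num 1) ;; Asg 20 (Var 12) ;;
     For False 18 (Var 16) (nextP ;; Asg 10 (Bin Mul (Var 10) (Var 20)) ;; fillP) ;;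
     Asg 14 (Bin Mul (Var 14) (Var 16)) ;; Asg 8 (Bin Add (Var 8) (Num 1))"

definition setupP :: "nat \<Rightarrow> stm" where
  "setupP k = Asg 14 (Num 1) ;; Asg 10 (Num 2) ;; Asg 8 (Num 0) ;;
     Wh False (Bin Lt (Var 14) (Var 6)) (levelP k) ;; mulP k"

text \<open>Every modulus divides the product \<open>U (Suc i)\<close>. This keeps the search for
  primes within \<open>B\<close>.\<close>

lemma (in tower_code) iterate_nextp_le_U: "j < m i \<Longrightarrow> (nextp ^^ Suc j) (M i) \<le> U (Suc i)"
proof -
  assume j: "j < m i"
  have "(nextp ^^ Suc j) (M i) = (\<Prod>j'\<in>{j}. (nextp ^^ Suc j') (M i))" by simp
  also have "\<dots> \<le> U (Suc i)" unfolding lev_simps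
    using j by (intro dvd_imp_le prod_dvd_prod_subset prod_pos)
      (auto simp del: funpow.simps intro!: less_iterate_nextp[of _ "M i", THEN le_less_trans[OF le0]])
  finally show ?thesis .
qed

lemma (in tower_code) M_less_U: "M i < U (Suc i)"
  using iterate_nextp_le_U[of 0 i] m_pos[of i] nextp(1)[of "M i"] by simp

lemma (in tower_code) U_mono: "i \<le> j \<Longrightarrow> U i \<le> U j"
proof (induction j rule: dec_induct)
  case (step j)
  then show ?case using U_le_M[of j] M_less_U[of j] by linarith
qed simp

lemma (in tower_code) M_mono: "i \<le> j \<Longrightarrow> M i \<le> M j"
  unfolding M_def using U_mono by (intro mult_left_mono power_mono) auto

context ovram begin

lemma wp_mulP:
  assumes pre: "v 4 = l" "v 10 = U i" "i \<le> r"
    and post: "\<And>v'. (\<forall>x<22. x \<noteq> 12 \<longrightarrow> v' x = v x) \<Longrightarrow> v' 12 = M i \<Longrightarrow> Q v' h"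
  shows "wp (mulP k) Q v h"
  unfolding mulP_def
proof (intro wp_Sq wp_Asg)
  let ?I = "\<lambda>j v' h'. h' = h \<and> (\<forall>x<22. x \<noteq> 12 \<longrightarrow> v' x = v x) \<and> v' 12 = l * U i ^ j"
  have kB: "k \<le> B" using B by linarith
  show "wp (For False 22 (Num k) (Asg 12 (Bin Mul (Var 12) (Var 10)))) Q (v(12 := ev w (Var 4) v h)) h"
  proof (rule wp_For[where I = ?I and L = k])
    show "?I 0 ((v(12 := ev w (Var 4) v h))(22 := 0)) h" using pre by simp
    show "okE w (Num k) v' h' \<and> ev w (Num k) v' h' = k" for v' h' using B_less[OF kB] by simp
    show "Q v' h'" if "?I k v' h'" for v' h' using that by (auto intro!: post simp: M_def)
    show "k \<le> b False" "k < 2 ^ w" using kB bF B_less by auto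
    fix j v' h' assume j: "j < k" and I: "?I j v' h'" "v' 22 = j"
    have "l * U i ^ Suc j \<le> l * U i ^ k"
      using j U_pos[of i] by (intro mult_left_mono power_increasing) auto
    also have "\<dots> \<le> B" using order.trans[OF M_mono[OF pre(3)] N_le_B(3)] unfolding M_def .
    finally have "l * U i ^ Suc j < 2 ^ w" using B_less by blast
    then show "wp (Asg 12 (Bin Mul (Var 12) (Var 10))) (\<lambda>v' h'. v' 22 = j \<and> ?I (Suc j) (v'(22 := Suc j)) h') v' h'"
      by (intro wp_Asg) (use I pre in \<open>simp_all add: mult_ac\<close>)
  qed
qed simp

lemma prime_iff_no_divisor: "x \<ge> 2 \<Longrightarrow> prime x \<longleftrightarrow> (\<forall>a<x. 1 < a \<longrightarrow> x mod a \<noteq> (0::nat))"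
  unfolding prime_nat_iff' dvd_eq_mod_eq_0 by (auto simp: Suc_le_eq numeral_2_eq_2)

lemma wp_nextP:
  assumes pre: "v 20 \<ge> 1" "nextp (v 20) \<le> B"
    and post: "\<And>v'. (\<forall>x<20. v' x = v x) \<Longrightarrow> v' 20 = nextp (v 20) \<Longrightarrow> Q v' h"
  shows "wp nextP Q v h"
  unfolding nextP_def
proof (intro wp_Sq wp_Asg)
  let ?p = "nextp (v 20)"
  let ?I = "\<lambda>v' h'. h' = h \<and> (\<forall>x<20. v' x = v x) \<and> v 20 \<le> v' 20 \<and> v' 20 \<le> ?p \<and>
      v' 24 = (if v' 20 = ?p then 1 else 0)"
  let ?L = "For False 22 (Var 20)
        (Ite (Bin Lt (Num 1) (Var 22))
          (Ite (Bin Equal (Bin Mod (Var 20) (Var 22)) (Num 0)) (Asg 24 (Num 0)) (Asg 24 (Var 24)))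
          (Asg 24 (Var 24)))"
  show "wp (Wh False (Bin Equal (Var 24) (Num 0))
     (Asg 20 (Bin Add (Var 20) (Num 1)) ;; Asg 24 (Num 1) ;; ?L)) Q (v(24 := ev w (Num 0) v h)) h"
  proof (rule wp_Wh[where I = ?I and \<mu> = "\<lambda>v h. ?p - v 20"])
    show "?I (v(24 := ev w (Num 0) v h)) h" using nextp(1)[of "v 20"] by simp
    show "okE w (Bin Equal (Var 24) (Num 0)) v' h'" for v' h' by simp
    show "Q v' h'" if "?I v' h'" "ev w (Bin Equal (Var 24) (Num 0)) v' h' = 0" for v' h'
      using that by (auto intro!: post split: if_split_asm)
    show "?p - (v(24 := ev w (Num 0) v h)) 20 \<le> b False" using pre bF by simp
    fix v' h' assume I: "?I v' h'" and nz: "ev w (Bin Equal (Var 24) (Num 0)) v' h' \<noteq> 0"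
    define x where "x = Suc (v' 20)"
    have lt: "v' 20 < ?p" using I nz by (auto split: if_split_asm)
    then have x: "x \<le> ?p" "v 20 < x" "x \<ge> 2" "x < 2 ^ w" "x \<le> B"
      using I pre B_less[of x] by (auto simp: x_def)
    \<comment> \<open>No prime lies strictly between the starting point and \<open>?p\<close>, so
      the primality flag signals that \<open>?p\<close> has been reached.\<close>
    have px: "prime x \<longleftrightarrow> x = ?p"
      using nextp(2)[of "v 20"] nextp(3)[OF x(2)] x(1) by auto
    let ?d = "\<lambda>a. 1 < a \<longrightarrow> x mod a \<noteq> 0"
    let ?J = "\<lambda>a u h''. h'' = h \<and> (\<forall>y<20. u y = v y) \<and> u 20 = x \<and>
      u 24 = (if \<forall>a'<a. ?d a' then 1 else 0)"
    show "wp (Asg 20 (Bin Add (Var 20) (Num 1)) ;; Asg 24 (Num 1) ;; ?L)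
        (\<lambda>v'' h''. ?I v'' h'' \<and> ?p - v'' 20 < ?p - v' 20) v' h'"
    proof (intro wp_Sq wp_Asg)
      let ?u = "(v'(20 := ev w (Bin Add (Var 20) (Num 1)) v' h'))
          (24 := ev w (Num 1) (v'(20 := ev w (Bin Add (Var 20) (Num 1)) v' h')) h')"
      show "wp ?L (\<lambda>v'' h''. ?I v'' h'' \<and> ?p - v'' 20 < ?p - v' 20) ?u h'"
      proof (rule wp_For[where I = ?J and L = x])
        show "?J 0 (?u(22 := 0)) h'" using I by (simp add: x_def)
        show "okE w (Var 20) u h'' \<and> ev w (Var 20) u h'' = x" if "?J a u h''" for a u h''
          using that by simp
        show "?I u h'' \<and> ?p - u 20 < ?p - v' 20" if "?J x u h''" for u h''
          using that prime_iff_no_divisor[OF x(3)] px x lt by (simp add: x_def)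
        show "x \<le> b False" "x < 2 ^ w" using x bF by auto
        fix a u h'' assume a: "a < x" and J: "?J a u h''" and u22: "u 22 = a"
        obtain pa where pa: "(\<forall>a'<a. ?d a') = pa" by blast
        have ex: "(\<forall>a'<Suc a. ?d a') \<longleftrightarrow> pa \<and> ?d a"
          unfolding pa[symmetric] by (auto simp: less_Suc_eq)
        have J': "h'' = h" "\<And>y. y < 20 \<Longrightarrow> u y = v y" "u 20 = x" "u 24 = (if pa then 1 else 0)"
          using J pa by auto
        show "wp (Ite (Bin Lt (Num 1) (Var 22))
          (Ite (Bin Equal (Bin Mod (Var 20) (Var 22)) (Num 0)) (Asg 24 (Num 0)) (Asg 24 (Var 24)))
          (Asg 24 (Var 24))) (\<lambda>v' h'. v' 22 = a \<and> ?J (Suc a) (v'(22 := Suc a)) h') u h''"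
          by (intro wp_Ite wp_Asg)
             (use J' u22 in \<open>simp_all only: ex, simp_all split: if_split_asm\<close>)
      qed
    qed (use x in \<open>simp_all add: x_def\<close>)
  qed
qed simp

lemma wp_fillP:
  assumes pre: "v 6 = N" "v 8 = i" "i < r" "v 14 \<ge> 1" "v 16 \<ge> 1"
    and post: "\<And>v'. (\<forall>x<22. v' x = v x) \<Longrightarrow>
      Q v' (h(2 := \<lambda>z. if i * N \<le> z \<and> z < i * N + N \<and> ((z - i * N) div v 14) mod v 16 = v 18 then v 20 else h 2 z))"
  shows "wp fillP Q v h"
  unfolding fillP_def
proof -
  let ?c = "\<lambda>z. ((z - i * N) div v 14) mod v 16 = v 18"
  let ?f = "\<lambda>a. \<lambda>z. if i * N \<le> z \<and> z < i * N + a \<and> ?c z then v 20 else h 2 z"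
  let ?I = "\<lambda>a v' h'. h' = h(2 := ?f a) \<and> (\<forall>x<22. v' x = v x)"
  show "wp (For False 22 (Var 6)
     (Ite (Bin Equal (Bin Mod (Bin Div (Var 22) (Var 14)) (Var 16)) (Var 18))
       (Sto 2 (Bin Add (Bin Mul (Var 8) (Var 6)) (Var 22)) (Var 20)) (Asg 10 (Var 10)))) Q v h"
  proof (rule wp_For[where I = ?I and L = N])
    show "?I 0 (v(22 := 0)) h" by (auto simp: fun_eq_iff)
    show "okE w (Var 6) v' h' \<and> ev w (Var 6) v' h' = N" if "?I a v' h'" for a v' h'
      using that pre by simp
    show "Q v' h'" if "?I N v' h'" for v' h' using that post by blast
    show "N \<le> b False" "N < 2 ^ w" using N_le_B bF B_less by auto
    fix a v' h' assume a: "a < N" and I: "?I a v' h'" and v22: "v' 22 = a"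
    have ad: "i * N + a < 2 ^ w" using rN_le[OF pre(3) a] B_less by blast
    have c: "?c (i * N + a) \<longleftrightarrow> (a div v 14) mod v 16 = v 18" by simp
    have f1: "h(2 := (?f a)(i * N + a := v 20)) = h(2 := ?f (Suc a))"
      if "(a div v 14) mod v 16 = v 18"
    proof -
      have "(?f a)(i * N + a := v 20) = ?f (Suc a)" using that by (auto simp: fun_eq_iff less_Suc_eq)
      then show ?thesis by simp
    qed
    have f2: "h(2 := ?f a) = h(2 := ?f (Suc a))" if "(a div v 14) mod v 16 \<noteq> v 18"
    proof -
      have "?f a = ?f (Suc a)" using that by (auto simp: fun_eq_iff less_Suc_eq)
      then show ?thesis by simp
    qed
    have v': "v' 6 = N" "v' 8 = i" "v' 14 = v 14" "v' 16 = v 16" "v' 18 = v 18" "v' 20 = v 20" "h' = h(2 := ?f a)"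
        "\<And>x. x < 22 \<Longrightarrow> v' x = v x"
      using I pre by auto
    show "wp (Ite (Bin Equal (Bin Mod (Bin Div (Var 22) (Var 14)) (Var 16)) (Var 18))
       (Sto 2 (Bin Add (Bin Mul (Var 8) (Var 6)) (Var 22)) (Var 20)) (Asg 10 (Var 10)))
      (\<lambda>v' h'. v' 22 = a \<and> ?I (Suc a) (v'(22 := Suc a)) h') v' h'"
    proof (cases "(a div v 14) mod v 16 = v 18")
      case True
      show ?thesis
      proof (intro wp_Ite wp_Sto, goal_cases)
        case 4
        have "h'(2 := (h' 2)(ev w (Bin Add (Bin Mul (Var 8) (Var 6)) (Var 22)) v' h' := ev w (Var 20) v' h'))
            = h(2 := ?f (Suc a))"
          unfolding f1[OF True, symmetric] using v' v22 by simp
        then show ?case using v' v22 by simp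
      qed (use v' v22 ad le_sum_less[OF ad] True in simp_all)
    next
      case False
      show ?thesis
      proof (intro wp_Ite wp_Asg, goal_cases)
        case 4
        show ?case using v' v22 f2[OF False] by simp
      qed (use v' v22 False in simp_all)
    qed
  qed
qed

lemma wp_levelP:
  assumes pre: "v 4 = l" "v 6 = N" "v 8 = i" "i < r" "v 14 = P i" "v 10 = U i"
    and post: "\<And>v' f. (\<forall>x<8. v' x = v x) \<Longrightarrow> v' 8 = Suc i \<Longrightarrow> v' 14 = P (Suc i) \<Longrightarrow> v' 10 = U (Suc i) \<Longrightarrow>
      (\<forall>z<i * N. f z = h 2 z) \<Longrightarrow> (\<forall>g<N. f (i * N + g) = q i g) \<Longrightarrow>
      Q v' (h(4 := (h 4)(i := U i), 2 := f))"
  shows "wp (levelP k) Q v h"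
  unfolding levelP_def
proof (rule wp_Sq, rule wp_Sto, simp, simp, rule wp_Sq)
  let ?h = "h(4 := (h 4)(i := U i))"
  have UB: "U (Suc i) \<le> B"
    using U_mono[of "Suc i" r] pre(4) U_le_M[of r] N_le_B(3) by linarith
  have MB: "M i \<le> B" using M_less_U[of i] UB by linarith
  have Pi: "P i < N" using less_r pre(4) by blast
  have mB: "m i \<le> B" using MB by (simp add: m_def)
  have mP: "P (Suc i) \<le> B"
  proof -
    have "P (Suc i) \<le> 2 * N"
    proof -
      have "P (Suc i) \<le> P i * (N div P i + 1)" unfolding lev_simps m_def by (intro mult_left_mono) auto
      also have "\<dots> \<le> N + P i" by (simp add: algebra_simps)
      finally show ?thesis using Pi by simp
    qed
    then show ?thesis using B by linarith
  qed
  let ?pr = "\<lambda>j. \<Prod>j'<j. (nextp ^^ Suc j') (M i)"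
  let ?loop = "For False 18 (Var 16) (nextP ;; Asg 10 (Bin Mul (Var 10) (Var 20)) ;; fillP)"
  let ?rest = "Asg 14 (Bin Mul (Var 14) (Var 16)) ;; Asg 8 (Bin Add (Var 8) (Num 1))"
  have e: "h(4 := (h 4)(ev w (Var 8) v h := ev w (Var 10) v h)) = ?h" using pre by simp
  show "wp (mulP k) (wp (Asg 16 (Bin Add (Bin Div (Var 6) (Var 14)) (Num 1)) ;;
     Ite (Bin Lt (Var 12) (Var 16)) (Asg 16 (Var 12)) (Asg 16 (Var 16)) ;;
     Asg 10 (Num 1) ;; Asg 20 (Var 12) ;; ?loop ;; ?rest) Q) v
     (h(4 := (h 4)(ev w (Var 8) v h := ev w (Var 10) v h)))"
    unfolding e
  proof (rule wp_mulP[where i = i], goal_cases)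
    case (4 u)
    have u: "\<And>x. x < 10 \<Longrightarrow> u x = v x" "u 14 = P i" "u 12 = M i" "u 6 = N" "u 8 = i" using 4 pre by auto
    have "Suc (N div P i) \<le> B" using div_le_dividend[of N "P i"] B by linarith
    then have nd: "Suc (N div P i) < 2 ^ w" using B_less by blast
    have loop: "wp (?loop ;; ?rest) Q z ?h"
      if z: "\<And>x. x < 10 \<Longrightarrow> z x = v x" "z 14 = P i" "z 16 = m i" "z 10 = 1" "z 20 = M i" for z
    proof (rule wp_Sq)
      \<comment> \<open>After \<open>j\<close> primes the table of level \<open>i\<close> is correct
        at rows whose block position is below \<open>j\<close>; for \<open>j = m i\<close> these are
        all rows.\<close>
      let ?I = "\<lambda>j z' h'. \<exists>f. h' = h(4 := (h 4)(i := U i), 2 := f) \<and> (\<forall>z<i * N. f z = h 2 z) \<and>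
          (\<forall>g<N. (g div P i) mod m i < j \<longrightarrow> f (i * N + g) = q i g) \<and>
          (\<forall>x<10. z' x = v x) \<and> z' 14 = P i \<and> z' 16 = m i \<and> z' 10 = ?pr j \<and> z' 20 = (nextp ^^ j) (M i)"
      show "wp ?loop (wp ?rest Q) z ?h"
      proof (rule wp_For[where I = ?I and L = "m i"])
        have "?h = h(4 := (h 4)(i := U i), 2 := h 2)" by (auto simp: fun_eq_iff)
        then show "?I 0 (z(18 := 0)) ?h" using z by (intro exI[of _ "h 2"]) simp
        show "okE w (Var 16) v' h' \<and> ev w (Var 16) v' h' = m i" if "?I j v' h'" for j v' h'
          using that by auto
        show "m i \<le> b False" "m i < 2 ^ w" using mB bF B_less by auto
        show "wp ?rest Q v' h'" if I: "?I (m i) v' h'" for v' h'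
        proof -
          obtain f where f: "h' = h(4 := (h 4)(i := U i), 2 := f)" "\<forall>z<i * N. f z = h 2 z"
            "\<forall>g<N. f (i * N + g) = q i g" "\<And>x. x < 10 \<Longrightarrow> v' x = v x" "v' 14 = P i" "v' 16 = m i"
            "v' 10 = U (Suc i)" "v' 8 = i"
            using I m_pos[of i] pre(3) by (auto simp: Suc_le_eq)
          have "i + 1 \<le> B" using pre(4) N_le_B(4) by linarith
          then have i1: "Suc i < 2 ^ w" "P i * m i < 2 ^ w" using B_less mP by auto
          show ?thesis
            by (intro wp_Sq wp_Asg) (use i1 f post[of "v'(14 := P (Suc i), 8 := Suc i)" f] in simp_all)
        qed
        fix j v' h' assume j: "j < m i" and "?I j v' h'" and v18: "v' 18 = j"
        then obtain f where f: "h' = h(4 := (h 4)(i := U i), 2 := f)" "\<forall>z<i * N. f z = h 2 z"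
            "\<forall>g<N. (g div P i) mod m i < j \<longrightarrow> f (i * N + g) = q i g" "\<And>x. x < 10 \<Longrightarrow> v' x = v x" "v' 14 = P i" "v' 16 = m i"
            "v' 10 = ?pr j" "v' 20 = (nextp ^^ j) (M i)" by blast
        let ?x = "(nextp ^^ Suc j) (M i)"
        have xB: "?x \<le> B" using iterate_nextp_le_U[OF j] UB by linarith
        \<comment> \<open>A partial product divides the full one, so the accumulation in register 10
          cannot overflow.\<close>
        have "?pr (Suc j) \<le> U (Suc i)" unfolding lev_simps
        proof (intro dvd_imp_le prod_dvd_prod_subset prod_pos ballI)
          show "0 < (nextp ^^ Suc j') (M i)" for j' using less_iterate_nextp[of "Suc j'" "M i"] by linarith
        qed (use j in auto)
        then have pB: "?pr j * ?x < 2 ^ w" using UB B_less[of "?pr (Suc j)"] by simp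
        have M1: "M i \<ge> 1" using U_le_M[of i] U_pos[of i] by linarith
        have v20: "v' 20 \<ge> 1" "nextp (v' 20) = ?x"
          using f(8) M1 less_iterate_nextp[of j "M i"] by (cases "j = 0"; simp)+
        show "wp (nextP ;; Asg 10 (Bin Mul (Var 10) (Var 20)) ;; fillP)
          (\<lambda>v' h'. v' 18 = j \<and> ?I (Suc j) (v'(18 := Suc j)) h') v' h'"
        proof (rule wp_Sq, rule wp_nextP, goal_cases)
          case (3 y)
          have y: "\<And>x. x < 10 \<Longrightarrow> y x = v x" "y 14 = P i" "y 16 = m i" "y 10 = ?pr j" "y 20 = ?x" "y 18 = j"
            using 3 f(4-7) v18 v20 by auto
          show ?case
          proof (rule wp_Sq, rule wp_Asg)
            show "okE w (Bin Mul (Var 10) (Var 20)) y h'" using y pB by simp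
            show "wp fillP (\<lambda>v' h'. v' 18 = j \<and> ?I (Suc j) (v'(18 := Suc j)) h')
                (y(10 := ev w (Bin Mul (Var 10) (Var 20)) y h')) h'"
            proof (rule wp_fillP[where i = i], goal_cases)
              case (6 t)
              have t: "\<And>x. x < 10 \<Longrightarrow> t x = v x" "t 14 = P i" "t 16 = m i" "t 10 = ?pr (Suc j)" "t 20 = ?x" "t 18 = j"
                using 6 y by auto
              define f' where "f' = (\<lambda>z. if i * N \<le> z \<and> z < i * N + N \<and> (z - i * N) div P i mod m i = j then ?x else f z)"
              have f'1: "\<forall>z<i * N. f' z = h 2 z" using f(2) by (simp add: f'_def)
              have f'2: "f' (i * N + g) = q i g" if "g < N" "(g div P i) mod m i < Suc j" for g
                using that f(3) by (auto simp: f'_def q_def less_Suc_eq)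
              let ?y = "y(10 := ev w (Bin Mul (Var 10) (Var 20)) y h')"
              have eq: "h'(2 := \<lambda>z. if i * N \<le> z \<and> z < i * N + N \<and> (z - i * N) div ?y 14 mod ?y 16 = ?y 18
                  then ?y 20 else h' 2 z) = h(4 := (h 4)(i := U i), 2 := f')"
              proof -
                have 1: "?y 14 = P i" "?y 16 = m i" "?y 18 = j" "?y 20 = ?x" "h' 2 = f"
                  using y f(1) by (simp_all del: funpow.simps)
                show ?thesis unfolding 1 f'_def[symmetric] by (simp add: f(1))
              qed
              show ?case
                unfolding eq by (intro conjI exI[of _ f']) (use f'1 f'2 t in auto)
            qed (use y pre m_pos[of i] P_pos[of i] in simp_all)
          qed
        qed (use v20 xB in simp_all)
      qed
    qed
    show ?case
      by (intro wp_Sq[where p = "Asg a b" for a b] wp_Sq[where p = "Ite a b c" for a b c] wp_Asg wp_Ite loop)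
         (use u nd in \<open>simp_all add: m_def split: if_split_asm\<close>)
  qed (use pre in simp_all)
qed

lemma wp_setupP:
  assumes pre: "v 4 = l" "v 6 = N"
    and post: "\<And>v' h'. (\<forall>x<8. v' x = v x) \<Longrightarrow> v' 8 = r \<Longrightarrow> v' 12 = M r \<Longrightarrow> tabs h' \<Longrightarrow>
      (\<forall>c. c \<noteq> 2 \<and> c \<noteq> 4 \<longrightarrow> h' c = h c) \<Longrightarrow> Q v' h'"
  shows "wp (setupP k) Q v h"
  unfolding setupP_def
proof (rule wp_Sq, rule wp_Asg, goal_cases)
  case 2
  let ?I = "\<lambda>v' h'. (\<forall>x<8. v' x = v x) \<and> v' 8 \<le> r \<and> v' 14 = P (v' 8) \<and> v' 10 = U (v' 8) \<and>
      (\<forall>c. c \<noteq> 2 \<and> c \<noteq> 4 \<longrightarrow> h' c = h c) \<and>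
      (\<forall>i<v' 8. (\<forall>g<N. h' 2 (i * N + g) = q i g) \<and> h' 4 i = U i)"
  let ?L = "Wh False (Bin Lt (Var 14) (Var 6)) (levelP k)"
  have loop: "wp ?L (wp (mulP k) Q) u h" if u: "?I u h" "u 8 = 0" for u
  proof (rule wp_Wh[where I = ?I and \<mu> = "\<lambda>v h. r - v 8"])
    show "?I u h" by (rule u)
    show "okE w (Bin Lt (Var 14) (Var 6)) v' h'" for v' h' by simp
    show "r - u 8 \<le> b False" using N_le_B bF by simp
    fix v' h' assume I: "?I v' h'"
    show "wp (mulP k) Q v' h'" if "ev w (Bin Lt (Var 14) (Var 6)) v' h' = 0"
    proof -
      have "\<not> P (v' 8) < N" using that I pre by (auto split: if_split_asm)
      then have v8: "v' 8 = r" using I less_r[of "v' 8"] by (meson le_neq_implies_less)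
      show ?thesis
      proof (rule wp_mulP[where i = r], goal_cases)
        case (4 z)
        have "tabs h'" using I v8 by (simp add: tabs_def)
        then show ?case using 4 I v8 by (intro post) auto
      qed (use I v8 pre in auto)
    qed
    assume "ev w (Bin Lt (Var 14) (Var 6)) v' h' \<noteq> 0"
    then have "P (v' 8) < N" using I pre by (auto split: if_split_asm)
    then have lt: "v' 8 < r" using I N_le_P_r by (metis le_neq_implies_less not_le)
    show "wp (levelP k) (\<lambda>v'' h''. ?I v'' h'' \<and> r - v'' 8 < r - v' 8) v' h'"
    proof (rule wp_levelP[where i = "v' 8"], goal_cases)
      case (7 y f)
      have old: "f (i * N + g) = h' 2 (i * N + g)" if "i < v' 8" "g < N" for i g
        using 7(5) pair_le[OF that] by blast
      have "(\<forall>g<N. f (i * N + g) = q i g) \<and> ((h' 4)(v' 8 := U (v' 8))) i = U i" if "i < Suc (v' 8)" for i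
        using that 7(6) old[of i] I by (cases "i = v' 8") auto
      then show ?case using 7 I lt by (auto simp: diff_less_mono2)
    qed (use I pre lt in auto)
  qed
  have two: "(2::nat) < 2 ^ w" using B_less[of 2] B k2 by simp
  show ?case by (intro wp_Sq[where p = "Asg a c" for a c] wp_Sq[where p = "Wh a c e" for a c e] wp_Asg loop) (use pre two in auto)
next
  case 1
  show ?case by simp
qed

end

section \<open>Computing the parameters\<close>

text \<open>Induction peels off the first logarithm, with the argument generalized to all reals. The
  case \<open>x \<le> 1\<close> is split off beforehand, so the value of \<open>log\<close> at
  nonpositive arguments is irrelevant.\<close>

lemma log_star_le_iff:
  "log_star n \<le> j \<longleftrightarrow> n \<le> tow (Suc j)"
proof -
  have *: "(\<exists>i\<le>j. (log 2 ^^ i) x \<le> 1) \<longleftrightarrow> x \<le> real (tow (Suc j))" for x :: real and j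
  proof (induction j arbitrary: x)
    case (Suc j)
    have "(\<exists>i\<le>Suc j. (log 2 ^^ i) x \<le> 1) \<longleftrightarrow> x \<le> 1 \<or> (\<exists>i\<le>j. (log 2 ^^ Suc i) x \<le> 1)"
      by (metis Suc_le_mono funpow_0 not0_implies_Suc le0)
    also have "\<dots> \<longleftrightarrow> x \<le> 1 \<or> log 2 x \<le> real (tow (Suc j))"
      using Suc.IH[of "log 2 x"] by (simp add: funpow_swap1)
    also have "\<dots> \<longleftrightarrow> x \<le> real (tow (Suc (Suc j)))"
    proof (cases "x \<le> 1")
      case True
      have "(1::real) \<le> real (tow (Suc (Suc j)))" by simp
      then have "x \<le> real (tow (Suc (Suc j)))" using True by linarith
      then show ?thesis using True by blast
    next
      case False
      have "real (tow (Suc (Suc j))) = 2 powr real (tow (Suc j))"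
        unfolding tow.simps(2)[of "Suc j"] by (simp add: powr_realpow del: tow.simps)
      then show ?thesis using False by (simp add: log_le_iff del: tow.simps)
    qed
    finally show ?case .
  qed simp
  let ?P = "\<lambda>i. (log 2 ^^ i) (real n) \<le> 1"
  have "n \<le> tow (Suc n)" using strict_mono_imp_increasing[OF strict_mono_tow, of "Suc n"] by linarith
  then have "real n \<le> real (tow (Suc n))" by linarith
  then have ex: "\<exists>i. ?P i" using *[of n "real n"] by blast
  have "log_star n \<le> j \<longleftrightarrow> (\<exists>i\<le>j. ?P i)"
    unfolding log_star_def using LeastI_ex[OF ex] by (meson Least_le order.trans)
  then show ?thesis using *[of j "real n"] by simp
qed

definition clg :: "nat \<Rightarrow> nat" where "clg n = (LEAST e. n \<le> 2 ^ e)"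

lemma clg_le_iff: "clg n \<le> e \<longleftrightarrow> n \<le> 2 ^ e"
proof -
  have "n \<le> 2 ^ n" using less_exp[of n] by linarith
  then have "n \<le> 2 ^ clg n" unfolding clg_def by (rule LeastI)
  moreover have "n \<le> 2 ^ e \<Longrightarrow> clg n \<le> e" unfolding clg_def by (rule Least_le)
  ultimately show ?thesis by (meson order.trans one_le_numeral power_increasing)
qed

text \<open>Comparing a tower with \<open>clg n\<close> instead of \<open>n\<close> avoids overflow:
  the program computes \<open>2 ^ tow j\<close> only while \<open>tow j < clg n\<close>, and then it
  is below \<open>n\<close>.\<close>

lemma log_star_le_iff_clg: "log_star n \<le> j \<longleftrightarrow> clg n \<le> tow j"
  by (simp add: log_star_le_iff clg_le_iff)

text \<open>Doubling until \<open>n\<close> is reached yields \<open>clg n\<close> in register 14.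
  The second loop climbs the tower \<open>tow\<close> from 0, contributing one factor
  \<open>3 * k + 1\<close> to \<open>l\<close> per step.\<close>

definition initP :: "nat \<Rightarrow> stm" where
  "initP k = Asg 2 (Var 1) ;; Asg 14 (Num 0) ;; Asg 16 (Num 1) ;;
     Wh False (Bin Lt (Var 16) (Var 0))
       (Asg 16 (Bin Add (Var 16) (Var 16)) ;; Asg 14 (Bin Add (Var 14) (Num 1))) ;;
     Asg 16 (Num 0) ;; Asg 4 (Num 1) ;;
     Wh False (Bin Lt (Var 16) (Var 14))
       (Asg 16 (Bin Shl (Num 1) (Var 16)) ;; Asg 4 (Bin Mul (Var 4) (Num (3 * k + 1)))) ;;
     Asg 6 (Bin Add (Bin Div (Var 2) (Var 4)) (Num 1))"

definition progP :: "nat \<Rightarrow> stm" where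
  "progP k = initP k ;; setupP k ;; mainP k"

context ovram begin

lemma wp_initP:
  assumes pre: "v 0 = n" "v 1 = d" and l: "l = (3 * k + 1) ^ log_star n" and clg: "clg n \<le> B"
    and k: "3 * k + 1 \<le> B"
    and post: "\<And>v'. v' 0 = n \<Longrightarrow> v' 2 = d \<Longrightarrow> v' 4 = l \<Longrightarrow> v' 6 = N \<Longrightarrow> Q v' h"
  shows "wp (initP k) Q v h"
proof -
  have n2: "2 * n < 2 ^ w"
  proof -
    have "2 * n < 2 * ((1 * n + 1) * (0 + 1))" by simp
    also have "\<dots> \<le> 2 * ((k * n + 1) * (B + 1))" using k2 by (intro mult_left_mono mult_mono add_mono) auto
    finally show ?thesis using W by linarith
  qed
  have lsB: "log_star n \<le> B"
  proof -
    have "log_star n < 2 ^ log_star n" by (rule less_exp)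
    also have "\<dots> \<le> l" unfolding l using k2 by (intro power_mono) auto
    finally show ?thesis using N_le_B by linarith
  qed
  let ?I = "\<lambda>v' h'. h' = h \<and> v' 0 = n \<and> v' 2 = d \<and> v' 14 \<le> clg n \<and> v' 16 = 2 ^ v' 14"
  let ?J = "\<lambda>v' h'. h' = h \<and> v' 0 = n \<and> v' 2 = d \<and> v' 14 = clg n \<and>
      (\<exists>j\<le>log_star n. v' 16 = tow j \<and> v' 4 = (3 * k + 1) ^ j)"
  let ?b1 = "Asg 16 (Bin Add (Var 16) (Var 16)) ;; Asg 14 (Bin Add (Var 14) (Num 1))"
  let ?b2 = "Asg 16 (Bin Shl (Num 1) (Var 16)) ;; Asg 4 (Bin Mul (Var 4) (Num (3 * k + 1)))"
  let ?fin = "Asg 6 (Bin Add (Bin Div (Var 2) (Var 4)) (Num 1))"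
  have fin: "wp ?fin Q v' h" if "?J v' h" "v' 4 = l" for v'
  proof -
    have "d div l + 1 < 2 ^ w" using B_less[OF N_le_B(1)] by (simp add: N_def)
    then show ?thesis by (intro wp_Asg) (use that in \<open>auto intro!: post simp: N_def\<close>)
  qed
  have L2: "wp (Wh False (Bin Lt (Var 16) (Var 14)) ?b2) (wp ?fin Q) u h"
    if "?J u h" for u
  \<comment> \<open>The step number \<open>j\<close> is stored in no register; as \<open>tow\<close>
    is strictly increasing, the least index recovers it from \<open>tow j\<close>.\<close>
  proof (rule wp_Wh[where I = ?J and \<mu> = "\<lambda>v h. log_star n - (LEAST j. v 16 \<le> tow j)"])
    show "?J u h" by (rule that)
    show "okE w (Bin Lt (Var 16) (Var 14)) v' h'" for v' :: "nat \<Rightarrow> nat" and h' by simp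
    show "log_star n - (LEAST j. u 16 \<le> tow j) \<le> b False" using lsB bF by simp
    fix v' :: "nat \<Rightarrow> nat" and h' :: "nat \<Rightarrow> nat \<Rightarrow> nat" assume J: "?J v' h'"
    then obtain j where j: "j \<le> log_star n" "v' 16 = tow j" "v' 4 = (3 * k + 1) ^ j" by blast
    have least: "(LEAST j'. tow j \<le> tow j') = j" for j
      using strict_mono_less_eq[OF strict_mono_tow] by (intro Least_equality) auto
    show "wp ?fin Q v' h'" if "ev w (Bin Lt (Var 16) (Var 14)) v' h' = 0"
    proof -
      have "clg n \<le> tow j" using that J j by (auto split: if_split_asm)
      then have "j = log_star n" using log_star_le_iff_clg[of n j] j by simp
      then show ?thesis using fin J j l by simp
    qed
    assume "ev w (Bin Lt (Var 16) (Var 14)) v' h' \<noteq> 0"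
    then have lt: "tow j < clg n" using J j by (auto split: if_split_asm)
    then have js: "j < log_star n" using log_star_le_iff_clg[of n j] by linarith
    have "2 ^ tow j < n" using lt clg_le_iff[of n "tow j"] by linarith
    then have a: "2 ^ tow j < (2::nat) ^ w" using n2 by linarith
    have "(3 * k + 1) ^ Suc j \<le> l" unfolding l using js by (intro power_increasing) auto
    then have "(3 * k + 1) ^ j * (3 * k + 1) \<le> l" by (simp only: power_Suc mult.commute)
    then have c: "(3 * k + 1) ^ j * (3 * k + 1) < 2 ^ w" using N_le_B(2) by (intro B_less) linarith
    have d: "log_star n - Suc j < log_star n - j" using js by simp
    show "wp ?b2 (\<lambda>v'' h''. ?J v'' h'' \<and> log_star n - (LEAST j. v'' 16 \<le> tow j) < log_star n - (LEAST j. v' 16 \<le> tow j)) v' h'"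
    proof (intro wp_Sq wp_Asg, goal_cases)
      case 3
      have e: "2 ^ tow j = tow (Suc j)" by simp
      show ?case using J j js d by (auto simp: least e simp del: tow.simps intro!: exI[of _ "Suc j"])
    qed (use J j a c B_less[OF k] in simp_all)
  qed
  have L1: "wp (Wh False (Bin Lt (Var 16) (Var 0)) ?b1)
      (wp (Asg 16 (Num 0) ;; Asg 4 (Num 1) ;; Wh False (Bin Lt (Var 16) (Var 14)) ?b2 ;; ?fin) Q) u h"
    if "?I u h" for u
  proof (rule wp_Wh[where I = ?I and \<mu> = "\<lambda>v h. clg n - v 14"])
    show "?I u h" by (rule that)
    show "okE w (Bin Lt (Var 16) (Var 0)) v' h'" for v' h' by simp
    show "clg n - u 14 \<le> b False" using clg bF by simp
    fix v' :: "nat \<Rightarrow> nat" and h' :: "nat \<Rightarrow> nat \<Rightarrow> nat" assume I: "?I v' h'"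
    show "wp (Asg 16 (Num 0) ;; Asg 4 (Num 1) ;; Wh False (Bin Lt (Var 16) (Var 14)) ?b2 ;; ?fin) Q v' h'"
      if "ev w (Bin Lt (Var 16) (Var 0)) v' h' = 0"
    proof -
      have "n \<le> 2 ^ v' 14" using that I by (auto split: if_split_asm)
      then have "v' 14 = clg n" using I clg_le_iff[of n "v' 14"] by simp
      moreover have h': "h' = h" using I by blast
      ultimately show ?thesis
        unfolding h' using I
        by (intro wp_Sq[where p = "Asg a c" for a c] wp_Sq[where p = "Wh a c e" for a c e] wp_Asg L2
              conjI exI[of _ 0]) simp_all
    qed
    assume "ev w (Bin Lt (Var 16) (Var 0)) v' h' \<noteq> 0"
    then have lt: "2 ^ v' 14 < n" using I by (auto split: if_split_asm)
    then have s: "v' 14 < clg n" using clg_le_iff[of n "v' 14"] by linarith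
    have c: "Suc (v' 14) < 2 ^ w" using s clg B_less by (meson Suc_leI order.trans)
    show "wp ?b1 (\<lambda>v'' h''. ?I v'' h'' \<and> clg n - v'' 14 < clg n - v' 14) v' h'"
      by (intro wp_Sq wp_Asg) (use I s c lt n2 in simp_all)
  qed
  show ?thesis
    unfolding initP_def
    by (intro wp_Sq[where p = "Asg a c" for a c] wp_Sq[where p = "Wh a c e" for a c e] wp_Asg L1) (use pre in auto)
qed

lemma wp_progP:
  assumes solver: "\<And>x s. x < M r \<Longrightarrow> input_state w k n (l + 1) (query (h 0) x) s \<Longrightarrow>
      \<exists>\<tau> s'. exec w A s \<tau> s' \<and> \<tau> \<le> T \<and> reg s' 0 = (if kOV_yes k n (l + 1) (query (h 0) x) then 1 else 0)"
    and pre: "v 0 = n" "v 1 = d"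
      "\<And>y s g. y < k * n \<Longrightarrow> s < l \<Longrightarrow> g < N \<Longrightarrow> bits (h 0) y s g < 2"
    and l: "l = (3 * k + 1) ^ log_star n" and clg: "clg n \<le> B" and k: "3 * k + 1 \<le> B"
    and post: "\<And>v' h'. v' 0 = (if \<exists>x<M r. (\<forall>g<N. cv r x g 0 = 0) \<and>
      kOV_yes k n (l + 1) (query (h 0) x) then 1 else 0) \<Longrightarrow> Q v' h'"
  shows "wp (progP k) Q v h"
  unfolding progP_def
proof (rule wp_Sq, rule wp_initP[OF pre(1,2) l clg k], rule wp_Sq, rule wp_setupP)
  fix v' v'' :: "nat \<Rightarrow> nat" and h' :: "nat \<Rightarrow> nat \<Rightarrow> nat"
  assume a: "v' 0 = n" "v' 2 = d" "v' 4 = l" "v' 6 = N" "\<forall>x<8. v'' x = v' x" "v'' 8 = r" "v'' 12 = M r"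
    "tabs h'" "\<forall>c. c \<noteq> 2 \<and> c \<noteq> 4 \<longrightarrow> h' c = h c"
  then have e: "h' 0 = h 0" by simp
  show "wp (mainP k) Q v'' h'"
    by (rule wp_mainP) (use a solver pre(3) post in \<open>simp_all add: e\<close>)
qed auto

end

section \<open>Correctness and running time\<close>

context ovram begin

lemma kinner_query:
  "kinner k (l + 1) (\<lambda>t. query mm x t (i t)) =
     int (\<Sum>s<l. \<Prod>t<k. enc (bits mm (t * n + i t) s)) - int x"
proof -
  have "(\<Prod>t<k. if t = 0 then - int x else 1) = - int x"
    using k2 by (simp add: prod.delta)
  then show ?thesis by (simp add: kinner_def query_def)
qed

lemma kinner_zero_iff:
  assumes "\<And>t j. t < k \<Longrightarrow> j < d \<Longrightarrow> y t j \<ge> 0"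
  shows "kinner k d y = 0 \<longleftrightarrow> (\<forall>j<d. \<exists>t<k. y t j = 0)"
proof -
  have "kinner k d y = 0 \<longleftrightarrow> (\<forall>j\<in>{..<d}. (\<Prod>t<k. y t j) = 0)"
    unfolding kinner_def using assms by (intro sum_nonneg_eq_0_iff prod_nonneg) auto
  then show ?thesis by (simp, metis lessThan_iff)
qed

lemma bits_orthogonal_iff:
  "(\<forall>g<N. \<forall>s<l. \<exists>t<k. bits mm (t * n + i t) s g = 0) \<longleftrightarrow>
    (\<forall>j<d. \<exists>t<k. mm ((t * n + i t) * d + j) = 0)"
proof (intro iffI allI impI)
  fix j assume a: "\<forall>g<N. \<forall>s<l. \<exists>t<k. bits mm (t * n + i t) s g = 0" and j: "j < d"
  \<comment> \<open>Column and row of coordinate \<open>j\<close>; the column exists because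
    \<open>d \<le> l * N\<close>.\<close>
  have "j div N < l" "j mod N < N" using j d_le N1 less_mult_imp_div_less[of j l N] by auto
  then obtain t where "t < k" "bits mm (t * n + i t) (j div N) (j mod N) = 0" using a by blast
  then show "\<exists>t<k. mm ((t * n + i t) * d + j) = 0" using j by (auto simp: bits_def)
next
  fix g s assume a: "\<forall>j<d. \<exists>t<k. mm ((t * n + i t) * d + j) = 0" and "g < N" "s < l"
  show "\<exists>t<k. bits mm (t * n + i t) s g = 0"
  proof (cases "s * N + g < d")
    case True
    then show ?thesis using a by (auto simp: bits_def)
  next
    case False
    then show ?thesis using k2 by (intro exI[of _ 0]) (simp add: bits_def)
  qed
qed

text \<open>A query at \<open>x\<close> succeeds iff some choice of vectors has codes with inner
  product exactly \<open>x\<close>. All such values are below \<open>M r\<close>, and those that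
  decode to zeros are exactly the ones from orthogonal choices.\<close>

lemma reduction_correct:
  assumes X: "\<And>t i j. t < k \<Longrightarrow> i < n \<Longrightarrow> j < d \<Longrightarrow> X t i j = int (mm ((t * n + i) * d + j))"
    and bits: "\<And>y s g. y < k * n \<Longrightarrow> s < l \<Longrightarrow> g < N \<Longrightarrow> bits mm y s g < 2"
  shows "(\<exists>x<M r. (\<forall>g<N. cv r x g 0 = 0) \<and> kOV_yes k n (l + 1) (query mm x)) \<longleftrightarrow> kOV_yes k n d X"
proof -
  define val where "val i = (\<Sum>s<l. \<Prod>t<k. enc (bits mm (t * n + i t) s))" for i
  have q: "kOV_yes k n (l + 1) (query mm x) \<longleftrightarrow> (\<exists>i. (\<forall>t<k. i t < n) \<and> val i = x)" for x
    unfolding kOV_yes_def kinner_query val_def[symmetric] by simp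
  have v: "val i < M r \<and> ((\<forall>g<N. cv r (val i) g 0 = 0) \<longleftrightarrow> kinner k d (\<lambda>t. X t (i t)) = 0)"
    if i: "\<forall>t<k. i t < n" for i
  proof -
    have b: "bits mm (t * n + i t) s g < 2" if "t < k" "s < l" "g < N" for t s g
      using that i by (intro bits pair_le) auto
    have "kinner k d (\<lambda>t. X t (i t)) = 0 \<longleftrightarrow> (\<forall>j<d. \<exists>t<k. X t (i t) j = 0)"
      using i X by (intro kinner_zero_iff) auto
    also have "\<dots> \<longleftrightarrow> (\<forall>j<d. \<exists>t<k. mm ((t * n + i t) * d + j) = 0)"
      using i X by (metis of_nat_eq_0_iff)
    finally show ?thesis
      using orthogonal_iff_cv[of "\<lambda>t. bits mm (t * n + i t)", OF b] bits_orthogonal_iff[of mm i]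
      unfolding val_def by blast
  qed
  show ?thesis unfolding q unfolding kOV_yes_def using v by blast
qed

theorem run_progP:
  assumes solver: "\<And>X s. (\<forall>t<k. \<forall>i<n. \<forall>j<l + 1. X t i j \<in> {- (2 ^ (w - 1)) ..< 2 ^ (w - 1)}) \<Longrightarrow>
      input_state w k n (l + 1) X s \<Longrightarrow>
      \<exists>\<tau> s'. exec w A s \<tau> s' \<and> \<tau> \<le> T \<and> reg s' 0 = (if kOV_yes k n (l + 1) X then 1 else 0)"
    and l: "l = (3 * k + 1) ^ log_star n" and clg: "clg n \<le> B" and k: "3 * k + 1 \<le> B"
    and X: "\<forall>t<k. \<forall>i<n. \<forall>j<d. X t i j \<in> {0, 1}" and s: "input_state w k n d X s"
  shows "\<exists>\<tau> s'. exec w (link A (compS (progP k))) s \<tau> s' \<and> \<tau> \<le> tb b T (progP k) \<and>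
      reg s' 0 = (if kOV_yes k n d X then 1 else 0)"
proof -
  let ?v = "reg s" and ?h = "mem s"
  have one: "(1::int) < 2 ^ w" using w1 by (intro one_less_power) auto
  have Xm: "X t i j = int (?h 0 ((t * n + i) * d + j))" if "t < k" "i < n" "j < d" for t i j
  proof -
    have "X t i j = 0 \<or> X t i j = 1" using X that by blast
    then have "X t i j mod 2 ^ w = X t i j" using w1 one by (elim disjE) simp_all
    then show ?thesis using s that unfolding input_state_def by metis
  qed
  have bits: "bits (?h 0) y s g < 2" if "y < k * n" "s < l" "g < N" for y s g
  proof (cases "s * N + g < d")
    case True
    have yt: "y div n < k" "y mod n < n" "y div n * n + y mod n = y"
      using that n1 by (auto simp: less_mult_imp_div_less)
    have "int (?h 0 ((y div n * n + y mod n) * d + (s * N + g))) \<in> {0, 1}"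
      using X Xm[OF yt(1,2) True] yt True by metis
    then show ?thesis using True yt(3) by (auto simp: bits_def)
  qed (simp add: bits_def)
  have encB: "int (enc (bits (?h 0) y j)) < 2 ^ (w - 1)" "int x < 2 ^ (w - 1)"
    if "y < k * n" "j < l" "x < M r" for y j x
  proof -
    \<comment> \<open>Here the factor 2 of \<open>W\<close> is spent: codes and \<open>x\<close>
      stay in the positive half of the signed range.\<close>
    have "2 * (1 * (B + 1)) \<le> 2 * ((k * n + 1) * (B + 1))"
      by (intro mult_left_mono mult_right_mono) auto
    also have "\<dots> \<le> 2 ^ w" by (rule W)
    also have "(2::nat) ^ w = 2 * 2 ^ (w - 1)" using w1 by (cases w) auto
    finally have B1: "B < 2 ^ (w - 1)" by simp
    have "enc (bits (?h 0) y j) \<le> B" using enc_bits_less bits that by blast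
    then have "enc (bits (?h 0) y j) < 2 ^ (w - 1)" "x < 2 ^ (w - 1)" using B1 that(3) N_le_B(3) by linarith+
    then have "int (enc (bits (?h 0) y j)) < int (2 ^ (w - 1))" "int x < int (2 ^ (w - 1))"
      by (simp_all only: of_nat_less_iff)
    then show "int (enc (bits (?h 0) y j)) < 2 ^ (w - 1)" "int x < 2 ^ (w - 1)" by simp_all
  qed
  have range: "query (?h 0) x t i j \<in> {- (2 ^ (w - 1)) ..< 2 ^ (w - 1)}"
    if "x < M r" "t < k" "i < n" "j < l + 1" for x t i j
  proof (cases "j < l")
    case True
    have "t * n + i < k * n" by (rule pair_le[OF that(2,3)])
    then have "int (enc (bits (?h 0) (t * n + i) j)) < 2 ^ (w - 1)" using encB(1) True that(1) by blast
    moreover have "- (2 ^ (w - 1)) \<le> int (enc (bits (?h 0) (t * n + i) j))"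
      by (rule order.trans[of _ 0]) simp_all
    ultimately show ?thesis using True by (simp add: query_def del: One_nat_def)
  next
    case False
    have "int x < 2 ^ (w - 1)" using encB(2)[of 0 0 x] that n1 k2 l1 by simp
    moreover have "B \<ge> 1" "w \<ge> 2"
    proof -
      show "B \<ge> 1" using B by linarith
      have "2 * (1 * (1 + 1)) \<le> 2 * ((k * n + 1) * (B + 1))" using B
        by (intro mult_left_mono mult_mono) auto
      then have "(2::nat) ^ 2 \<le> 2 ^ w" using W by (simp add: power2_eq_square)
      then show "w \<ge> 2" by (simp only: power_increasing_iff one_less_numeral_iff semiring_norm)
    qed
    moreover have "(1::int) < 2 ^ (w - 1)" using \<open>w \<ge> 2\<close> by (intro one_less_power) auto
    moreover have "query (?h 0) x t i j \<in> {- Z ..< Z}" if "int x < Z" "1 < Z" for Z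
      using that False by (auto simp: query_def)
    ultimately show ?thesis by blast
  qed
  have "wp (progP k) (\<lambda>v' h'. v' 0 = (if kOV_yes k n d X then 1 else 0)) ?v ?h"
  proof (rule wp_progP[OF _ _ _ _ l clg k], goal_cases)
    case (1 x s)
    then show ?case using range by (intro solver) auto
  next
    case 2
    show ?case using s by (simp add: input_state_def)
  next
    case 3
    show ?case using s by (simp add: input_state_def)
  next
    case (4 y s g)
    then show ?case by (rule bits)
  next
    case (5 v' h')
    then show ?case using reduction_correct[of X "?h 0", OF Xm bits] by simp
  qed
  moreover have "cleanS (progP k)"
    by (simp add: progP_def initP_def setupP_def levelP_def mulP_def nextP_def fillP_def mainP_def
        buildP_def inVP_def encP_def validP_def chainP_def For_def tmp_def)
  moreover have "rep s ?v ?h" using s by (auto simp: rep_def words_def input_state_def)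
  ultimately obtain \<tau> s' v' h' where "exec w (link A (compS (progP k))) s \<tau> s'" "\<tau> \<le> tb b T (progP k)"
      "rep s' v' h'" "v' 0 = (if kOV_yes k n d X then 1 else 0)"
    unfolding wp_def by blast
  moreover have "\<not> tmp 0" by (simp add: tmp_def)
  ultimately show ?thesis unfolding rep_def by metis
qed

end

section \<open>Running time as a polynomial in the small bound\<close>

text \<open>Programs without calls and without loops over all vectors; their time is polynomial in
  the small bound alone.\<close>

fun small :: "stm \<Rightarrow> bool" where
  "small (Sq p q) = (small p \<and> small q)"
| "small (Ite e p q) = (small p \<and> small q)"
| "small (Wh h e p) = (\<not> h \<and> small p)"
| "small Cl = False"
| "small p = True"

text \<open>Calls and \<open>True\<close> loops may sit inside small loops, but a
  \<open>True\<close> loop has a \<open>small\<close> body. Thus the large quantities are never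
  multiplied with each other.\<close>

fun lin :: "stm \<Rightarrow> bool" where
  "lin (Sq p q) = (lin p \<and> lin q)"
| "lin (Ite e p q) = (lin p \<and> lin q)"
| "lin (Wh h e p) = (if h then small p else lin p)"
| "lin p = True"

text \<open>A single number serves as coefficient and exponent, so that one existential witness
  suffices per program.\<close>

lemma poly_bound_add:
  assumes "(B::nat) \<ge> 1" shows "K * B ^ K + K' * B ^ K' + c \<le> (K + K' + c) * B ^ (K + K' + c)"
proof -
  define Z where "Z = B ^ (K + K' + c)"
  have "B ^ K \<le> Z" "B ^ K' \<le> Z" "1 \<le> Z"
    unfolding Z_def using assms by (auto intro!: power_increasing)
  then have "K * B ^ K \<le> K * Z" "K' * B ^ K' \<le> K' * Z" "c * 1 \<le> c * Z"
    by (auto simp only: mult_le_mono2)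
  then show ?thesis unfolding Z_def[symmetric] by (simp only: add_mult_distrib)
qed

lemma poly_bound_loop:
  assumes "(B::nat) \<ge> 1" shows "c + B * (K * B ^ K + c) \<le> (K + 2 * c + 1) * B ^ (K + 2 * c + 1)"
proof -
  define Z where "Z = B ^ (K + 1)"
  have Z: "B * B ^ K = Z" by (simp add: Z_def)
  have "B ^ 1 \<le> Z" "1 \<le> Z" unfolding Z_def using assms by (intro power_increasing one_le_power; simp)+
  then have "c * B \<le> c * Z" "c * 1 \<le> c * Z" by (auto simp only: mult_le_mono2 power_one_right)
  moreover have "B * (K * B ^ K + c) = K * Z + c * B" by (simp add: Z[symmetric] algebra_simps)
  moreover have "(K + 2 * c) * Z = K * Z + c * Z + c * Z" by (simp only: mult_2 add_mult_distrib)
  ultimately have "c + B * (K * B ^ K + c) \<le> (K + 2 * c) * Z" by linarith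
  also have "\<dots> \<le> (K + 2 * c + 1) * B ^ (K + 2 * c + 1)"
    unfolding Z_def using assms by (intro mult_mono power_increasing) auto
  finally show ?thesis .
qed

lemma tb_small:
  "small p \<Longrightarrow> \<exists>K. \<forall>b T B. b False \<le> B \<longrightarrow> 1 \<le> B \<longrightarrow> tb b T p \<le> K * B ^ K"
proof (induction p)
  case (Asg x e)
  have "1 * (costE e + 1) \<le> B ^ (costE e + 1) * (costE e + 1)" if "B \<ge> 1" for B :: nat
    using that by (intro mult_right_mono one_le_power) auto
  then show ?case by (intro exI[of _ "costE e + 1"]) (auto simp: mult.commute)
next
  case (Sto c a e)
  have "1 * (costE a + costE e + 1) \<le> B ^ (costE a + costE e + 1) * (costE a + costE e + 1)" if "B \<ge> 1" for B :: nat
    using that by (intro mult_right_mono one_le_power) auto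
  then show ?case by (intro exI[of _ "costE a + costE e + 1"]) (auto simp: mult.commute)
next
  case (Sq p q)
  then obtain K K' where "\<forall>b T B. b False \<le> B \<longrightarrow> 1 \<le> B \<longrightarrow> tb b T p \<le> K * B ^ K"
    "\<forall>b T B. b False \<le> B \<longrightarrow> 1 \<le> B \<longrightarrow> tb b T q \<le> K' * B ^ K'" by auto
  then have "tb b T (p ;; q) \<le> K * B ^ K + K' * B ^ K' + 0" if "b False \<le> B" "1 \<le> B" for b T B
    using that by (simp add: add_mono)
  then have "tb b T (p ;; q) \<le> (K + K' + 0) * B ^ (K + K' + 0)" if "b False \<le> B" "1 \<le> B" for b T B
    using that order.trans[OF _ poly_bound_add[OF that(2)]] by blast
  then show ?case by blast
next
  case (Ite e p q)
  then obtain K K' where K: "\<forall>b T B. b False \<le> B \<longrightarrow> 1 \<le> B \<longrightarrow> tb b T p \<le> K * B ^ K"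
    "\<forall>b T B. b False \<le> B \<longrightarrow> 1 \<le> B \<longrightarrow> tb b T q \<le> K' * B ^ K'" by auto
  let ?c = "costE e + 1"
  have "tb b T (Ite e p q) \<le> K * B ^ K + K' * B ^ K' + ?c" if "b False \<le> B" "1 \<le> B" for b T B
    using K that by (simp add: add_mono)
  then have "tb b T (Ite e p q) \<le> (K + K' + ?c) * B ^ (K + K' + ?c)" if "b False \<le> B" "1 \<le> B" for b T B
    using that order.trans[OF _ poly_bound_add[OF that(2)]] by blast
  then show ?case by blast
next
  case (Wh h e p)
  then obtain K where K: "\<forall>b T B. b False \<le> B \<longrightarrow> 1 \<le> B \<longrightarrow> tb b T p \<le> K * B ^ K" by auto
  let ?c = "costE e + 1"
  have "tb b T (Wh h e p) \<le> ?c + B * (K * B ^ K + ?c)" if "b False \<le> B" "1 \<le> B" for b T B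
  proof -
    have "b h * (tb b T p + ?c) \<le> B * (K * B ^ K + ?c)"
      using that K Wh.prems by (intro mult_mono add_mono) auto
    then show ?thesis by simp
  qed
  then have "tb b T (Wh h e p) \<le> (K + 2 * ?c + 1) * B ^ (K + 2 * ?c + 1)" if "b False \<le> B" "1 \<le> B" for b T B
    using that order.trans[OF _ poly_bound_loop[OF that(2)]] by blast
  then show ?case by blast
qed auto

text \<open>\<open>K\<close> is chosen before \<open>b\<close>, \<open>T\<close>, \<open>B\<close>
  and \<open>S\<close>: it depends on the program text only, so the overhead is a fixed power of
  \<open>B\<close> for all \<open>n\<close>.\<close>

lemma tb_lin:
  "lin p \<Longrightarrow> \<exists>K. \<forall>b T B S. b False \<le> B \<longrightarrow> 1 \<le> B \<longrightarrow> b True \<le> S \<longrightarrow> T \<le> S \<longrightarrow> 1 \<le> S \<longrightarrow>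
     tb b T p \<le> K * B ^ K * S"
proof (induction p)
  case (Asg x e)
  then obtain K where "\<forall>b T B. b False \<le> B \<longrightarrow> 1 \<le> B \<longrightarrow> tb b T (Asg x e) \<le> K * B ^ K"
    using tb_small[of "Asg x e"] by auto
  moreover have "a \<le> a * S" if "1 \<le> S" for a S :: nat using that by simp
  ultimately show ?case by (meson order.trans)
next
  case (Sto c a e)
  then obtain K where "\<forall>b T B. b False \<le> B \<longrightarrow> 1 \<le> B \<longrightarrow> tb b T (Sto c a e) \<le> K * B ^ K"
    using tb_small[of "Sto c a e"] by auto
  moreover have "a \<le> a * S" if "1 \<le> S" for a S :: nat using that by simp
  ultimately show ?case by (meson order.trans)
next
  case (Sq p q)
  then obtain K K' where K: "\<And>b T B S. b False \<le> B \<Longrightarrow> 1 \<le> B \<Longrightarrow> b True \<le> S \<Longrightarrow> T \<le> S \<Longrightarrow> 1 \<le> S \<Longrightarrow>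
      tb b T p \<le> K * B ^ K * S"
    "\<And>b T B S. b False \<le> B \<Longrightarrow> 1 \<le> B \<Longrightarrow> b True \<le> S \<Longrightarrow> T \<le> S \<Longrightarrow> 1 \<le> S \<Longrightarrow>
      tb b T q \<le> K' * B ^ K' * S" by (auto, metis)
  show ?case
  proof (intro exI[of _ "K + K' + 0"] allI impI)
    fix b T B S assume a: "b False \<le> B" "1 \<le> B" "b True \<le> S" "T \<le> S" "1 \<le> (S::nat)"
    have "tb b T (p ;; q) \<le> (K * B ^ K + K' * B ^ K' + 0) * S"
      using K(1)[OF a] K(2)[OF a] by (simp add: algebra_simps)
    also have "\<dots> \<le> (K + K' + 0) * B ^ (K + K' + 0) * S"
      using poly_bound_add[OF a(2), of K K' 0] by (rule mult_right_mono) simp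
    finally show "tb b T (p ;; q) \<le> (K + K' + 0) * B ^ (K + K' + 0) * S" .
  qed
next
  case (Ite e p q)
  then obtain K K' where K: "\<And>b T B S. b False \<le> B \<Longrightarrow> 1 \<le> B \<Longrightarrow> b True \<le> S \<Longrightarrow> T \<le> S \<Longrightarrow> 1 \<le> S \<Longrightarrow>
      tb b T p \<le> K * B ^ K * S"
    "\<And>b T B S. b False \<le> B \<Longrightarrow> 1 \<le> B \<Longrightarrow> b True \<le> S \<Longrightarrow> T \<le> S \<Longrightarrow> 1 \<le> S \<Longrightarrow>
      tb b T q \<le> K' * B ^ K' * S" by (auto, metis)
  let ?c = "costE e + 1"
  show ?case
  proof (intro exI[of _ "K + K' + ?c"] allI impI)
    fix b T B S assume a: "b False \<le> B" "1 \<le> B" "b True \<le> S" "T \<le> S" "1 \<le> (S::nat)"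
    have "?c * 1 \<le> ?c * S" using a by (intro mult_left_mono) auto
    then have "tb b T (Ite e p q) \<le> (K * B ^ K + K' * B ^ K' + ?c) * S"
      using K(1)[OF a] K(2)[OF a] by (simp add: algebra_simps)
    also have "\<dots> \<le> (K + K' + ?c) * B ^ (K + K' + ?c) * S"
      using poly_bound_add[OF a(2), of K K' ?c] by (rule mult_right_mono) simp
    finally show "tb b T (Ite e p q) \<le> (K + K' + ?c) * B ^ (K + K' + ?c) * S" .
  qed
next
  case (Wh h e p)
  let ?c = "costE e + 1"
  show ?case
  proof (cases h)
    case True
    then obtain K where K: "\<forall>b T B. b False \<le> B \<longrightarrow> 1 \<le> B \<longrightarrow> tb b T p \<le> K * B ^ K"
      using tb_small[of p] Wh.prems by auto
    show ?thesis
    proof (intro exI[of _ "K + 0 + 2 * ?c"] allI impI)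
      fix b T B S assume a: "b False \<le> B" "1 \<le> B" "b True \<le> S" "T \<le> S" "1 \<le> (S::nat)"
      have "b h * (tb b T p + ?c) \<le> S * (K * B ^ K + ?c)"
        using K a True by (intro mult_mono add_mono) auto
      moreover have "?c * 1 \<le> ?c * S" using a by (intro mult_left_mono) auto
      ultimately have "tb b T (Wh h e p) \<le> (K * B ^ K + 0 * B ^ 0 + 2 * ?c) * S"
        by (simp add: algebra_simps)
      also have "\<dots> \<le> (K + 0 + 2 * ?c) * B ^ (K + 0 + 2 * ?c) * S"
        using poly_bound_add[OF a(2), of K 0 "2 * ?c"] by (rule mult_right_mono) simp
      finally show "tb b T (Wh h e p) \<le> (K + 0 + 2 * ?c) * B ^ (K + 0 + 2 * ?c) * S" .
    qed
  next
    case False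
    then obtain K where K: "\<And>b T B S. b False \<le> B \<Longrightarrow> 1 \<le> B \<Longrightarrow> b True \<le> S \<Longrightarrow> T \<le> S \<Longrightarrow> 1 \<le> S \<Longrightarrow>
        tb b T p \<le> K * B ^ K * S" using Wh by (auto, metis)
    show ?thesis
    proof (intro exI[of _ "K + 2 * ?c + 1"] allI impI)
      fix b T B S assume a: "b False \<le> B" "1 \<le> B" "b True \<le> S" "T \<le> S" "1 \<le> (S::nat)"
      have c: "?c * 1 \<le> ?c * S" using a by (intro mult_left_mono) auto
      have "b h * (tb b T p + ?c) \<le> B * (K * B ^ K * S + ?c * S)"
        using K[OF a] c a False by (intro mult_mono add_mono) auto
      then have "tb b T (Wh h e p) \<le> (?c + B * (K * B ^ K + ?c)) * S"
        using c by (simp add: algebra_simps)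
      also have "\<dots> \<le> (K + 2 * ?c + 1) * B ^ (K + 2 * ?c + 1) * S"
        using poly_bound_loop[OF a(2), of ?c K] by (rule mult_right_mono) simp
      finally show "tb b T (Wh h e p) \<le> (K + 2 * ?c + 1) * B ^ (K + 2 * ?c + 1) * S" .
    qed
  qed
next
  case Cl
  have "T \<le> 1 * B ^ 1 * S" if "1 \<le> B" "T \<le> S" for T B S :: nat
    using that mult_le_mono[of 1 B T S] by simp
  then show ?case by (intro exI[of _ 1]) auto
qed

lemma lin_progP: "lin (progP k)"
  by (simp add: progP_def initP_def setupP_def levelP_def mulP_def nextP_def fillP_def mainP_def
        buildP_def inVP_def encP_def validP_def chainP_def For_def)

section \<open>Sublinear solvers do not exist\<close>

inductive_cases exec_SeqE: "exec w (Seq p q) s t s'"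
inductive_cases exec_CondE: "exec w (Cond r p q) s t s'"
inductive_cases exec_WhileE: "exec w (While r p) s t s'"

text \<open>Identifies the run forced by the adversary with the run promised for the modified
  instance.\<close>

lemma exec_determ:
  "exec w p s t s' \<Longrightarrow> exec w p s t2 s2 \<Longrightarrow> t2 = t \<and> s2 = s'"
proof (induction arbitrary: t2 s2 rule: exec.induct)
  case (Seq p s t s' q t' s'')
  then show ?case by (metis exec_SeqE)
next
  case (CondTrue s r p t s' q)
  obtain u where "exec w p s u s2" "t2 = u + 1"
    using CondTrue.prems CondTrue.hyps(1) by (elim exec_CondE) auto
  then show ?case using CondTrue.IH by blast
next
  case (CondFalse s r q t s' p)
  obtain u where "exec w q s u s2" "t2 = u + 1"
    using CondFalse.prems CondFalse.hyps(1) by (elim exec_CondE) auto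
  then show ?case using CondFalse.IH by blast
next
  case (WhileFalse s r p)
  from WhileFalse.prems show ?case
    by (rule exec_WhileE) (use WhileFalse.hyps in simp_all)
next
  case (WhileTrue s r p t s' t' s'')
  from WhileTrue.prems show ?case
  proof (rule exec_WhileE, goal_cases)
    case 1
    then show ?case using WhileTrue.hyps(1) by simp
  next
    case (2 u1 u u2)
    have "u1 = t \<and> u = s'" using WhileTrue.IH(1)[OF 2(3)] .
    then show ?case using WhileTrue.IH(2)[of u2 s2] 2 by simp
  qed
qed (auto elim: exec.cases)

text \<open>\<open>Z\<close> is a set of memory cells whose initial contents determine the run,
  given the registers. The last clause says that agreement of a cell persists, which is what
  sequential composition needs.\<close>

definition same_run :: "nat \<Rightarrow> com \<Rightarrow> state \<Rightarrow> nat \<Rightarrow> state \<Rightarrow> (nat \<times> nat) set \<Rightarrow> bool" where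
  "same_run w p s t s' Z \<longleftrightarrow> (\<forall>u :: state. reg u = reg s \<and> (\<forall>(b, a)\<in>Z. mem u b a = mem s b a) \<longrightarrow>
     (\<exists>u'. exec w p u t u' \<and> reg u' = reg s' \<and>
        (\<forall>b a. mem u b a = mem s b a \<longrightarrow> mem u' b a = mem s' b a)))"

lemma same_run_trans:
  assumes "same_run w p s t s' Z" "same_run w q s' t' s'' Z'"
    "\<And>(u :: state) u' u''. reg u = reg s \<Longrightarrow> exec w p u t u' \<Longrightarrow> exec w q u' t' u'' \<Longrightarrow> exec w c u t'' u''"
  shows "same_run w c s t'' s'' (Z \<union> Z')"
  unfolding same_run_def
proof (intro allI impI)
  fix u :: state assume u: "reg u = reg s \<and> (\<forall>(b, a)\<in>Z \<union> Z'. mem u b a = mem s b a)"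
  obtain u' where u': "exec w p u t u'" "reg u' = reg s'"
      "\<And>b a. mem u b a = mem s b a \<Longrightarrow> mem u' b a = mem s' b a"
    using assms(1) u unfolding same_run_def by blast
  have "\<forall>(b, a)\<in>Z'. mem u' b a = mem s' b a" using u u'(3) by blast
  then obtain u'' where u'': "exec w q u' t' u''" "reg u'' = reg s''"
      "\<And>b a. mem u' b a = mem s' b a \<Longrightarrow> mem u'' b a = mem s'' b a"
    using assms(2) u'(2) unfolding same_run_def by blast
  show "\<exists>u'. exec w c u t'' u' \<and> reg u' = reg s'' \<and>
      (\<forall>b a. mem u b a = mem s b a \<longrightarrow> mem u' b a = mem s'' b a)"
    using assms(3)[OF _ u'(1) u''(1)] u u'(3) u'' by blast
qed

lemma same_run_one:
  assumes "same_run w p s t s' Z"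
    "\<And>(u :: state) u'. reg u = reg s \<Longrightarrow> exec w p u t u' \<Longrightarrow> exec w c u t'' u'"
  shows "same_run w c s t'' s' Z"
  unfolding same_run_def
proof (intro allI impI)
  fix u :: state assume u: "reg u = reg s \<and> (\<forall>(b, a)\<in>Z. mem u b a = mem s b a)"
  obtain u' where u': "exec w p u t u'" "reg u' = reg s'"
      "\<forall>b a. mem u b a = mem s b a \<longrightarrow> mem u' b a = mem s' b a"
    using assms(1) u unfolding same_run_def by blast
  then show "\<exists>u'. exec w c u t'' u' \<and> reg u' = reg s' \<and>
      (\<forall>b a. mem u b a = mem s b a \<longrightarrow> mem u' b a = mem s' b a)"
    using assms(2)[OF conjunct1[OF u] u'(1)] by blast
qed

text \<open>One time unit reads at most one memory cell.\<close>

lemma exec_queries: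
  "exec w p s t s' \<Longrightarrow> \<exists>Z. finite Z \<and> card Z \<le> t \<and> same_run w p s t s' Z"
proof (induction rule: exec.induct)
  case (Const r c s)
  show ?case
  proof (intro exI[of _ "{}"] conjI)
    show "same_run w (Const r c) s 1 (s\<lparr>reg := (reg s)(r := c mod 2 ^ w)\<rparr>) {}"
      unfolding same_run_def using exec.Const[of w r c] by fastforce
  qed simp_all
next
  case (Op f r r1 r2 s)
  show ?case
  proof (intro exI[of _ "{}"] conjI)
    show "same_run w (Op f r r1 r2) s 1 (s\<lparr>reg := (reg s)(r := binop_sem w f (reg s r1) (reg s r2))\<rparr>) {}"
      unfolding same_run_def using exec.Op[of w f r r1 r2] by fastforce
  qed simp_all
next
  case (Load r b a s)
  show ?case
  proof (intro exI[of _ "{(b, reg s a)}"] conjI)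
    show "same_run w (Load r b a) s 1 (s\<lparr>reg := (reg s)(r := mem s b (reg s a))\<rparr>) {(b, reg s a)}"
      unfolding same_run_def using exec.Load[of w r b a] by fastforce
  qed simp_all
next
  case (Store b a r s)
  show ?case
  proof (intro exI[of _ "{}"] conjI)
    show "same_run w (Store b a r) s 1 (s\<lparr>mem := (mem s)(b := (mem s b)(reg s a := reg s r))\<rparr>) {}"
      unfolding same_run_def using exec.Store[of w b a r] by fastforce
  qed simp_all
next
  case (Seq p s t s' q t' s'')
  then obtain Z Z' where Z: "finite Z" "card Z \<le> t" "same_run w p s t s' Z"
      "finite Z'" "card Z' \<le> t'" "same_run w q s' t' s'' Z'" by blast
  have "same_run w (Seq p q) s (t + t') s'' (Z \<union> Z')"
    using same_run_trans[OF Z(3,6)] exec.Seq by blast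
  moreover have "card (Z \<union> Z') \<le> t + t'" using card_Un_le[of Z Z'] Z by linarith
  ultimately show ?case using Z by blast
next
  case (CondTrue s r p t s' q)
  then obtain Z where Z: "finite Z" "card Z \<le> t" "same_run w p s t s' Z" by blast
  have "same_run w (Cond r p q) s (t + 1) s' Z"
    using CondTrue.hyps by (intro same_run_one[OF Z(3)] exec.CondTrue) auto
  then show ?case using Z by (meson le_add1 order.trans)
next
  case (CondFalse s r q t s' p)
  then obtain Z where Z: "finite Z" "card Z \<le> t" "same_run w q s t s' Z" by blast
  have "same_run w (Cond r p q) s (t + 1) s' Z"
    using CondFalse.hyps by (intro same_run_one[OF Z(3)] exec.CondFalse) auto
  then show ?case using Z by (meson le_add1 order.trans)
next
  case (WhileFalse s r p)
  show ?case
  proof (intro exI[of _ "{}"] conjI)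
    show "same_run w (While r p) s 1 s {}"
      unfolding same_run_def using exec.WhileFalse[of _ r w p] WhileFalse by metis
  qed simp_all
next
  case (WhileTrue s r p t s' t' s'')
  then obtain Z Z' where Z: "finite Z" "card Z \<le> t" "same_run w p s t s' Z"
      "finite Z'" "card Z' \<le> t'" "same_run w (While r p) s' t' s'' Z'" by blast
  have "same_run w (While r p) s (t + t' + 1) s'' (Z \<union> Z')"
    using same_run_trans[OF Z(3,6)] exec.WhileTrue WhileTrue.hyps(1) by metis
  moreover have "card (Z \<union> Z') \<le> t + t' + 1" using card_Un_le[of Z Z'] Z by linarith
  ultimately show ?case using Z by blast
qed

text \<open>Adversary argument: some vector of the all-ones instance is not inspected, and replacing it
  by the zero vector changes the answer.\<close>

lemma solver_time_ge:
  assumes solver: "\<And>X s. (\<forall>t<k. \<forall>i<n. \<forall>j<d. X t i j \<in> {0, 1}) \<Longrightarrow> input_state w k n d X s \<Longrightarrow>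
      \<exists>\<tau> s'. exec w p s \<tau> s' \<and> real \<tau> \<le> T \<and> reg s' 0 = (if kOV_yes k n d X then 1 else 0)"
    and "k \<ge> 1" "n \<ge> 1" "d \<ge> 1" "n < 2 ^ w" "d < 2 ^ w" "w \<ge> 1"
  shows "real n \<le> T"
proof (rule ccontr)
  assume "\<not> real n \<le> T"
  define s where "s = \<lparr>reg = (\<lambda>_. 0)(0 := n, 1 := d), mem = \<lambda>_ _. 1\<rparr>"
  define s2 where "s2 i = \<lparr>reg = (\<lambda>_. 0)(0 := n, 1 := d), mem = \<lambda>b a. if b = 0 \<and> a div d = i then 0 else 1\<rparr>"
    for i :: nat
  define Y where "Y i = (\<lambda>(t::nat) i' (j::nat). if t = 0 \<and> i' = i then 0 else 1 :: int)" for i :: nat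
  have one: "(1::nat) < 2 ^ w" "(1::int) < 2 ^ w" using assms by (auto intro!: one_less_power)
  have inp: "input_state w k n d (\<lambda>_ _ _. 1) s"
    using assms one by (auto simp: input_state_def s_def)
  have "\<forall>t<k. \<forall>i<n. \<forall>j<d. (1::int) \<in> {0, 1}" by simp
  from solver[OF this inp] obtain \<tau> s' where r: "exec w p s \<tau> s'" "real \<tau> \<le> T"
      "reg s' 0 = (if kOV_yes k n d (\<lambda>_ _ _. 1) then 1 else 0)"
    by blast
  have "\<not> kOV_yes k n d (\<lambda>_ _ _. 1)" using assms by (simp add: kOV_yes_def kinner_def)
  then have r0: "reg s' 0 = 0" using r by simp
  obtain Z where Z: "finite Z" "card Z \<le> \<tau>" "same_run w p s \<tau> s' Z"
    using exec_queries[OF r(1)] by blast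
  \<comment> \<open>A cell of the input belongs to vector number \<open>a div d\<close> for its
    address \<open>a\<close>. Fewer than \<open>n\<close> cells are read, so some vector of the
    first collection is missed entirely.\<close>
  have "card ((\<lambda>z. snd z div d) ` Z) < n"
    using card_image_le[OF Z(1), of "\<lambda>z. snd z div d"] Z(2) r(2) \<open>\<not> real n \<le> T\<close> by linarith
  then have "\<not> {..<n} \<subseteq> (\<lambda>z. snd z div d) ` Z"
    using card_mono[of "(\<lambda>z. snd z div d) ` Z" "{..<n}"] Z(1) by auto
  then obtain i where i: "i < n" "i \<notin> (\<lambda>z. snd z div d) ` Z" by blast
  have "\<forall>(b, a)\<in>Z. mem (s2 i) b a = mem s b a"
    using i(2) by (force simp: s_def s2_def)
  moreover have "reg (s2 i) = reg s" by (simp add: s_def s2_def)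
  ultimately obtain u where u: "exec w p (s2 i) \<tau> u" "reg u = reg s'"
    using Z(3) unfolding same_run_def by blast
  have "input_state w k n d (Y i) (s2 i)"
    unfolding input_state_def
  proof (intro conjI allI impI)
    fix t i' j assume t: "t < k" "i' < n" "j < d"
    have "t * n + i' = i \<longleftrightarrow> t = 0 \<and> i' = i"
      using t i by (cases t) auto
    then show "int (mem (s2 i) 0 ((t * n + i') * d + j)) = Y i t i' j mod 2 ^ w"
      using t one by (simp add: s2_def Y_def)
  qed (use assms one in \<open>auto simp: s2_def\<close>)
  moreover have "\<forall>t<k. \<forall>i'<n. \<forall>j<d. Y i t i' j \<in> {0, 1}" by (simp add: Y_def)
  ultimately obtain \<tau>' u' where u': "exec w p (s2 i) \<tau>' u'"
      "reg u' 0 = (if kOV_yes k n d (Y i) then 1 else 0)"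
    using solver by blast
  have "kinner k d (\<lambda>t. Y i t i) = 0"
    unfolding kinner_def using assms(2) by (intro sum.neutral ballI prod_zero) (auto simp: Y_def intro!: bexI[of _ 0])
  then have "kOV_yes k n d (Y i)" unfolding kOV_yes_def using i by (intro exI[of _ "\<lambda>_. i"]) auto
  then show False using exec_determ[OF u(1) u'(1)] u'(2) u(2) r0 by simp
qed

section \<open>Asymptotics\<close>

lemma tow_ge: "j \<le> tow j"
  using strict_mono_imp_increasing[OF strict_mono_tow, of j] .

lemma filterlim_log_star: "filterlim log_star at_top sequentially"
  unfolding filterlim_at_top
proof
  fix Z
  have "Z \<le> log_star n" if "n > tow Z" for n
  proof (rule ccontr)
    assume "\<not> Z \<le> log_star n"
    then have "log_star n \<le> Z - 1" "Z > 0" by linarith+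
    then show False using log_star_le_iff[of n "Z - 1"] that by simp
  qed
  then show "eventually (\<lambda>n. Z \<le> log_star n) sequentially"
    by (intro eventually_mono[OF eventually_gt_at_top[of "tow Z"]])
qed

text \<open>By minimality of \<open>log_star n\<close>, \<open>n\<close> exceeds
  \<open>tow (log_star n)\<close>, which is 2 to the \<open>tow (log_star n - 1)\<close>.\<close>

lemma tow_pred_less_log:
  assumes "log_star n \<ge> 1" shows "tow (log_star n - 1) < log 2 n"
proof -
  have "\<not> log_star n \<le> log_star n - 1" using assms by simp
  then have "\<not> n \<le> tow (Suc (log_star n - 1))" unfolding log_star_le_iff .
  then have "2 ^ tow (log_star n - 1) < n" by simp
  then have "real (2 ^ tow (log_star n - 1)) < real n" by (simp only: of_nat_less_iff)
  then have "log 2 (2 ^ tow (log_star n - 1)) < log 2 n" by (subst log_less_cancel_iff) auto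
  then show ?thesis by (simp add: log_nat_power)
qed

text \<open>The offsets fit \<open>j = log_star n - 3\<close>: the exponent becomes
  \<open>log_star n\<close> and the right side \<open>tow (log_star n - 1)\<close>, which is below
  log n. Two exponentiations beyond \<open>tow j \<ge> j\<close> outgrow a single
  exponential.\<close>

lemma power_le_tow: "eventually (\<lambda>j. real a ^ (j + 3) \<le> real (tow (j + 2))) sequentially"
proof -
  have "eventually (\<lambda>j. real a * (real j + 3) \<le> 2 ^ j) sequentially"
  proof -
    have "(\<lambda>j. real j + 3) \<in> o(\<lambda>j. 2 ^ j :: real)" by real_asymp
    from landau_o.smallD[OF this, of "1 / (real a + 1)"]
    have "eventually (\<lambda>j. real j + 3 \<le> 2 ^ j / (real a + 1)) sequentially" by simp
    then show ?thesis
    proof eventually_elim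
      case (elim j)
      have "real a * (real j + 3) \<le> (real a + 1) * (2 ^ j / (real a + 1))"
        using elim by (intro mult_mono) auto
      then show ?case by simp
    qed
  qed
  then show ?thesis
  proof eventually_elim
    case (elim j)
    have "real (a * (j + 3)) \<le> real (2 ^ j)" using elim by (simp add: algebra_simps)
    then have "a * (j + 3) \<le> 2 ^ j" by (simp only: of_nat_le_iff)
    also have "\<dots> \<le> 2 ^ tow j" using tow_ge by (intro power_increasing) auto
    finally have le: "a * (j + 3) \<le> tow (Suc j)" by simp
    have "a ^ (j + 3) \<le> (2 ^ a) ^ (j + 3)" using less_exp[of a] by (intro power_mono) auto
    also have "\<dots> = 2 ^ (a * (j + 3))" by (simp only: power_mult)
    also have "\<dots> \<le> 2 ^ tow (Suc j)" using le by (intro power_increasing) auto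
    finally have "a ^ (j + 3) \<le> tow (j + 2)" by (simp add: numeral_2_eq_2)
    then show ?case unfolding of_nat_power[symmetric] of_nat_le_iff .
  qed
qed

lemma power_log_star_le_log: "eventually (\<lambda>n. real a ^ log_star n \<le> log 2 n) sequentially"
proof -
  have "eventually (\<lambda>n. real a ^ (log_star n - 3 + 3) \<le> real (tow (log_star n - 3 + 2))) sequentially"
  proof (rule eventually_compose_filterlim[OF power_le_tow])
    show "filterlim (\<lambda>n. log_star n - 3) at_top sequentially"
      by (rule filterlim_compose[OF filterlim_minus_const_nat_at_top filterlim_log_star])
  qed
  moreover have "eventually (\<lambda>n. log_star n \<ge> 3) sequentially"
    using filterlim_log_star by (simp add: filterlim_at_top)
  ultimately show ?thesis
  proof eventually_elim
    case (elim n)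
    then have "log_star n - 3 + 3 = log_star n" "log_star n - 3 + 2 = log_star n - 1" by linarith+
    then have "real a ^ log_star n \<le> real (tow (log_star n - 1))" using elim(1) by simp
    also have "real (tow (log_star n - 1)) \<le> log 2 n"
      using tow_pred_less_log[of n] elim(2) by linarith
    finally show ?case .
  qed
qed

section \<open>The overhead is n^{o(1)}\<close>

locale reduction =
  fixes k :: nat and c :: real
  assumes k2: "k \<ge> 2" and c0: "c > 0"
begin

definition "el n = (3 * k + 1) ^ log_star n"
definition "dm n = nat \<lfloor>c * log 2 (real n)\<rfloor>"
definition "num n = dm n div el n + 1"
definition "top_U n = tower_code.U k (el n) (num n) (tower_code.r k (el n) (num n))"
definition "top_M n = el n * top_U n ^ k"
text \<open>The left side of the assumption \<open>B\<close> of \<open>ovram\<close>, increased by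
  \<open>clg n\<close> and \<open>3 * k + 1\<close> as required by \<open>wp_initP\<close>.\<close>

definition "bound n = top_M n + num n * num n + el n * num n + el n + 2 * num n + k + 3 + clg n + (3 * k + 1)"

lemma el_pos: "el n \<ge> 1" by (simp add: el_def)

lemma code: "tower_code k (el n) (num n)"
  using k2 el_pos by unfold_locales (auto simp: num_def)

lemma top_U_ge: "top_U n \<ge> 2"
  unfolding top_U_def by (rule tower_code.U_ge_2[OF code])

lemma bound_pos: "bound n \<ge> 1" by (simp add: bound_def)

lemma el_le_log: "eventually (\<lambda>n. real (el n) \<le> log 2 n) sequentially"
  using power_log_star_le_log[of "3 * k + 1"] by (simp add: el_def)

lemma filterlim_el: "filterlim el at_top sequentially"
proof (rule filterlim_at_top_mono[OF filterlim_log_star])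
  have "log_star n \<le> el n" for n
  proof -
    have "log_star n < 2 ^ log_star n" by (rule less_exp)
    also have "\<dots> \<le> el n" unfolding el_def using k2 by (intro power_mono) auto
    finally show ?thesis by simp
  qed
  then show "eventually (\<lambda>n. log_star n \<le> el n) sequentially" by simp
qed

lemma num_le: "n \<ge> 1 \<Longrightarrow> real (num n) \<le> c * log 2 n / el n + 1"
proof -
  assume "n \<ge> 1"
  then have "real (dm n) \<le> c * log 2 n" using c0 by (simp add: dm_def)
  then have "real (dm n) / el n \<le> c * log 2 n / el n" by (intro divide_right_mono) auto
  moreover have "real (dm n div el n) \<le> real (dm n) / el n" by (rule of_nat_div_le_of_nat)
  ultimately show ?thesis by (simp add: num_def)
qed

text \<open>A bound on the code length relative to log n. The factor
  \<open>2 * (c + 1) / el n\<close> comes from \<open>P r \<le> 2 * N\<close>, the others from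
  \<open>log_U_le\<close> with \<open>log_star n\<close> in place of \<open>r\<close>.\<close>

definition "\<rho> n = 2 * (c + 1) * (1 + log 2 (el n)) * (3 * real k) ^ log_star n / el n"

lemma log_top_U:
  "eventually (\<lambda>n. log 2 (top_U n) \<le> \<rho> n * log 2 n) sequentially"
proof -
  obtain M0 where M0: "\<And>M. M \<ge> M0 \<Longrightarrow> (nextp ^^ M) M \<le> M\<^sup>2"
    using many_primes_below_square unfolding eventually_at_top_linorder by blast
  have "eventually (\<lambda>n. el n \<ge> M0) sequentially" using filterlim_el by (simp add: filterlim_at_top)
  moreover have "eventually (\<lambda>n. c * log 2 (real n) + 1 \<le> real n) sequentially" using c0 by real_asymp
  ultimately show ?thesis using el_le_log eventually_ge_at_top[of "1::nat"]
  proof eventually_elim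
    case (elim n)
    interpret tower_code k "el n" "num n" by (rule code)
    have l0: "0 < real (el n)" using el_pos[of n] by simp
    have y: "log 2 n \<ge> 1" using elim(3) el_pos[of n] by linarith
    have N: "real (num n) \<le> c * log 2 n / el n + 1" by (rule num_le[OF elim(4)])
    have "c * log 2 n / el n \<le> c * log 2 n / 1"
      using el_pos[of n] c0 y by (intro divide_left_mono) auto
    then have "real (num n) \<le> real n" using N elim(2) by simp
    \<comment> \<open>The number of levels:
      \<open>tow r < N \<le> n \<le> tow (log_star n + 1)\<close>, hence
      \<open>r \<le> log_star n\<close>.\<close>
    then have "tow r < n" using tow_r_less by linarith
    also have "n \<le> tow (Suc (log_star n))" using log_star_le_iff[of n "log_star n"] by simp
    finally have "r < Suc (log_star n)" using strict_mono_less[OF strict_mono_tow] by blast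
    then have rL: "(3 * k) ^ r \<le> (3 * k) ^ log_star n" using k2 by (intro power_increasing) auto
    have "1 \<le> log 2 n / el n" using elim(3) l0 by (simp add: le_divide_eq)
    then have N2: "real (num n) \<le> (c + 1) * (log 2 n / el n)" 
    proof -
      have "c * log 2 n / el n = c * (log 2 n / el n)" by simp
      then have "real (num n) \<le> c * (log 2 n / el n) + 1" using N by linarith
      then show ?thesis using \<open>1 \<le> log 2 n / el n\<close> by (simp only: distrib_right mult_1)
    qed
    have P2: "real (P r) \<le> 2 * ((c + 1) * (log 2 n / el n))" using P_r_le N2 by linarith
    have ll: "0 \<le> 1 + log 2 (el n)" using el_pos[of n] by simp
    have "log 2 (top_U n) \<le> real (P r) * (1 + log 2 (el n)) * (3 * real k) ^ r"
      unfolding top_U_def using log_U_le[of r] M0 elim(1) by simp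
    also have "\<dots> \<le> 2 * ((c + 1) * (log 2 n / el n)) * (1 + log 2 (el n)) * (3 * real k) ^ log_star n"
    proof -
      have "real ((3 * k) ^ r) \<le> real ((3 * k) ^ log_star n)" using rL by (simp only: of_nat_le_iff)
      then have "(3 * real k) ^ r \<le> (3 * real k) ^ log_star n" by simp
      then show ?thesis using P2 ll c0 y by (intro mult_mono) auto
    qed
    also have "\<dots> = \<rho> n * log 2 n" by (simp add: \<rho>_def)
    finally show ?case .
  qed
qed

text \<open>With \<open>L\<close> for \<open>log_star n\<close>, the main term is \<open>L\<close>
  times a power of 3k / (3k + 1) with exponent \<open>L\<close>. The geometric decay, due to the
  base \<open>3 * k + 1\<close> of \<open>l\<close>, beats the factor \<open>L\<close> from log
  l.\<close>

lemma \<rho>_tendsto: "\<rho> \<longlonglongrightarrow> 0"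
proof -
  let ?x = "3 * real k / (3 * real k + 1)"
  have x: "norm ?x < 1" by simp
  have 1: "(\<lambda>L. ?x ^ L) \<longlonglongrightarrow> 0" using x by (intro LIMSEQ_power_zero) 
  have 2: "(\<lambda>L. real L * ?x ^ L) \<longlonglongrightarrow> 0" using x by (rule powser_times_n_limit_0)
  have "(\<lambda>L. 2 * (c + 1) * (?x ^ L + log 2 (3 * real k + 1) * (real L * ?x ^ L))) \<longlonglongrightarrow>
      2 * (c + 1) * (0 + log 2 (3 * real k + 1) * 0)"
    by (intro tendsto_intros 1 2)
  then have "(\<lambda>n. 2 * (c + 1) * (?x ^ log_star n + log 2 (3 * real k + 1) * (real (log_star n) * ?x ^ log_star n))) \<longlonglongrightarrow> 0"
    using filterlim_compose[OF _ filterlim_log_star] by fastforce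
  moreover have "\<rho> n = 2 * (c + 1) * (?x ^ log_star n + log 2 (3 * real k + 1) * (real (log_star n) * ?x ^ log_star n))" for n
  proof -
    have "real (el n) = (3 * real k + 1) ^ log_star n" by (simp add: el_def add.commute)
    moreover have "log 2 ((3 * real k + 1) ^ log_star n) = log_star n * log 2 (3 * real k + 1)"
      by (intro log_nat_power) auto
    ultimately show ?thesis by (simp add: \<rho>_def power_divide field_simps)
  qed
  ultimately show ?thesis by (subst tendsto_cong[of _ "\<lambda>n. 2 * (c + 1) * (?x ^ log_star n +
      log 2 (3 * real k + 1) * (real (log_star n) * ?x ^ log_star n))"]) simp_all
qed

text \<open>The summands of \<open>bound\<close> estimated by \<open>y\<close> for log n:
  \<open>el\<close> by \<open>y\<close>, \<open>num\<close> by \<open>c * y + 1\<close>,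
  \<open>clg\<close> by \<open>y + 1\<close>. The first \<open>y\<close> is the coefficient of
  \<open>top_U n ^ k\<close> in \<open>top_M n\<close>.\<close>

definition "poly y = y + (c * y + 1) * (c * y + 1) + y * (c * y + 1) + y + 2 * (c * y + 1) + (4 * real k + 4) + (y + 1)"

text \<open>As \<open>top_U n ^ k\<close> is at least 1, it can be pulled out of all summands of
  \<open>bound n\<close>; the rest is polynomial in log n.\<close>

lemma log_bound:
  "eventually (\<lambda>n. log 2 (bound n) \<le> k * (\<rho> n * log 2 n) + log 2 (poly (log 2 n))) sequentially"
  using log_top_U el_le_log eventually_ge_at_top[of "1::nat"]
proof eventually_elim
  case (elim n)
  let ?y = "log 2 (real n)" and ?u = "real (top_U n) ^ k"
  have u1: "1 \<le> ?u" using top_U_ge[of n] by (intro one_le_power) auto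
  have y: "?y \<ge> 1" using elim(2) el_pos[of n] by linarith
  have "c * log 2 n / el n \<le> c * log 2 n / 1"
      using el_pos[of n] c0 y by (intro divide_left_mono) auto
  then have N: "real (num n) \<le> c * ?y + 1" using num_le[OF elim(3)] by simp
  have cl: "real (clg n) \<le> ?y + 1"
  proof (cases "clg n")
    case (Suc e)
    then have "\<not> clg n \<le> e" by simp
    then have "2 ^ e < n" unfolding clg_le_iff by simp
    then have "real (2 ^ e) < real n" by (simp only: of_nat_less_iff)
    then have "log 2 (2 ^ e) \<le> ?y" by (subst log_le_cancel_iff) auto
    then show ?thesis using Suc by (simp add: log_nat_power)
  qed (use y in simp)
  have NN: "real (num n) * real (num n) \<le> (c * ?y + 1) * (c * ?y + 1)" using N by (intro mult_mono) auto
  have lN: "real (el n) * real (num n) \<le> ?y * (c * ?y + 1)" using N elim(2) y by (intro mult_mono) auto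
  let ?rest = "(c * ?y + 1) * (c * ?y + 1) + ?y * (c * ?y + 1) + ?y + 2 * (c * ?y + 1) + (4 * real k + 4) + (?y + 1)"
  have "real (bound n) \<le> ?y * ?u + ?rest"
  proof -
    have "real (el n) * ?u \<le> ?y * ?u" using elim(2) u1 by (intro mult_right_mono) auto
    then show ?thesis using NN lN N cl elim(2) by (simp add: bound_def top_M_def)
  qed
  also have "?rest * 1 \<le> ?rest * ?u" using u1 y c0 by (intro mult_left_mono) auto
  then have "?y * ?u + ?rest \<le> ?u * poly ?y" by (simp add: poly_def algebra_simps)
  finally have le: "real (bound n) \<le> ?u * poly ?y" .
  have p: "poly ?y > 0" unfolding poly_def using y c0 by (intro add_nonneg_pos add_nonneg_nonneg mult_nonneg_nonneg) auto
  have "log 2 (bound n) \<le> log 2 (?u * poly ?y)"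
    using le bound_pos[of n] p u1 by (subst log_le_cancel_iff) (auto intro: mult_pos_pos)
  also have "\<dots> = k * log 2 (top_U n) + log 2 (poly ?y)"
    using p top_U_ge[of n] by (simp add: log_mult log_nat_power)
  also have "k * log 2 (top_U n) \<le> k * (\<rho> n * log 2 n)" using elim(1) by (intro mult_left_mono) auto
  finally show ?case by simp
qed

definition "C = 1 + (c + 1) * (c + 1) + (c + 1) + 1 + 2 * (c + 1) + (4 * real k + 4) + 2"

lemma poly_bounds:
  assumes "y \<ge> 1" shows "1 \<le> poly y" "poly y \<le> C * y\<^sup>2"
proof -
  have "0 \<le> c * y" "0 \<le> real k" using c0 assms by simp_all
  then have nn: "0 \<le> (c * y + 1) * (c * y + 1)" "0 \<le> y * (c * y + 1)" using assms by auto
  have "1 \<le> y + u + v + y + 2 * (x + 1) + (4 * z + 4) + (y + 1)"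
    if "0 \<le> u" "0 \<le> v" "0 \<le> x" "0 \<le> z" for u v x z :: real
    using that assms by simp
  then show "1 \<le> poly y" unfolding poly_def using nn \<open>0 \<le> c * y\<close> \<open>0 \<le> real k\<close> by blast
  have 1: "c * y + 1 \<le> (c + 1) * y" using assms by (simp add: algebra_simps)
  have 2: "y \<le> y * y" using assms by simp
  have 3: "(c * y + 1) * (c * y + 1) \<le> ((c + 1) * y) * ((c + 1) * y)"
    using 1 c0 assms by (intro mult_mono) auto
  have 4: "y * (c * y + 1) \<le> y * ((c + 1) * y)" using 1 assms by (intro mult_left_mono) auto
  have 5: "(c + 1) * y \<le> (c + 1) * (y * y)" using 2 c0 by (intro mult_left_mono) auto
  have 6: "1 \<le> y * y" using 2 assms by linarith
  then have "(4 * real k + 4) * 1 \<le> (4 * real k + 4) * (y * y)" by (intro mult_left_mono) auto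
  then have 7: "4 * real k + 4 \<le> (4 * real k + 4) * (y * y)" by simp
  have 8: "2 * (c * y + 1) \<le> 2 * ((c + 1) * (y * y))" using order.trans[OF 1 5] by simp
  have "poly y \<le> y * y + ((c + 1) * y) * ((c + 1) * y) + y * ((c + 1) * y) + y * y + 2 * ((c + 1) * (y * y)) +
      (4 * real k + 4) * (y * y) + (y * y + y * y)"
    unfolding poly_def by (intro add_mono 2 3 4 6 7 8)
  also have "\<dots> = C * y\<^sup>2" by (simp add: C_def power2_eq_square algebra_simps)
  finally show "poly y \<le> C * y\<^sup>2" .
qed

lemma log_bound_tendsto: "(\<lambda>n. log 2 (bound n) / log 2 n) \<longlonglongrightarrow> 0"
proof (rule tendsto_sandwich[of "\<lambda>_. 0" _ _ "\<lambda>n. k * \<rho> n + log 2 (poly (log 2 n)) / log 2 n"])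
  show "eventually (\<lambda>n. 0 \<le> log 2 (bound n) / log 2 n) sequentially"
    using eventually_ge_at_top[of "1::nat"]
  proof eventually_elim
    case (elim n)
    have "0 \<le> log 2 (bound n)" using bound_pos[of n] by simp
    then show ?case using elim by simp
  qed
  show "eventually (\<lambda>n. log 2 (bound n) / log 2 n \<le> k * \<rho> n + log 2 (poly (log 2 n)) / log 2 n) sequentially"
    using log_bound eventually_gt_at_top[of "1::nat"]
  proof eventually_elim
    case (elim n)
    have "log 2 (real n) > 0" using elim(2) by simp
    then show ?case using elim(1) by (simp add: field_simps)
  qed
  have "((\<lambda>y. log 2 (poly y) / y) \<longlongrightarrow> 0) at_top"
  proof (rule tendsto_sandwich[of "\<lambda>_. 0" _ _ "\<lambda>y. log 2 (C * y\<^sup>2) / y"])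
    show "eventually (\<lambda>y. 0 \<le> log 2 (poly y) / y) at_top" using eventually_ge_at_top[of "1::real"]
    proof eventually_elim
      case (elim y)
      then have "1 \<le> poly y" using poly_bounds by blast
      then show ?case using elim by simp
    qed
    show "eventually (\<lambda>y. log 2 (poly y) / y \<le> log 2 (C * y\<^sup>2) / y) at_top"
      using eventually_ge_at_top[of "1::real"]
    proof eventually_elim
      case (elim y)
      then have "1 \<le> poly y" "poly y \<le> C * y\<^sup>2" using poly_bounds by blast+
      then show ?case using elim by (intro divide_right_mono) auto
    qed
    have "C > 0" unfolding C_def using c0 by (intro add_nonneg_pos add_nonneg_nonneg) auto
    then show "((\<lambda>y. log 2 (C * y\<^sup>2) / y) \<longlongrightarrow> 0) at_top" by real_asymp
  qed simp
  moreover have "filterlim (\<lambda>n. log 2 (real n)) at_top sequentially" by real_asymp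
  ultimately have "(\<lambda>n. log 2 (poly (log 2 (real n))) / log 2 (real n)) \<longlonglongrightarrow> 0"
    by (rule filterlim_compose)
  from tendsto_add[OF tendsto_mult[OF tendsto_const[of "real k"] \<rho>_tendsto] this]
  show "(\<lambda>n. k * \<rho> n + log 2 (poly (log 2 n)) / log 2 n) \<longlonglongrightarrow> 0" by simp
qed simp_all

text \<open>The word size has to suffice for every \<open>n \<ge> 1\<close>, whereas
  \<open>bound n \<le> n\<close> is known only eventually. The finitely many exceptions are summed
  into \<open>K\<close> and then absorbed in the exponent, using
  \<open>n + 1 \<ge> 2\<close>.\<close>

lemma word_size:
  obtains a :: nat where "\<And>n. n \<ge> 1 \<Longrightarrow> 2 * ((k * n + 1) * (bound n + 1)) \<le> (n + 1) ^ a"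
proof -
  have "eventually (\<lambda>n. log 2 (bound n) / log 2 n < 1) sequentially"
    using order_tendstoD(2)[OF log_bound_tendsto, of 1] by simp
  then have "eventually (\<lambda>n. bound n \<le> n) sequentially"
    using eventually_gt_at_top[of "1::nat"]
  proof eventually_elim
    case (elim n)
    have "log 2 (real n) > 0" using elim(2) by simp
    then have "log 2 (bound n) < log 2 n" using elim(1) by (simp add: divide_less_eq)
    then have "real (bound n) < real n"
      using elim(2) bound_pos[of n] by (subst (asm) log_less_cancel_iff) auto
    then show ?case by simp
  qed
  then obtain n0 where n0: "\<And>n. n \<ge> n0 \<Longrightarrow> bound n \<le> n" unfolding eventually_sequentially by blast
  define K where "K = (\<Sum>n<n0. bound n)"
  have b: "bound n \<le> K + n" for n
  proof (cases "n \<ge> n0")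
    case False
    then have "bound n \<le> K" unfolding K_def by (intro member_le_sum) auto
    then show ?thesis by simp
  qed (use n0[of n] in simp)
  have "2 * ((k * n + 1) * (bound n + 1)) \<le> (n + 1) ^ (1 + (k + 1) + (K + 2))" if n: "n \<ge> 1" for n
  proof -
    have exp: "x \<le> (n + 1) ^ x" for x
    proof -
      have "x < 2 ^ x" by (rule less_exp)
      also have "\<dots> \<le> (n + 1) ^ x" using n by (intro power_mono) auto
      finally show ?thesis by simp
    qed
    have "k * n + 1 \<le> k * (n + 1) + 1 * (n + 1)" by simp
    then have "k * n + 1 \<le> (k + 1) * (n + 1)" by (simp only: add_mult_distrib)
    also have "\<dots> \<le> (n + 1) ^ k * (n + 1)"
    proof (rule mult_right_mono)
      have "k + 1 \<le> 2 ^ k" using less_exp[of k] by linarith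
      also have "\<dots> \<le> (n + 1) ^ k" using n by (intro power_mono) auto
      finally show "k + 1 \<le> (n + 1) ^ k" .
    qed simp
    finally have 1: "k * n + 1 \<le> (n + 1) ^ (k + 1)" by (simp add: mult.commute)
    have "bound n + 1 \<le> K * (n + 1) + 1 * (n + 1)" using b[of n] by simp
    then have "bound n + 1 \<le> (K + 1) * (n + 1)" by (simp only: add_mult_distrib)
    also have "\<dots> \<le> (n + 1) ^ (K + 1) * (n + 1)" by (rule mult_right_mono[OF exp]) simp
    finally have 2: "bound n + 1 \<le> (n + 1) ^ (K + 2)" by (simp add: mult.commute)
    have "2 * ((k * n + 1) * (bound n + 1)) \<le> (n + 1) ^ 1 * ((n + 1) ^ (k + 1) * (n + 1) ^ (K + 2))"
      using 1 2 n by (intro mult_mono) auto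
    then show ?thesis by (simp only: power_add mult.assoc)
  qed
  then show ?thesis by (rule that)
qed

end

section \<open>The theorem\<close>

lemma exists_word_size:
  fixes n a :: nat
  assumes "n \<ge> 1" "a \<ge> 1"
  obtains w :: nat where "real a * log 2 (real n + 1) \<le> w" "w \<le> real (2 * a) * log 2 (real n + 1)" "n < 2 ^ w" "w \<ge> 1"
proof -
  let ?y = "log 2 (real n + 1)"
  have y: "?y \<ge> 1" using assms(1) by (subst le_log_iff) auto
  define w where "w = a * nat \<lceil>?y\<rceil>"
  have c: "?y \<le> nat \<lceil>?y\<rceil>" "real (nat \<lceil>?y\<rceil>) \<le> 2 * ?y"
    using y by linarith+
  have 1: "real a * ?y \<le> w" "w \<le> real (2 * a) * ?y"
    using mult_left_mono[OF c(1), of "real a"] mult_left_mono[OF c(2), of "real a"] by (simp_all add: w_def algebra_simps)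
  have "1 * ?y \<le> real a * ?y" using assms y by (intro mult_right_mono) auto
  then have yw: "?y \<le> w" using 1 by linarith
  then have "real n + 1 \<le> 2 powr w" by (subst (asm) log_le_iff) auto
  then have "real (n + 1) \<le> real (2 ^ w)" by (simp add: powr_realpow)
  then have "n + 1 \<le> 2 ^ w" by (simp only: of_nat_le_iff)
  moreover have "w \<ge> 1" using yw y by linarith
  ultimately show thesis using that[OF 1] by simp
qed

text \<open>The assumption on the solver allows arbitrarily large \<delta>; reading the input rules
  out exponents below 1. This lets the time of the solver dominate the linear cost of writing a
  query.\<close>

lemma decides_OV_exponent_ge_1:
  assumes dec: "decides_OV k d E p (\<lambda>n. real n powr a)" and "k \<ge> 1"
    and d: "\<And>n. d n \<ge> 1" "eventually (\<lambda>n. d n \<le> n) sequentially"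
    and E: "\<And>w. w \<ge> 2 \<Longrightarrow> {0, 1} \<subseteq> E w"
  shows "a \<ge> 1"
proof (rule ccontr)
  assume a: "\<not> a \<ge> 1"
  obtain C0 where C0: "\<forall>C::nat. \<exists>f \<in> O(\<lambda>n. real n powr a). \<forall>n\<ge>1. \<forall>w::nat.
        real C0 * log 2 (real n + 1) \<le> real w \<and> real w \<le> real C * log 2 (real n + 1) \<longrightarrow>
        (\<forall>X s. (\<forall>t<k. \<forall>i<n. \<forall>j<d n. X t i j \<in> E w) \<and> input_state w k n (d n) X s \<longrightarrow>
           (\<exists>\<tau> s'. exec w p s \<tau> s' \<and> real \<tau> \<le> f n \<and>
              reg s' 0 = (if kOV_yes k n (d n) X then 1 else 0)))"
    using dec unfolding decides_OV_def by blast
  \<comment> \<open>The 2 forces \<open>w \<ge> 2\<close>, which makes 0 and 1 admissible entries;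
    \<open>2 * c\<close> is the matching upper constant from
    \<open>exists_word_size\<close>.\<close>
  define c where "c = C0 + 2"
  obtain f where f: "f \<in> O(\<lambda>n. real n powr a)" and run: "\<And>n w X s. n \<ge> 1 \<Longrightarrow>
        real C0 * log 2 (real n + 1) \<le> real w \<Longrightarrow> real w \<le> real (2 * c) * log 2 (real n + 1) \<Longrightarrow>
        \<forall>t<k. \<forall>i<n. \<forall>j<d n. X t i j \<in> E w \<Longrightarrow> input_state w k n (d n) X s \<Longrightarrow>
           \<exists>\<tau> s'. exec w p s \<tau> s' \<and> real \<tau> \<le> f n \<and>
              reg s' 0 = (if kOV_yes k n (d n) X then 1 else 0)"
    using C0[rule_format, of "2 * c"] by blast
  have ge: "real n \<le> f n" if n: "n \<ge> 1" "d n \<le> n" for n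
  proof -
    obtain w :: nat where w: "real c * log 2 (real n + 1) \<le> w" "w \<le> real (2 * c) * log 2 (real n + 1)"
        "n < 2 ^ w" "w \<ge> 1"
      using exists_word_size[OF n(1), of c] by (auto simp: c_def)
    have y: "log 2 (real n + 1) \<ge> 1" using n(1) by (subst le_log_iff) auto
    have "real C0 * log 2 (real n + 1) \<le> real c * log 2 (real n + 1)"
      using y by (intro mult_right_mono) (auto simp: c_def)
    then have lo: "real C0 * log 2 (real n + 1) \<le> w" using w(1) by linarith
    have "real 2 * 1 \<le> real c * log 2 (real n + 1)" using y by (intro mult_mono) (auto simp: c_def)
    then have w2: "w \<ge> 2" using w(1) by linarith
    show ?thesis
    proof (rule solver_time_ge[where k = k and n = n and d = "d n" and w = w and p = p])
      fix X s assume X: "\<forall>t<k. \<forall>i<n. \<forall>j<d n. X t i j \<in> {0, 1}" and s: "input_state w k n (d n) X s"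
      have "\<forall>t<k. \<forall>i<n. \<forall>j<d n. X t i j \<in> E w" using X E[OF w2] by blast
      then show "\<exists>\<tau> s'. exec w p s \<tau> s' \<and> real \<tau> \<le> f n \<and> reg s' 0 = (if kOV_yes k n (d n) X then 1 else 0)"
        using run[OF n(1) lo w(2) _ s] by blast
    qed (use assms n w d in auto)
  qed
  have "f \<in> o(\<lambda>n. real n)"
  proof (rule landau_o.big_small_trans[OF f])
    show "(\<lambda>n. real n powr a) \<in> o(\<lambda>n. real n)" using a by real_asymp
  qed
  then have "eventually (\<lambda>n. norm (f n) \<le> 1 / 2 * norm (real n)) sequentially"
    by (rule landau_o.smallD) simp
  then have "eventually (\<lambda>n::nat. False) sequentially"
    using d(2) eventually_ge_at_top[of "1::nat"]
  proof eventually_elim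
    case (elim n)
    then show False using ge[of n] by simp
  qed
  then show False by simp
qed

lemma kOV_solver_progP:
  fixes A :: com
  assumes k2: "k \<ge> 2" and c0: "c > 0"
    and A: "ZkOV_solver k (\<lambda>n. (3 * k + 1) ^ log_star n + 1) A (\<lambda>n. real n powr (real k - \<delta>))"
  shows "\<exists>\<epsilon> :: nat \<Rightarrow> real. \<epsilon> \<longlonglongrightarrow> 0 \<and>
       kOV_solver k (\<lambda>n. nat \<lfloor>c * log 2 (real n)\<rfloor>) (link A (compS (progP k)))
         (\<lambda>n. real n powr (real k - \<delta> + \<epsilon> n))"
proof -
  interpret red: reduction k c by unfold_locales (rule k2 c0)+
  let ?l = red.el and ?N = red.num and ?d = red.dm and ?B = red.bound
  let ?E = "\<lambda>w::nat. {- (2 ^ (w - 1)) ..< 2 ^ (w - 1)} :: int set"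
  let ?dA = "\<lambda>n. (3 * k + 1) ^ log_star n + 1"
  have dA: "?dA n = ?l n + 1" for n by (simp add: red.el_def)
  have exp1: "real k - \<delta> \<ge> 1"
  proof (rule decides_OV_exponent_ge_1[where k = k and d = ?dA and E = ?E and p = A])
    show "decides_OV k ?dA ?E A (\<lambda>n. real n powr (real k - \<delta>))" using A unfolding ZkOV_solver_def .
    show "eventually (\<lambda>n. ?dA n \<le> n) sequentially"
    proof -
      have "eventually (\<lambda>n::nat. log 2 (real n) + 1 \<le> real n) sequentially" by real_asymp
      then show ?thesis using red.el_le_log
      proof eventually_elim
        case (elim n)
        then have "real (?l n + 1) \<le> real n" by simp
        then have "?l n + 1 \<le> n" by (simp only: of_nat_le_iff)
        then show ?case by (simp only: red.el_def)
      qed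
    qed
    show "{0, 1} \<subseteq> ?E w" if "w \<ge> 2" for w
    proof -
      have "(1::int) < 2 ^ (w - 1)" using that by (intro one_less_power) auto
      then show ?thesis by auto
    qed
  qed (use k2 in auto)
  obtain K where K: "\<And>b T B S. b False \<le> B \<Longrightarrow> 1 \<le> B \<Longrightarrow> b True \<le> S \<Longrightarrow> T \<le> S \<Longrightarrow> 1 \<le> S \<Longrightarrow>
      tb b T (progP k) \<le> K * B ^ K * S"
    using tb_lin[OF lin_progP[of k]] by blast
  obtain a where a: "\<And>n. n \<ge> 1 \<Longrightarrow> 2 * ((k * n + 1) * (?B n + 1)) \<le> (n + 1) ^ a"
    using red.word_size by blast
  obtain C0 where C0: "\<forall>C::nat. \<exists>f \<in> O(\<lambda>n. real n powr (real k - \<delta>)). \<forall>n\<ge>1. \<forall>w::nat.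
        real C0 * log 2 (real n + 1) \<le> real w \<and> real w \<le> real C * log 2 (real n + 1) \<longrightarrow>
        (\<forall>X s. (\<forall>t<k. \<forall>i<n. \<forall>j<?dA n. X t i j \<in> ?E w) \<and> input_state w k n (?dA n) X s \<longrightarrow>
           (\<exists>\<tau> s'. exec w A s \<tau> s' \<and> real \<tau> \<le> f n \<and>
              reg s' 0 = (if kOV_yes k n (?dA n) X then 1 else 0)))"
    using A unfolding ZkOV_solver_def decides_OV_def by blast
  \<comment> \<open>Chosen such that \<open>?B n ^ K = n powr \<epsilon> n\<close>; \<open>K\<close>
    is constant, so this tends to 0.\<close>
  define \<epsilon> where "\<epsilon> n = real K * (log 2 (?B n) / log 2 n)" for n :: nat
  have eps: "\<epsilon> \<longlonglongrightarrow> 0"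
    using tendsto_mult[OF tendsto_const[of "real K"] red.log_bound_tendsto] by (simp add: \<epsilon>_def[abs_def])
  have Bpow: "real (?B n) ^ K = real n powr \<epsilon> n" if "n \<ge> 2" for n
  proof -
    have B1: "real (?B n) > 0" using red.bound_pos[of n] by simp
    have y: "log 2 (real n) > 0" using that by simp
    have "real n powr \<epsilon> n = (2 powr log 2 n) powr \<epsilon> n" using that by simp
    also have "\<dots> = 2 powr (log 2 n * \<epsilon> n)" by (rule powr_powr)
    also have "log 2 n * \<epsilon> n = log 2 (?B n) * real K" using y by (simp add: \<epsilon>_def)
    also have "2 powr \<dots> = (2 powr log 2 (?B n)) powr real K" by (rule powr_powr[symmetric])
    also have "\<dots> = real (?B n) ^ K" using B1 by (simp add: powr_realpow)
    finally show ?thesis by simp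
  qed
  have "kOV_solver k ?d (link A (compS (progP k))) (\<lambda>n. real n powr (real k - \<delta> + \<epsilon> n))"
    unfolding kOV_solver_def decides_OV_def
  \<comment> \<open>\<open>C0\<close> is for the solver, \<open>a\<close> gives
    \<open>(n + 1) ^ a \<le> 2 ^ w\<close> and thereby the assumption \<open>W\<close>, and 1
    ensures \<open>w \<ge> 1\<close>.\<close>
  proof (intro exI[of _ "C0 + a + 1"] allI)
    fix C :: nat
    obtain f where f: "f \<in> O(\<lambda>n. real n powr (real k - \<delta>))" and run: "\<And>n w X s. n \<ge> 1 \<Longrightarrow>
        real C0 * log 2 (real n + 1) \<le> real w \<Longrightarrow> real w \<le> real C * log 2 (real n + 1) \<Longrightarrow>
        \<forall>t<k. \<forall>i<n. \<forall>j<?dA n. X t i j \<in> ?E w \<Longrightarrow> input_state w k n (?dA n) X s \<Longrightarrow>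
           \<exists>\<tau> s'. exec w A s \<tau> s' \<and> real \<tau> \<le> f n \<and>
              reg s' 0 = (if kOV_yes k n (?dA n) X then 1 else 0)"
      using C0[rule_format, of C] by blast
    define T where "T n = nat \<lfloor>f n\<rfloor>" for n
    define F where "F n = real (K * ?B n ^ K * (k * n + T n + 1))" for n
    have "F \<in> O(\<lambda>n. real n powr (real k - \<delta> + \<epsilon> n))"
    proof -
      obtain D where D: "D > 0" "eventually (\<lambda>n. norm (f n) \<le> D * norm (real n powr (real k - \<delta>))) sequentially"
        using landau_o.bigE[OF f] by blast
      have "eventually (\<lambda>n. norm (F n) \<le> (real K * (real k + D + 1)) * norm (real n powr (real k - \<delta> + \<epsilon> n))) sequentially"
        using D(2) eventually_ge_at_top[of "2::nat"]
      proof eventually_elim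
        case (elim n)
        let ?p = "real n powr (real k - \<delta>)"
        \<comment> \<open>The exponent is at least 1, so \<open>k * n\<close> and the constant are
          absorbed by the time of the solver.\<close>
        have "real n powr 1 \<le> ?p" using exp1 elim(2) by (intro powr_mono) auto
        then have np: "real n \<le> ?p" "1 \<le> ?p" using elim(2) by simp_all
        have "real (T n) \<le> \<bar>f n\<bar>" unfolding T_def by linarith
        then have Tn: "real (T n) \<le> D * ?p" using elim(1) by simp
        have "real k * real n \<le> real k * ?p" using np(1) by (intro mult_left_mono) auto
        then have "real (k * n + T n + 1) \<le> (real k + D + 1) * ?p"
          using Tn np(2) by (simp add: algebra_simps)
        then have "real K * real n powr \<epsilon> n * real (k * n + T n + 1) \<le> real K * real n powr \<epsilon> n * ((real k + D + 1) * ?p)"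
          by (intro mult_left_mono) auto
        also have "\<dots> = (real K * (real k + D + 1)) * real n powr (real k - \<delta> + \<epsilon> n)"
          by (simp add: powr_add)
        also have "real K * real n powr \<epsilon> n * real (k * n + T n + 1) = F n"
          unfolding F_def of_nat_mult[of "K * _"] of_nat_mult[of K] of_nat_power Bpow[OF elim(2)] ..
        also have "F n = norm (F n)" unfolding F_def by (simp only: norm_of_nat)
        finally show ?case by simp
      qed
      then show ?thesis by (rule bigoI)
    qed
    moreover have "\<exists>\<tau> s'. exec w (link A (compS (progP k))) s \<tau> s' \<and> real \<tau> \<le> F n \<and>
        reg s' 0 = (if kOV_yes k n (?d n) X then 1 else 0)"
      if n: "n \<ge> 1" and w: "real (C0 + a + 1) * log 2 (real n + 1) \<le> real w" "real w \<le> real C * log 2 (real n + 1)"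
        and X: "\<forall>t<k. \<forall>i<n. \<forall>j<?d n. X t i j \<in> {0, 1}" and s: "input_state w k n (?d n) X s" for n w X s
    proof -
      have y: "log 2 (real n + 1) \<ge> 1" using n by (subst le_log_iff) auto
      have le: "real x * log 2 (real n + 1) \<le> real w" if "x \<le> C0 + a + 1" for x
        using that w(1) y mult_right_mono[of "real x" "real (C0 + a + 1)" "log 2 (real n + 1)"] by linarith
      have "log 2 (real n + 1) \<le> real w" using le[of 1] by simp
      then have "1 \<le> real w" using y by linarith
      then have w1: "w \<ge> 1" by simp
      have "2 powr (real a * log 2 (real n + 1)) \<le> 2 powr real w" using le[of a] by (intro powr_mono) auto
      moreover have "2 powr (real a * log 2 (real n + 1)) = (2 powr log 2 (real n + 1)) powr real a"
        by (subst powr_powr) (simp add: mult.commute)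
      ultimately have "(real n + 1) ^ a \<le> 2 ^ w" by (simp add: powr_realpow)
      then have "real ((n + 1) ^ a) \<le> real (2 ^ w)" by (simp add: add.commute)
      then have "(n + 1) ^ a \<le> 2 ^ w" by (simp only: of_nat_le_iff)
      then have W: "2 * ((k * n + 1) * (?B n + 1)) \<le> 2 ^ w" using a[OF n] by linarith
      interpret code: tower_code k "?l n" "?N n" by (rule red.code)
      define b where "b = (\<lambda>h. if h then k * n else ?B n)"
      have ov: "ovram w b k (?l n) (?N n) n (?d n) (?B n)"
      proof unfold_locales
        show "code.M code.r + ?N n * ?N n + ?l n * ?N n + ?l n + 2 * ?N n + k + 3 \<le> ?B n"
          by (simp add: red.bound_def red.top_M_def red.top_U_def code.M_def)
      qed (use w1 W n in \<open>simp_all add: b_def red.num_def\<close>)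
      interpret ov: ovram w A b "T n" k "?l n" "?N n" n "?d n" "?B n" by (rule ov)
      have "\<exists>\<tau> s'. exec w (link A (compS (progP k))) s \<tau> s' \<and> \<tau> \<le> tb b (T n) (progP k) \<and>
          reg s' 0 = (if kOV_yes k n (?d n) X then 1 else 0)"
      proof (rule ov.run_progP[OF _ _ _ _ X s])
        fix X s assume "\<forall>t<k. \<forall>i<n. \<forall>j<?l n + 1. X t i j \<in> ?E w" "input_state w k n (?l n + 1) X s"
        then obtain \<tau> s' where 1: "exec w A s \<tau> s'" "real \<tau> \<le> f n"
            "reg s' 0 = (if kOV_yes k n (?l n + 1) X then 1 else 0)"
          using run[OF n le[of C0] w(2), of X s] unfolding dA by auto
        then have "\<tau> \<le> T n" unfolding T_def by linarith
        then show "\<exists>\<tau> s'. exec w A s \<tau> s' \<and> \<tau> \<le> T n \<and> reg s' 0 = (if kOV_yes k n (?l n + 1) X then 1 else 0)"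
          using 1 by blast
      qed (simp_all add: red.el_def red.bound_def)
      then obtain \<tau> s' where 2: "exec w (link A (compS (progP k))) s \<tau> s'" "\<tau> \<le> tb b (T n) (progP k)"
          "reg s' 0 = (if kOV_yes k n (?d n) X then 1 else 0)" by blast
      have "tb b (T n) (progP k) \<le> K * ?B n ^ K * (k * n + T n + 1)"
        using red.bound_pos[of n] by (intro K) (auto simp: b_def)
      then have "\<tau> \<le> K * ?B n ^ K * (k * n + T n + 1)" using 2(2) by linarith
      then have "real \<tau> \<le> F n" unfolding F_def by (simp only: of_nat_le_iff)
      then show ?thesis using 2 by blast
    qed
    ultimately show "\<exists>f\<in>O(\<lambda>n. real n powr (real k - \<delta> + \<epsilon> n)). \<forall>n\<ge>1. \<forall>w::nat.
        real (C0 + a + 1) * log 2 (real n + 1) \<le> real w \<and> real w \<le> real C * log 2 (real n + 1) \<longrightarrow>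
        (\<forall>X s. (\<forall>t<k. \<forall>i<n. \<forall>j<?d n. X t i j \<in> {0, 1}) \<and> input_state w k n (?d n) X s \<longrightarrow>
           (\<exists>\<tau> s'. exec w (link A (compS (progP k))) s \<tau> s' \<and> real \<tau> \<le> f n \<and>
              reg s' 0 = (if kOV_yes k n (?d n) X then 1 else 0)))"
      by blast
  qed
  then show ?thesis using eps unfolding red.dm_def by blast
qed

text \<open>The witness \<open>compS (progP k)\<close> is built from \<open>k\<close> alone: the
  dimension arrives in register 1, so \<open>c\<close> enters only the analysis.\<close>

theorem theoremA5:
  fixes k :: nat and c :: real
  assumes "k \<ge> 2" and "c > 0"
  shows "\<exists>R :: com. \<forall>(\<delta> :: real) (A :: com).
    \<delta> > 0 \<and>
    ZkOV_solver k (\<lambda>n. (3 * k + 1) ^ log_star n + 1) A (\<lambda>n. real n powr (real k - \<delta>)) \<longrightarrow>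
    (\<exists>\<epsilon> :: nat \<Rightarrow> real. \<epsilon> \<longlonglongrightarrow> 0 \<and>
       kOV_solver k (\<lambda>n. nat \<lfloor>c * log 2 (real n)\<rfloor>) (link A R)
         (\<lambda>n. real n powr (real k - \<delta> + \<epsilon> n)))"
  using kOV_solver_progP[OF assms] by blast

end
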